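(* Let $m,n$ be positive integers with $n/2\le m\le n-1$. Let $a_m,\dots,a_n$ be algebraically independent variables over $k$, $F=k(a_m,\dots,a_n)$, and $E=F[x]/(f(x))$, where \[ f(x)=x^n+a_m x^{n-m}+\dots+a_{n-1}x+a_n . \] Then $\tau(E/F)=n-m$. Equivalently, every polynomial obtained from $f(x)$ by a Tschirnhaus transformation has at least $n-m$ coefficients that are algebraically independent over $k$, and $n-m$ is attained.
   Context: $k$ is a field of characteristic $0$ (not necessarily algebraically closed). For a field extension $E/F$ of degree $n$ with $k\subset F$, and a generator $z$ of $E$ over $F$ (i.e. $E=F(z)$) with minimal polynomial $t^n+\alpha_1(z)t^{n-1}+\dots+\alpha_n(z)$ over $F$, $\tau(E/F)$ is the minimum of $\operatorname{trdeg}_k k(\alpha_1(z),\dots,\alpha_n(z))$ over all such generators $z$. A Tschirnhaus transformation of an irreducible monic polynomial $\alpha\in F[x]$ of degree $n$ is an isomorphism $F[x]/(\alpha(x))\cong F[t]/(\beta(t))$ with $\beta$ monic irreducible of degree $n$; $\beta$ is the minimal polynomial of a generator of $F[x]/(\alpha(x))$ over $F$. *)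

theory Defs
  imports "HOL-Computational_Algebra.Polynomial"
begin

text \<open>All fields are subsets of an ambient field of type 'K (characteristic 0).\<close>

definition is_subfield :: "'K::field set \<Rightarrow> bool" where
  "is_subfield L \<longleftrightarrow> 0 \<in> L \<and> 1 \<in> L \<and>
     (\<forall>x\<in>L. \<forall>y\<in>L. x + y \<in> L \<and> x * y \<in> L) \<and>
     (\<forall>x\<in>L. - x \<in> L \<and> inverse x \<in> L)"

definition field_gen :: "'K::field set \<Rightarrow> 'K set \<Rightarrow> 'K set" where
  "field_gen k S = \<Inter> {L. is_subfield L \<and> k \<union> S \<subseteq> L}"

text \<open>Algebraic independence over k of a family x indexed by I:
  no nontrivial polynomial relation with coefficients in k.
  A polynomial is a finitely supported coefficient function on exponent vectors
  (finitely supported, supported in I).\<close>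
definition alg_indep :: "'K::field set \<Rightarrow> 'i set \<Rightarrow> ('i \<Rightarrow> 'K) \<Rightarrow> bool" where
  "alg_indep k I x \<longleftrightarrow>
    (\<forall>c :: ('i \<Rightarrow> nat) \<Rightarrow> 'K.
       finite {e. c e \<noteq> 0} \<and> (\<forall>e. c e \<in> k) \<and>
       (\<forall>e. c e \<noteq> 0 \<longrightarrow> finite {i. e i \<noteq> 0} \<and> {i. e i \<noteq> 0} \<subseteq> I) \<and>
       (\<Sum>e | c e \<noteq> 0. c e * (\<Prod>i | e i \<noteq> 0. x i ^ e i)) = 0
       \<longrightarrow> (\<forall>e. c e = 0))"

definition trdeg :: "'K::field set \<Rightarrow> 'K set \<Rightarrow> nat" where
  "trdeg k A = (GREATEST d. \<exists>S. S \<subseteq> A \<and> finite S \<and> card S = d \<and> alg_indep k S id)"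

definition is_min_poly :: "'K::field set \<Rightarrow> 'K \<Rightarrow> 'K poly \<Rightarrow> bool" where
  "is_min_poly F z p \<longleftrightarrow> lead_coeff p = 1 \<and> set (coeffs p) \<subseteq> F \<and> poly p z = 0 \<and>
     (\<forall>q. q \<noteq> 0 \<and> set (coeffs q) \<subseteq> F \<and> poly q z = 0 \<longrightarrow> degree p \<le> degree q)"

definition min_poly :: "'K::field set \<Rightarrow> 'K \<Rightarrow> 'K poly" where
  "min_poly F z = (THE p. is_min_poly F z p)"

definition tau :: "'K::field set \<Rightarrow> 'K set \<Rightarrow> 'K set \<Rightarrow> nat" where
  "tau k F E = (LEAST t. \<exists>z\<in>E. field_gen F {z} = E \<and>
       t = trdeg k (field_gen k (set (coeffs (min_poly F z)))))"

end

(*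
A rescaling of x by a_(n-1)/a_n makes the last two coefficients of f equal, so n - m is attained.

For the lower bound put r = n - m. There is a polynomial f0 = x^n + (terms of degree at most r)
with exactly r double roots u_1, ..., u_r, all other roots being simple. Deform it to f0 + t W with W monic of
degree r and W(u_i) = w_i independent variables: its coefficients are algebraically
independent, so F embeds into Laurent series in t over the rational functions in the w_i.
Near u_i two roots of f0 + t W are power series in sqrt(e_i t), where e_i is a constant
multiple of w_i, and sqrt(e_i t) -> -sqrt(e_i t) exchanges them. Let z be any generator of E over F, and let z_i, z_i'
be the conjugates of z belonging to these two roots. They differ, and D_i = (z_i - z_i')^2 is a
series in t whose leading coefficient is a square times an odd power of e_i. Hence the
exponents of w_1, ..., w_r in the leading coefficients of D_1, ..., D_r form the identity matrix
modulo 2, which makes D_1, ..., D_r algebraically independent. As they are algebraic over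
the field generated by the coefficients of the minimal polynomial of z, that field has transcendence degree at least r.
*)
theory Submission
  imports "HOL-Algebra.Algebraic_Closure_Type" "HOL-Library.Poly_Mapping"
    "HOL-Computational_Algebra.Computational_Algebra" Defs
begin

text \<open>The hypothesis \<open>n \<le> 2 * m\<close> says r <= m, so that m distinct roots, r of
  them doubled, have total degree n. That f0 lacks the terms of degrees r + 1, ..., n - 1 amounts to
  m - 1 homogeneous equations in these m roots. A nonzero solution is found as the residue of a
  place on a rational function field, and comparing degrees in x f0' - n f0 shows that its entries
  are automatically distinct. Such residues live in an algebraic closure, so k is merely embedded in
  the field of constants. The obstacle is that the embeddings of E sending its root to a root near
  u_i end in fields of series in s = sqrt(e_i t), a different one for each i, so the z_i cannot be
  compared with each other. Only what is invariant under s to -s descends to the series in t, and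
  the square of z_i - z_i' does. The difference is odd in s: its lowest term is c s^p with p odd,
  whose square is c^2 e_i^p t^p. Nothing is known about c, which may involve every w_j; reading
  exponents modulo 2 removes it.\<close>

subsection \<open>Places\<close>

text \<open>Partial ring homomorphisms are represented by their graphs, so that they can be
  glued by Zorn's lemma and their domain need not be carried along.\<close>

definition subring_rel :: "('a::comm_ring_1 \<times> 'b::comm_ring_1) set \<Rightarrow> bool" where
  "subring_rel G \<longleftrightarrow> (1, 1) \<in> G \<and>
     (\<forall>x y x' y'. (x, y) \<in> G \<and> (x', y') \<in> G \<longrightarrow> (x + x', y + y') \<in> G \<and> (x * x', y * y') \<in> G) \<and>
     (\<forall>x y. (x, y) \<in> G \<longrightarrow> (- x, - y) \<in> G)"

text \<open>For a subring relation the fibre over 0 decides: two values of the same element differ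
  by a value of 0 (\<open>srel_single_valued\<close>).\<close>

definition functional_rel :: "('a::zero \<times> 'b::zero) set \<Rightarrow> bool" where
  "functional_rel G \<longleftrightarrow> (\<forall>y. (0, y) \<in> G \<longrightarrow> y = 0)"

text \<open>The domain of such a \<open>G\<close> is a valuation ring. By the last clause every
  element with nonzero value is a unit of it, so the elements of value 0 form its maximal
  ideal.\<close>

definition place_rel :: "('a::field \<times> 'b::field) set \<Rightarrow> bool" where
  "place_rel G \<longleftrightarrow> subring_rel G \<and> functional_rel G \<and>
     (\<forall>x. x \<noteq> 0 \<longrightarrow> x \<in> Domain G \<or> inverse x \<in> Domain G) \<and>
     (\<forall>x y. (x, y) \<in> G \<and> y \<noteq> 0 \<longrightarrow> (inverse x, inverse y) \<in> G)"

definition poly_rel :: "('a::zero \<times> 'b::zero) set \<Rightarrow> 'a poly \<Rightarrow> 'b poly \<Rightarrow> bool" where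
  "poly_rel G P Q \<longleftrightarrow> (\<forall>i. (coeff P i, coeff Q i) \<in> G)"

text \<open>For a subring relation \<open>G\<close> this is the least subring relation that contains
  \<open>G\<close> and \<open>(x, y)\<close>. It may be multi-valued; whether it is functional tests
  if \<open>y\<close> is an admissible value for \<open>x\<close>.\<close>

definition adjoin_rel :: "('a::comm_ring_1 \<times> 'b::comm_ring_1) set \<Rightarrow> 'a \<Rightarrow> 'b \<Rightarrow> ('a \<times> 'b) set" where
  "adjoin_rel G x y = {(poly P x, poly Q y) | P Q. poly_rel G P Q}"

lemma poly_altdef_le: "degree p \<le> N \<Longrightarrow> poly p x = (\<Sum>i\<le>N. coeff p i * x ^ i)"
  for x :: "'a::comm_semiring_1"
  unfolding poly_altdef by (intro sum.mono_neutral_left) (auto simp: coeff_eq_0)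

context
  fixes G :: "('a::comm_ring_1 \<times> 'b::comm_ring_1) set"
  assumes G: "subring_rel G"
begin

lemma srel_1: "(1, 1) \<in> G"
  and srel_add: "(x, y) \<in> G \<Longrightarrow> (x', y') \<in> G \<Longrightarrow> (x + x', y + y') \<in> G"
  and srel_mult: "(x, y) \<in> G \<Longrightarrow> (x', y') \<in> G \<Longrightarrow> (x * x', y * y') \<in> G"
  and srel_uminus: "(x, y) \<in> G \<Longrightarrow> (- x, - y) \<in> G"
  using G unfolding subring_rel_def by blast+

lemma srel_0: "(0, 0) \<in> G"
  using srel_add[OF srel_1 srel_uminus[OF srel_1]] by simp

lemma srel_diff: "(x, y) \<in> G \<Longrightarrow> (x', y') \<in> G \<Longrightarrow> (x - x', y - y') \<in> G"
  using srel_add[OF _ srel_uminus] by fastforce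

lemma srel_sum: "(\<And>i. i \<in> I \<Longrightarrow> (f i, g i) \<in> G) \<Longrightarrow> (sum f I, sum g I) \<in> G"
  by (induction I rule: infinite_finite_induct) (auto simp: srel_0 srel_add)

lemma srel_power: "(x, y) \<in> G \<Longrightarrow> (x ^ n, y ^ n) \<in> G"
  by (induction n) (auto simp: srel_1 srel_mult)

lemma poly_rel_const: "(x, y) \<in> G \<Longrightarrow> poly_rel G [:x:] [:y:]"
  by (auto simp: poly_rel_def coeff_pCons srel_0 split: nat.splits)

lemma poly_rel_pCons: "(x, y) \<in> G \<Longrightarrow> poly_rel G P Q \<Longrightarrow> poly_rel G (pCons x P) (pCons y Q)"
  by (auto simp: poly_rel_def coeff_pCons srel_0 split: nat.splits)

lemma poly_rel_add: "poly_rel G P Q \<Longrightarrow> poly_rel G P' Q' \<Longrightarrow> poly_rel G (P + P') (Q + Q')"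
  by (auto simp: poly_rel_def srel_add)

lemma poly_rel_uminus: "poly_rel G P Q \<Longrightarrow> poly_rel G (- P) (- Q)"
  by (auto simp: poly_rel_def srel_uminus)

lemma poly_rel_diff: "poly_rel G P Q \<Longrightarrow> poly_rel G P' Q' \<Longrightarrow> poly_rel G (P - P') (Q - Q')"
  by (auto simp: poly_rel_def srel_diff)

lemma poly_rel_mult: "poly_rel G P Q \<Longrightarrow> poly_rel G P' Q' \<Longrightarrow> poly_rel G (P * P') (Q * Q')"
  by (auto simp: poly_rel_def coeff_mult intro!: srel_sum srel_mult)

lemma poly_rel_smult: "(x, y) \<in> G \<Longrightarrow> poly_rel G P Q \<Longrightarrow> poly_rel G (smult x P) (smult y Q)"
  by (auto simp: poly_rel_def srel_mult)

lemma poly_rel_monom: "(x, y) \<in> G \<Longrightarrow> poly_rel G (monom x n) (monom y n)"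
  by (auto simp: poly_rel_def srel_0)

lemma poly_rel_0: "poly_rel G 0 0" and poly_rel_1: "poly_rel G 1 1"
  by (auto simp: poly_rel_def srel_0 srel_1 coeff_1)

lemma poly_rel_sum: "(\<And>i. i \<in> I \<Longrightarrow> poly_rel G (f i) (g i)) \<Longrightarrow> poly_rel G (sum f I) (sum g I)"
  by (induction I rule: infinite_finite_induct) (auto simp: poly_rel_0 poly_rel_add)

lemma poly_rel_prod: "(\<And>i. i \<in> I \<Longrightarrow> poly_rel G (f i) (g i)) \<Longrightarrow> poly_rel G (prod f I) (prod g I)"
  by (induction I rule: infinite_finite_induct) (auto simp: poly_rel_1 poly_rel_mult)

lemma poly_rel_power: "poly_rel G P Q \<Longrightarrow> poly_rel G (P ^ n) (Q ^ n)"
  by (induction n) (auto simp: poly_rel_1 poly_rel_mult)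

lemma adjoin_rel_subset: "G \<subseteq> adjoin_rel G x y"
proof
  fix z assume "z \<in> G"
  then show "z \<in> adjoin_rel G x y"
    using poly_rel_const[of "fst z" "snd z"]
    by (auto simp: adjoin_rel_def intro!: exI[of _ "[:fst z:]"] exI[of _ "[:snd z:]"] prod_eqI)
qed

lemma adjoin_rel_mem: "(x, y) \<in> adjoin_rel G x y"
  using poly_rel_pCons[OF srel_0 poly_rel_const[OF srel_1]]
  by (auto simp: adjoin_rel_def intro!: exI[of _ "[:0, 1:]"])

lemma subring_rel_adjoin: "subring_rel (adjoin_rel G x y)"
  unfolding subring_rel_def
proof (intro conjI allI impI)
  show "(1, 1) \<in> adjoin_rel G x y"
    using adjoin_rel_subset srel_1 by blast
next
  fix u v u' v' assume *: "(u, v) \<in> adjoin_rel G x y \<and> (u', v') \<in> adjoin_rel G x y"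
  then obtain P Q P' Q' where PQ: "poly_rel G P Q" "poly_rel G P' Q'"
    "u = poly P x" "v = poly Q y" "u' = poly P' x" "v' = poly Q' y"
    by (auto simp: adjoin_rel_def)
  show "(u + u', v + v') \<in> adjoin_rel G x y"
    using poly_rel_add[OF PQ(1,2)] by (auto simp: adjoin_rel_def PQ) (metis poly_add)
  show "(u * u', v * v') \<in> adjoin_rel G x y"
    using poly_rel_mult[OF PQ(1,2)] by (auto simp: adjoin_rel_def PQ) (metis poly_mult)
next
  fix u v assume *: "(u, v) \<in> adjoin_rel G x y"
  then obtain P Q where PQ: "poly_rel G P Q" "u = poly P x" "v = poly Q y"
    by (auto simp: adjoin_rel_def)
  show "(- u, - v) \<in> adjoin_rel G x y"
    using poly_rel_uminus[OF PQ(1)] by (auto simp: adjoin_rel_def PQ) (metis poly_minus)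
qed

lemma srel_single_valued:
  assumes "functional_rel G" "(x, y) \<in> G" "(x, y') \<in> G"
  shows "y = y'"
  using srel_diff[OF assms(2,3)] assms(1) by (auto simp: functional_rel_def)

end

section \<open>Maximal partial homomorphisms into an algebraically closed field\<close>

context
  fixes G :: "('a::field \<times> 'b::alg_closed_field) set"
  assumes G: "subring_rel G" "functional_rel G"
    and max: "\<And>x y. functional_rel (adjoin_rel G x y) \<Longrightarrow> (x, y) \<in> G"
begin

text \<open>The pair of inverses can be adjoined consistently: multiplication by a power of
  \<open>a\<close> turns a polynomial relation in \<open>inverse a\<close> into a relation inside
  \<open>G\<close>.\<close>

lemma maximal_rel_inverse:
  assumes "(a, y) \<in> G" "y \<noteq> 0"
  shows "(inverse a, inverse y) \<in> G"
proof (rule max, unfold functional_rel_def, intro allI impI)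
  fix z assume "(0, z) \<in> adjoin_rel G (inverse a) (inverse y)"
  then obtain P Q where PQ: "poly_rel G P Q" "poly P (inverse a) = 0" "z = poly Q (inverse y)"
    by (auto simp: adjoin_rel_def)
  have a: "a \<noteq> 0" using assms G(2) by (auto simp: functional_rel_def)
  \<comment> \<open>The two degrees may differ, since a nonzero coefficient of \<open>P\<close> can
    have the value 0; one exponent has to clear both denominators.\<close>
  define N where "N = max (degree P) (degree Q)"
  have *: "(\<Sum>i\<le>N. coeff P i * a ^ (N - i)) = a ^ N * poly P (inverse a)"
    "(\<Sum>i\<le>N. coeff Q i * y ^ (N - i)) = y ^ N * poly Q (inverse y)"
  proof -
    have "poly P (inverse a) = (\<Sum>i\<le>N. coeff P i * inverse a ^ i)"
      "poly Q (inverse y) = (\<Sum>i\<le>N. coeff Q i * inverse y ^ i)"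
      by (auto simp: N_def intro!: poly_altdef_le)
    then show "(\<Sum>i\<le>N. coeff P i * a ^ (N - i)) = a ^ N * poly P (inverse a)"
      "(\<Sum>i\<le>N. coeff Q i * y ^ (N - i)) = y ^ N * poly Q (inverse y)"
      using a assms(2) by (auto simp: sum_distrib_left power_diff field_simps intro!: sum.cong)
  qed
  have "(\<Sum>i\<le>N. coeff P i * a ^ (N - i), \<Sum>i\<le>N. coeff Q i * y ^ (N - i)) \<in> G"
    using PQ(1) assms(1) G(1)
    by (auto simp: poly_rel_def intro!: srel_sum srel_mult srel_power)
  then have "y ^ N * z = 0"
    using G(2) unfolding * PQ(2) PQ(3) by (auto simp: functional_rel_def)
  then show "z = 0" using assms(2) by simp
qed

text \<open>The values \<open>Q\<close> of the polynomials \<open>P\<close> that vanish at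
  \<open>x\<close> form an ideal \<open>J\<close> over the field of values of \<open>G\<close>. A
  common zero of \<open>J\<close> would be an admissible value for \<open>x\<close>, so by
  maximality there is none. In an algebraically closed field a generator of \<open>J\<close> is then
  a nonzero constant.\<close>

lemma maximal_rel_ideal:
  assumes x: "x \<notin> Domain G"
  shows "\<exists>P. poly_rel G P 1 \<and> poly P x = 0"
proof -
  define J where "J = {Q. \<exists>P. poly_rel G P Q \<and> poly P x = 0}"
  have no_root: "\<exists>Q\<in>J. poly Q y \<noteq> 0" for y
  proof (rule ccontr)
    assume *: "\<not> ?thesis"
    have "functional_rel (adjoin_rel G x y)"
      using * by (auto simp: functional_rel_def adjoin_rel_def J_def)
    from max[OF this] show False using x by auto
  qed
  have J_diff: "Q - Q' \<in> J" if "Q \<in> J" "Q' \<in> J" for Q Q'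
    using that poly_rel_diff[OF G(1)] unfolding J_def by (fastforce simp: poly_diff)
  have J_mult: "S * Q \<in> J" if "Q \<in> J" "poly_rel G R S" for Q R S
    using that poly_rel_mult[OF G(1)] unfolding J_def by fastforce
  have J_range: "\<exists>a. (a, coeff Q i) \<in> G" if "Q \<in> J" for Q i
    using that by (auto simp: J_def poly_rel_def)
  obtain Q0 where "Q0 \<in> J" "Q0 \<noteq> 0" using no_root[of 0] poly_0 by metis
  then have "\<exists>Q. (Q \<in> J \<and> Q \<noteq> 0) \<and> (\<forall>Q'. Q' \<in> J \<and> Q' \<noteq> 0 \<longrightarrow> degree Q \<le> degree Q')"
    by (intro ex_has_least_nat[of "\<lambda>Q. Q \<in> J \<and> Q \<noteq> 0" Q0]) auto
  then obtain Q where Q: "Q \<in> J" "Q \<noteq> 0"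
    and Qmin: "\<And>Q'. Q' \<in> J \<Longrightarrow> Q' \<noteq> 0 \<Longrightarrow> degree Q \<le> degree Q'"
    by blast
  have lc: "lead_coeff Q \<noteq> 0" using Q by simp
  obtain a where a: "(a, lead_coeff Q) \<in> G" using J_range[OF Q(1)] by blast
  note inv = maximal_rel_inverse[OF a lc]
  \<comment> \<open>Division by \<open>Q\<close> within \<open>J\<close>, one leading term at a
    time, which is possible because \<open>lead_coeff Q\<close> is invertible among the values of
    \<open>G\<close>. Every zero of \<open>Q\<close> is therefore a common zero of
    \<open>J\<close>.\<close>
  have vanish: "poly Q' y = 0" if "Q' \<in> J" "poly Q y = 0" for Q' y
    using that(1)
  proof (induction "degree Q'" arbitrary: Q' rule: less_induct)
    case less
    show ?case
    proof (cases "Q' = 0")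
      case False
      then have deg: "degree Q \<le> degree Q'" using Qmin less.prems by blast
      obtain b where b: "(b, lead_coeff Q') \<in> G" using J_range[OF less.prems] by blast
      define c where "c = lead_coeff Q' * inverse (lead_coeff Q)"
      define S where "S = monom c (degree Q' - degree Q)"
      have c0: "c \<noteq> 0" using False lc by (simp add: c_def)
      have "poly_rel G (monom (b * inverse a) (degree Q' - degree Q)) S"
        unfolding S_def c_def by (intro poly_rel_monom[OF G(1)] srel_mult[OF G(1)] b inv)
      from J_mult[OF Q(1) this] have SQ: "S * Q \<in> J" .
      have R: "Q' - S * Q \<in> J" by (rule J_diff[OF less.prems SQ])
      have "poly (Q' - S * Q) y = 0"
      proof (cases "Q' - S * Q = 0")
        case nz: False
        have dS: "degree (S * Q) = degree Q'"
        proof -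
          have "S \<noteq> 0" "degree S = degree Q' - degree Q"
            using c0 by (auto simp: S_def degree_monom_eq)
          then show ?thesis using Q deg by (simp add: degree_mult_eq)
        qed
        have "lead_coeff (S * Q) = lead_coeff Q'"
          using lc c0 by (simp only: lead_coeff_mult S_def lead_coeff_monom) (simp add: c_def)
        then have "coeff (Q' - S * Q) (degree Q') = 0" using dS by simp
        moreover have "degree (Q' - S * Q) \<le> degree Q'"
          using degree_diff_le[of Q' "degree Q'" "S * Q"] dS by simp
        ultimately have "degree (Q' - S * Q) < degree Q'"
          using nz by (metis leading_coeff_0_iff order_le_less)
        from less.hyps[OF this R] show ?thesis .
      qed simp
      then show ?thesis using that(2) by simp
    qed simp
  qed
  have "degree Q = 0"
  proof (rule ccontr)
    assume "degree Q \<noteq> 0"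
    then obtain y where "poly Q y = 0" using alg_closed_imp_poly_has_root by blast
    with vanish no_root show False by blast
  qed
  then obtain c where c: "Q = [:c:]" using degree_eq_zeroE by blast
  have "[:inverse c:] * Q \<in> J"
    by (rule J_mult[OF Q(1) poly_rel_const[OF G(1)]]) (use inv c in simp)
  moreover have "[:inverse c:] * Q = 1" using lc c by simp
  ultimately show ?thesis by (simp add: J_def)
qed

text \<open>Having the value polynomial 1 means that the constant coefficient has value 1 and all
  others have value 0. The relation for \<open>inverse x\<close>, multiplied by the power
  \<open>N\<close> of \<open>x\<close>, becomes a polynomial \<open>S\<close> whose coefficient of
  degree \<open>N\<close> is the unit \<open>p0\<close>, so a multiple \<open>c\<close> of
  \<open>S\<close> cancels the leading term of \<open>P\<close>. As \<open>c\<close> has value 0,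
  the value polynomial remains 1.\<close>

lemma maximal_rel_reduce:
  assumes P: "poly_rel G P 1" "poly P x = 0" and P': "poly_rel G P' 1" "poly P' (inverse x) = 0"
    and deg: "degree P' \<le> degree P" and x: "x \<noteq> 0"
  shows "\<exists>R. poly_rel G R 1 \<and> poly R x = 0 \<and> degree R < degree P"
proof -
  define N where "N = degree P"
  have N: "N > 0"
  proof (rule ccontr)
    assume "\<not> N > 0"
    then obtain c where "P = [:c:]" unfolding N_def using degree_eq_zeroE by blast
    then have "coeff P 0 = 0" using P(2) by simp
    moreover have "(coeff P 0, 1) \<in> G" using P(1) by (auto simp: poly_rel_def dest: spec[of _ 0])
    ultimately show False using G(2) by (auto simp: functional_rel_def)
  qed
  define p0 where "p0 = coeff P' 0"
  have p0: "(p0, 1) \<in> G" using P'(1) by (auto simp: poly_rel_def p0_def dest: spec[of _ 0])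
  then have p0nz: "p0 \<noteq> 0" using G(2) by (auto simp: functional_rel_def)
  define c where "c = coeff P N * inverse p0"
  have "(coeff P N, 0) \<in> G" using P(1) N by (auto simp: poly_rel_def dest!: spec[of _ N])
  from srel_mult[OF G(1) this maximal_rel_inverse[OF p0]] have c: "(c, 0) \<in> G"
    by (simp add: c_def)
  define S where "S = (\<Sum>j\<le>degree P'. monom (coeff P' j) (N - j))"
  define S' :: "'b poly" where "S' = (\<Sum>j\<le>degree P'. monom (coeff 1 j) (N - j))"
  have SS': "poly_rel G S S'"
    unfolding S_def S'_def using P'(1)
    by (intro poly_rel_sum[OF G(1)] poly_rel_monom[OF G(1)]) (auto simp: poly_rel_def)
  define R where "R = P - smult c S"
  have "poly_rel G R (1 - smult 0 S')"
    unfolding R_def by (intro poly_rel_diff[OF G(1)] poly_rel_smult[OF G(1)] P c SS')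
  then have R1: "poly_rel G R 1" by simp
  have "poly S x = x ^ N * poly P' (inverse x)"
    using x deg unfolding S_def N_def
    by (simp add: poly_sum poly_monom poly_altdef[of P'] sum_distrib_left power_diff field_simps)

  then have R2: "poly R x = 0" using P(2) P'(2) by (simp add: R_def)
  have "degree R \<le> N"
    unfolding R_def S_def N_def
    by (intro degree_diff_le order.trans[OF degree_smult_le] degree_sum_le)
       (auto intro: order.trans[OF degree_monom_le])
  moreover have "coeff R N = 0"
  proof -
    have "coeff S N = (\<Sum>j\<le>degree P'. if j = 0 then p0 else 0)"
      unfolding S_def coeff_sum using deg N by (intro sum.cong) (auto simp: N_def p0_def)
    also have "\<dots> = p0" by (simp add: sum.delta)
    finally show ?thesis using p0nz by (simp add: R_def c_def)
  qed
  ultimately have "degree R < N" using N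
    by (metis degree_0 leading_coeff_0_iff order_le_less)
  with R1 R2 show ?thesis by (auto simp: N_def)
qed

text \<open>Otherwise \<open>x\<close> and its inverse both satisfy relations of value 1, and
  \<open>maximal_rel_reduce\<close> lowers the larger of the two minimal degrees.\<close>

lemma maximal_rel_dichotomy:
  assumes x: "x \<noteq> 0"
  shows "x \<in> Domain G \<or> inverse x \<in> Domain G"
proof (rule ccontr)
  assume "\<not> ?thesis"
  then have nd: "x \<notin> Domain G" "inverse x \<notin> Domain G" by auto
  let ?A = "\<lambda>x P. poly_rel G P 1 \<and> poly P x = 0"
  have least: "\<exists>P. ?A x P \<and> (\<forall>R. ?A x R \<longrightarrow> degree P \<le> degree R)" if "\<exists>P. ?A x P" for x
  proof -
    from that obtain P where "?A x P" by blast
    from ex_has_least_nat[of "?A x", OF this] show ?thesis by blast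
  qed
  obtain P where P: "?A x P" "\<And>R. ?A x R \<Longrightarrow> degree P \<le> degree R"
    using least[OF maximal_rel_ideal[OF nd(1)]] by blast
  obtain P' where P': "?A (inverse x) P'" "\<And>R. ?A (inverse x) R \<Longrightarrow> degree P' \<le> degree R"
    using least[OF maximal_rel_ideal[OF nd(2)]] by blast
  show False
  proof (cases "degree P' \<le> degree P")
    case True
    then show ?thesis using maximal_rel_reduce[of P x P'] P P' x by (meson linorder_not_less)
  next
    case False
    then show ?thesis using maximal_rel_reduce[of P' "inverse x" P] P P' x
      by (metis inverse_inverse_eq inverse_nonzero_iff_nonzero linorder_not_less nle_le)
  qed
qed

end

text \<open>Chevalley's extension theorem.\<close>

theorem place_extension:
  fixes G0 :: "('a::field \<times> 'b::alg_closed_field) set"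
  assumes "subring_rel G0" "functional_rel G0"
  shows "\<exists>G. G0 \<subseteq> G \<and> place_rel G"
proof -
  define A where "A = {G. G0 \<subseteq> G \<and> subring_rel G \<and> functional_rel G}"
  have "\<exists>M\<in>A. \<forall>Y\<in>A. M \<subseteq> Y \<longrightarrow> Y = M"
  proof (rule subset_Zorn_nonempty)
    show "A \<noteq> {}" using assms by (auto simp: A_def)
  next
    fix C assume C: "C \<noteq> {}" "subset.chain A C"
    have sub: "\<And>Y. Y \<in> C \<Longrightarrow> G0 \<subseteq> Y \<and> subring_rel Y \<and> functional_rel Y"
      using C by (auto simp: subset.chain_def A_def)
    have two: "\<exists>Y\<in>C. u \<in> Y \<and> v \<in> Y" if uv: "u \<in> \<Union>C" "v \<in> \<Union>C" for u v
    proof -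
      obtain Y Z where YZ: "Y \<in> C" "u \<in> Y" "Z \<in> C" "v \<in> Z" using uv by blast
      then have "Y \<subseteq> Z \<or> Z \<subseteq> Y" using C(2) by (auto simp: subset_chain_def)
      then show ?thesis using YZ by blast
    qed
    have "subring_rel (\<Union>C)"
      unfolding subring_rel_def
    proof (intro conjI allI impI)
      obtain Y where "Y \<in> C" using C(1) by blast
      then show "(1, 1) \<in> \<Union> C" using sub[of Y] srel_1[of Y] by auto
    next
      fix x y x' y' assume "(x, y) \<in> \<Union> C \<and> (x', y') \<in> \<Union> C"
      then obtain Y where "Y \<in> C" "(x, y) \<in> Y" "(x', y') \<in> Y" using two by metis
      then show "(x + x', y + y') \<in> \<Union> C" "(x * x', y * y') \<in> \<Union> C"
        using srel_add[of Y x y x' y'] srel_mult[of Y x y x' y'] sub[of Y] by auto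
    next
      fix x y assume "(x, y) \<in> \<Union> C"
      then obtain Y where "Y \<in> C" "(x, y) \<in> Y" by blast
      then show "(- x, - y) \<in> \<Union> C" using sub[of Y] srel_uminus[of Y x y] by auto
    qed
    moreover have "functional_rel (\<Union>C)"
      using sub by (auto simp: functional_rel_def)
    moreover have "G0 \<subseteq> \<Union>C" using sub C(1) by blast
    ultimately show "\<Union>C \<in> A" by (simp add: A_def)
  qed
  then obtain G where GA: "G \<in> A" and Gmax: "\<forall>Y\<in>A. G \<subseteq> Y \<longrightarrow> Y = G" by (rule bexE)
  have G: "G0 \<subseteq> G" "subring_rel G" "functional_rel G" using GA by (auto simp: A_def)
  have "(x, y) \<in> G" if "functional_rel (adjoin_rel G x y)" for x y
  proof -
    have "adjoin_rel G x y \<in> A"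
      using subring_rel_adjoin[OF G(2)] that subset_trans[OF G(1) adjoin_rel_subset[OF G(2)]]
      by (simp add: A_def)
    then have "adjoin_rel G x y = G" using Gmax adjoin_rel_subset[OF G(2)] by blast
    then show ?thesis using adjoin_rel_mem[OF G(2)] by metis
  qed
  then have "place_rel G"
    using G maximal_rel_dichotomy[OF G(2,3)] maximal_rel_inverse[OF G(2,3)]
    unfolding place_rel_def by simp
  with G show ?thesis by blast
qed

subsection \<open>Subfields and algebraic elements\<close>

definition is_subring :: "'a::comm_ring_1 set \<Rightarrow> bool" where
  "is_subring R \<longleftrightarrow> 1 \<in> R \<and> (\<forall>x\<in>R. \<forall>y\<in>R. x + y \<in> R \<and> x * y \<in> R) \<and> (\<forall>x\<in>R. - x \<in> R)"

definition poly_over :: "'a::zero set \<Rightarrow> 'a poly \<Rightarrow> bool" where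
  "poly_over R p \<longleftrightarrow> (\<forall>i. coeff p i \<in> R)"

context
  fixes R :: "'a::comm_ring_1 set"
  assumes R: "is_subring R"
begin

lemma subring_1: "1 \<in> R"
  and subring_add: "x \<in> R \<Longrightarrow> y \<in> R \<Longrightarrow> x + y \<in> R"
  and subring_mult: "x \<in> R \<Longrightarrow> y \<in> R \<Longrightarrow> x * y \<in> R"
  and subring_uminus: "x \<in> R \<Longrightarrow> - x \<in> R"
  using R by (auto simp: is_subring_def)

lemma subring_diff: "x \<in> R \<Longrightarrow> y \<in> R \<Longrightarrow> x - y \<in> R"
  using subring_add[OF _ subring_uminus] by fastforce

lemma subring_0: "0 \<in> R"
  using subring_diff[OF subring_1 subring_1] by simp

lemma subring_sum: "(\<And>i. i \<in> I \<Longrightarrow> f i \<in> R) \<Longrightarrow> sum f I \<in> R"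
  by (induction I rule: infinite_finite_induct) (auto simp: subring_0 subring_add)

lemma subring_prod: "(\<And>i. i \<in> I \<Longrightarrow> f i \<in> R) \<Longrightarrow> prod f I \<in> R"
  by (induction I rule: infinite_finite_induct) (auto simp: subring_1 subring_mult)

lemma subring_power: "x \<in> R \<Longrightarrow> x ^ n \<in> R"
  by (induction n) (auto simp: subring_1 subring_mult)

lemma subring_poly: "poly_over R p \<Longrightarrow> x \<in> R \<Longrightarrow> poly p x \<in> R"
  by (auto simp: poly_altdef poly_over_def intro!: subring_sum subring_mult subring_power)

lemma poly_over_coeffs: "poly_over R p \<longleftrightarrow> set (coeffs p) \<subseteq> R"
proof
  assume "set (coeffs p) \<subseteq> R"
  then have "coeff p i \<in> R" for i
    using coeff_in_coeffs[of p i] le_degree[of p i] subring_0 by (cases "p = 0"; cases "coeff p i = 0") auto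
  then show "poly_over R p" by (simp add: poly_over_def)
qed (auto simp: poly_over_def coeffs_def split: if_splits)

lemma poly_over_pConsD: "poly_over R (pCons a p) \<Longrightarrow> a \<in> R \<and> poly_over R p"
  unfolding poly_over_def by (metis coeff_pCons_0 coeff_pCons_Suc)

lemma poly_over_pCons: "x \<in> R \<Longrightarrow> poly_over R p \<Longrightarrow> poly_over R (pCons x p)"
  by (auto simp: poly_over_def coeff_pCons split: nat.splits)

lemma poly_over_monom: "x \<in> R \<Longrightarrow> poly_over R (monom x n)"
  by (auto simp: poly_over_def subring_0)

lemma poly_over_0: "poly_over R 0" and poly_over_1: "poly_over R 1"
  by (auto simp: poly_over_def subring_0 subring_1 coeff_1)

lemma poly_over_add: "poly_over R p \<Longrightarrow> poly_over R q \<Longrightarrow> poly_over R (p + q)"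
  by (auto simp: poly_over_def subring_add)

lemma poly_over_uminus: "poly_over R p \<Longrightarrow> poly_over R (- p)"
  by (auto simp: poly_over_def subring_uminus)

lemma poly_over_diff: "poly_over R p \<Longrightarrow> poly_over R q \<Longrightarrow> poly_over R (p - q)"
  by (auto simp: poly_over_def subring_diff)

lemma poly_over_mult: "poly_over R p \<Longrightarrow> poly_over R q \<Longrightarrow> poly_over R (p * q)"
  by (auto simp: poly_over_def coeff_mult intro!: subring_sum subring_mult)

lemma poly_over_smult: "x \<in> R \<Longrightarrow> poly_over R p \<Longrightarrow> poly_over R (smult x p)"
  by (auto simp: poly_over_def subring_mult)

lemma poly_over_sum: "(\<And>i. i \<in> I \<Longrightarrow> poly_over R (f i)) \<Longrightarrow> poly_over R (sum f I)"
  by (induction I rule: infinite_finite_induct) (auto simp: poly_over_0 poly_over_add)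

lemma subring_adjoin: "is_subring {poly p y | p. poly_over R p}"
  unfolding is_subring_def
proof (intro conjI ballI)
  show "1 \<in> {poly p y | p. poly_over R p}"
    using poly_over_1 by (metis (mono_tags, lifting) mem_Collect_eq poly_1)
next
  fix u v assume "u \<in> {poly p y | p. poly_over R p}" "v \<in> {poly p y | p. poly_over R p}"
  then obtain p q where pq: "u = poly p y" "v = poly q y" "poly_over R p" "poly_over R q" by auto
  then show "u + v \<in> {poly p y | p. poly_over R p}" "u * v \<in> {poly p y | p. poly_over R p}"
    using poly_over_add[of p q] poly_over_mult[of p q]
    by (auto simp del: poly_add poly_mult simp flip: poly_add poly_mult)
next
  fix u assume "u \<in> {poly p y | p. poly_over R p}"
  then obtain p where "u = poly p y" "poly_over R p" by auto
  then show "- u \<in> {poly p y | p. poly_over R p}"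
    using poly_over_uminus[of p] by (auto simp del: poly_minus simp flip: poly_minus)
qed

end

lemma subfield_subring: "is_subfield L \<Longrightarrow> is_subring L"
  by (auto simp: is_subfield_def is_subring_def)

lemma subfield_inverse: "is_subfield L \<Longrightarrow> x \<in> L \<Longrightarrow> inverse x \<in> L"
  by (auto simp: is_subfield_def)

lemma subfield_divide: "is_subfield L \<Longrightarrow> x \<in> L \<Longrightarrow> y \<in> L \<Longrightarrow> x / y \<in> L"
  by (auto simp: is_subfield_def divide_inverse)

lemma is_subfieldI: "is_subring L \<Longrightarrow> (\<And>x. x \<in> L \<Longrightarrow> x \<noteq> 0 \<Longrightarrow> inverse x \<in> L) \<Longrightarrow> is_subfield L"
  using subring_0 unfolding is_subfield_def is_subring_def by (metis inverse_zero)

lemma subfield_field_gen: "is_subfield (field_gen k S)"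
  unfolding field_gen_def is_subfield_def by blast

lemma field_gen_base: "x \<in> k \<Longrightarrow> x \<in> field_gen k S"
  and field_gen_gen: "x \<in> S \<Longrightarrow> x \<in> field_gen k S"
  unfolding field_gen_def by blast+

lemma field_gen_least: "is_subfield L \<Longrightarrow> k \<subseteq> L \<Longrightarrow> S \<subseteq> L \<Longrightarrow> field_gen k S \<subseteq> L"
  unfolding field_gen_def by blast

lemma field_gen_mono: "k \<subseteq> k' \<Longrightarrow> S \<subseteq> T \<Longrightarrow> field_gen k S \<subseteq> field_gen k' T"
  unfolding field_gen_def by blast

lemma field_gen_field_gen: "field_gen (field_gen k S) T = field_gen k (S \<union> T)"
proof
  show "field_gen (field_gen k S) T \<subseteq> field_gen k (S \<union> T)"
    by (intro field_gen_least subfield_field_gen field_gen_mono) (auto intro: field_gen_gen)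
  show "field_gen k (S \<union> T) \<subseteq> field_gen (field_gen k S) T"
    by (intro field_gen_least subfield_field_gen) (auto intro: field_gen_gen field_gen_base)
qed

lemma field_gen_empty: "is_subfield k \<Longrightarrow> field_gen k {} = k"
  using field_gen_least[of k k "{}"] field_gen_base[of _ k "{}"] by blast

definition fractions :: "'a::field set \<Rightarrow> 'a set" where
  "fractions R = {u / v | u v. u \<in> R \<and> v \<in> R \<and> v \<noteq> 0}"

lemma fractionsI: "u \<in> R \<Longrightarrow> v \<in> R \<Longrightarrow> v \<noteq> 0 \<Longrightarrow> u / v \<in> fractions R"
  unfolding fractions_def by blast

lemma fractionsE:
  assumes "x \<in> fractions R"
  obtains u v where "x = u / v" "u \<in> R" "v \<in> R" "v \<noteq> 0"
  using assms unfolding fractions_def by blast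

lemma subfield_fractions:
  fixes R :: "'a::field set"
  assumes R: "is_subring R"
  shows "is_subfield (fractions R)"
proof (rule is_subfieldI)
  note [intro] = subring_1[OF R] subring_add[OF R] subring_mult[OF R] subring_uminus[OF R]
  show "is_subring (fractions R)"
    unfolding is_subring_def
  proof (intro conjI ballI)
    show "1 \<in> fractions R"
      using fractionsI[OF subring_1[OF R] subring_1[OF R]] by simp
  next
    fix x y assume "x \<in> fractions R" "y \<in> fractions R"
    then obtain u v u' v' where *: "x = u / v" "y = u' / v'" "u \<in> R" "v \<in> R" "v \<noteq> 0" "u' \<in> R" "v' \<in> R" "v' \<noteq> 0"
      by (elim fractionsE) blast
    have "x + y = (u * v' + u' * v) / (v * v')" using * by (simp add: add_frac_eq)
    then show "x + y \<in> fractions R" using * by (simp only:) (intro fractionsI, auto)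
    have "x * y = (u * u') / (v * v')" using * by simp
    then show "x * y \<in> fractions R" using * by (simp only:) (intro fractionsI, auto)
  next
    fix x assume "x \<in> fractions R"
    then obtain u v where "x = u / v" "u \<in> R" "v \<in> R" "v \<noteq> 0" by (rule fractionsE)
    then show "- x \<in> fractions R"
      using fractionsI[of "- u" R v] by auto
  qed
  fix x assume "x \<in> fractions R" "x \<noteq> 0"
  then obtain u v where "x = u / v" "u \<in> R" "v \<in> R" "v \<noteq> 0" by (elim fractionsE)
  then show "inverse x \<in> fractions R"
    using fractionsI[of v R u] \<open>x \<noteq> 0\<close> by simp
qed

lemma fractions_superset: "is_subring R \<Longrightarrow> R \<subseteq> fractions R"
  using fractionsI[of _ R 1] subring_1[of R] by auto

lemma field_gen_eq_fractions:
  assumes "is_subring R" "k \<subseteq> R" "S \<subseteq> R" "R \<subseteq> field_gen k S"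
  shows "field_gen k S = fractions R"
proof
  show "field_gen k S \<subseteq> fractions R"
    using fractions_superset[OF assms(1)] assms
    by (intro field_gen_least subfield_fractions) auto
  show "fractions R \<subseteq> field_gen k S"
    using assms(4) subfield_divide[OF subfield_field_gen, of _ k S] by (auto elim!: fractionsE)
qed

section \<open>Algebraic elements over a subset of a field\<close>

definition alg_over :: "'a::field set \<Rightarrow> 'a \<Rightarrow> bool" where
  "alg_over L x \<longleftrightarrow> (\<exists>p. p \<noteq> 0 \<and> poly_over L p \<and> poly p x = 0)"

lemma alg_over_mono: "alg_over L x \<Longrightarrow> L \<subseteq> M \<Longrightarrow> alg_over M x"
  unfolding alg_over_def poly_over_def by blast

lemma alg_over_self:
  assumes "is_subring L" "x \<in> L"
  shows "alg_over L x"
  unfolding alg_over_def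
  using assms subring_uminus[OF assms]
  by (intro exI[of _ "[:- x, 1:]"]) (auto intro!: poly_over_pCons subring_1 poly_over_0)

lemma alg_over_inverse:
  assumes "alg_over L x" "0 \<in> L"
  shows "alg_over L (inverse x)"
proof (cases "x = 0")
  case False
  from assms obtain p where p: "p \<noteq> 0" "poly_over L p" "poly p x = 0" by (auto simp: alg_over_def)
  have "poly (reflect_poly p) (inverse x) = 0"
    using False p(3) by (subst poly_reflect_poly_nz) auto
  moreover have "poly_over L (reflect_poly p)"
    using p(2) assms(2) by (auto simp: poly_over_def coeff_reflect_poly)
  moreover have "reflect_poly p \<noteq> 0" using p(1) by simp
  ultimately show ?thesis unfolding alg_over_def by blast
qed (use assms in auto)

lemma poly_over_fractions:
  assumes R: "is_subring R" and "poly_over (fractions R) p"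
  shows "\<exists>d\<in>R. d \<noteq> 0 \<and> poly_over R (smult d p)"
  using assms(2)
proof (induction p)
  case 0
  then show ?case using subring_1[OF R] poly_over_0[OF R] by (intro bexI[of _ 1]) auto
next
  case (pCons a p)
  have "poly_over (fractions R) p" and a: "a \<in> fractions R"
    using poly_over_pConsD[OF subfield_subring[OF subfield_fractions[OF R]] pCons.prems] by auto
  then obtain d where d: "d \<in> R" "d \<noteq> 0" "poly_over R (smult d p)" using pCons.IH by blast
  from a obtain u v where uv: "a = u / v" "u \<in> R" "v \<in> R" "v \<noteq> 0" by (rule fractionsE)
  have "smult (d * v) (pCons a p) = pCons (d * u) (smult v (smult d p))"
    using uv by (simp add: mult.commute)
  then show ?case
    using d uv by (intro bexI[of _ "d * v"])
      (auto intro!: poly_over_pCons[OF R] poly_over_smult[OF R] subring_mult[OF R] simp del: smult_smult)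
qed

lemma alg_over_fractions:
  assumes R: "is_subring R" and "alg_over (fractions R) x"
  shows "alg_over R x"
proof -
  obtain p where p: "p \<noteq> 0" "poly_over (fractions R) p" "poly p x = 0"
    using assms by (auto simp: alg_over_def)
  obtain d where d: "d \<in> R" "d \<noteq> 0" "poly_over R (smult d p)"
    using poly_over_fractions[OF R p(2)] by blast
  then show ?thesis using p by (auto simp: alg_over_def intro!: exI[of _ "smult d p"])
qed

lemma field_gen_simple:
  assumes L: "is_subring L"
  shows "field_gen L {y} = fractions {poly p y | p. poly_over L p}"
proof (rule field_gen_eq_fractions)
  show "is_subring {poly p y | p. poly_over L p}" by (rule subring_adjoin[OF L])
  show "L \<subseteq> {poly p y | p. poly_over L p}"
    using poly_over_pCons[OF L _ poly_over_0[OF L]] by force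
  show "{y} \<subseteq> {poly p y | p. poly_over L p}"
    using poly_over_monom[OF L subring_1[OF L], of 1] by (auto simp: poly_monom intro!: exI[of _ "monom 1 1"])
  show "{poly p y | p. poly_over L p} \<subseteq> field_gen L {y}"
    using subring_poly[OF subfield_subring[OF subfield_field_gen[of L "{y}"]]] field_gen_base[of _ L]
      field_gen_gen[of y "{y}"] by (auto simp: poly_over_def)
qed

subsection \<open>Algebraic elements via places\<close>

text \<open>An element is transcendental over \<open>L\<close> iff some place that is injective on \<open>L\<close> sends it to infinity.
  This makes the closure properties of algebraic elements, including transitivity, immediate.\<close>

lemma place_transcendental:
  fixes x :: "'a::field"
  assumes L: "is_subring L" and x: "\<not> alg_over L x"
  shows "\<exists>G :: ('a \<times> 'a alg_closure) set. place_rel G \<and> (\<forall>l\<in>L. (l, to_ac l) \<in> G) \<and> (inverse x, 0) \<in> G"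
proof -
  define D where "D = {(l, to_ac l) | l. l \<in> L}"
  have D: "subring_rel D"
    using L unfolding D_def subring_rel_def is_subring_def by (auto simp flip: to_ac_1)
  \<comment> \<open>Any value is admissible: \<open>inverse x\<close> is transcendental over
    \<open>L\<close> as well, so a relation \<open>P\<close> is the zero polynomial, and
    \<open>Q\<close> is its image.\<close>
  have "functional_rel (adjoin_rel D (inverse x) 0)"
    unfolding functional_rel_def adjoin_rel_def
  proof (clarify)
    fix P Q assume PQ: "poly_rel D P Q" "0 = poly P (inverse x)"
    have c: "coeff P i \<in> L" "coeff Q i = to_ac (coeff P i)" for i
      using PQ(1) by (auto simp: poly_rel_def D_def)
    have "\<not> alg_over L (inverse x)"
      using x alg_over_inverse[of L "inverse x"] subring_0[OF L] by auto
    then have "P = 0" using c PQ(2) by (auto simp: alg_over_def poly_over_def)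
    then show "poly Q 0 = 0" using c(2) by (simp add: poly_0_coeff_0)
  qed
  from place_extension[OF subring_rel_adjoin[OF D] this]
  obtain G where G: "adjoin_rel D (inverse x) 0 \<subseteq> G" "place_rel G" by blast
  then show ?thesis
    using adjoin_rel_subset[OF D, of "inverse x" 0] adjoin_rel_mem[OF D, of "inverse x" 0]
    by (intro exI[of _ G]) (auto simp: D_def)
qed

lemma place_relD:
  assumes "place_rel G"
  shows "subring_rel G" "functional_rel G" "x \<noteq> 0 \<Longrightarrow> x \<in> Domain G \<or> inverse x \<in> Domain G"
    "(x, y) \<in> G \<Longrightarrow> y \<noteq> 0 \<Longrightarrow> (inverse x, inverse y) \<in> G"
  using assms by (auto simp: place_rel_def)

lemma srel_Domain_poly:
  assumes G: "subring_rel G" and "\<And>i. coeff p i \<in> Domain G" "x \<in> Domain G"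
  shows "poly p x \<in> Domain G"
  using assms(2)
proof (induction p)
  case 0
  then show ?case using srel_0[OF G] by auto
next
  case (pCons a p)
  have "coeff (pCons a p) (Suc i) \<in> Domain G" "coeff (pCons a p) 0 \<in> Domain G" for i
    using pCons.prems by blast+
  then have "a \<in> Domain G" "poly p x \<in> Domain G" using pCons.IH by auto
  then show ?case using srel_add[OF G] srel_mult[OF G] assms(3) by (fastforce simp: Domain.simps)
qed

text \<open>Read a relation for \<open>x\<close> backwards, as a relation for
  \<open>inverse x\<close> with constant term the old leading coefficient. That term has a nonzero
  value while all others carry a factor of value 0, so the value of the whole is nonzero although
  the relation says 0.\<close>

lemma place_infinite_not_alg:
  assumes G: "place_rel G" and L: "\<And>l. l \<in> L \<Longrightarrow> l \<noteq> 0 \<Longrightarrow> \<exists>y. y \<noteq> 0 \<and> (l, y) \<in> G"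
    and x: "x \<noteq> 0" "(inverse x, 0) \<in> G"
  shows "\<not> alg_over L x"
proof
  note sG = place_relD(1)[OF G]
  assume "alg_over L x"
  then obtain p where p: "p \<noteq> 0" "poly_over L p" "poly p x = 0" by (auto simp: alg_over_def)
  define r where "r = reflect_poly p"
  have r0: "poly r (inverse x) = 0"
    unfolding r_def using x(1) p(3) by (subst poly_reflect_poly_nz) auto
  have dom: "l \<in> Domain G" if "l \<in> L \<or> l = 0" for l
    using L[of l] srel_0[OF sG] that by (cases "l = 0") auto
  have rc: "coeff r i \<in> Domain G" for i
    using p(2) by (auto simp: r_def coeff_reflect_poly poly_over_def intro!: dom)
  have "coeff r 0 \<noteq> 0" "coeff r 0 \<in> L" using p(1,2) by (auto simp: r_def poly_over_def)
  then obtain y where y: "y \<noteq> 0" "(coeff r 0, y) \<in> G" using L by blast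
  obtain a r' where r': "r = pCons a r'" by (cases r)
  have "coeff r' i \<in> Domain G" for i using rc[of "Suc i"] r' by simp
  then have "poly r' (inverse x) \<in> Domain G"
    using srel_Domain_poly[OF sG] x(2) by blast
  then obtain w where "(poly r' (inverse x), w) \<in> G" by blast
  from srel_add[OF sG y(2) srel_mult[OF sG x(2) this]]
  have "(poly r (inverse x), y) \<in> G" using r' by simp
  then show False using r0 y(1) place_relD(2)[OF G] by (auto simp: functional_rel_def)
qed

text \<open>\<open>place_infinite_not_alg\<close> for \<open>x\<close> and for
  \<open>inverse x\<close> excludes the values infinity and 0. The hypothesis on \<open>L\<close>
  thus passes to the elements algebraic over \<open>L\<close>, which is what transitivity rests
  on.\<close>

lemma alg_over_place_nonzero:
  assumes G: "place_rel G" and L: "\<And>l. l \<in> L \<Longrightarrow> l \<noteq> 0 \<Longrightarrow> \<exists>y. y \<noteq> 0 \<and> (l, y) \<in> G" and "0 \<in> L"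
    and x: "alg_over L x" "x \<noteq> 0"
  shows "\<exists>y. y \<noteq> 0 \<and> (x, y) \<in> G"
proof -
  have *: "(inverse x, 0) \<notin> G" using place_infinite_not_alg[OF G, of L x] L x by blast
  have **: "(x, 0) \<notin> G"
    using place_infinite_not_alg[OF G, of L "inverse x"] L x alg_over_inverse[OF x(1) assms(3)] by auto
  from place_relD(3)[OF G x(2)] show ?thesis
  proof
    assume "x \<in> Domain G"
    then obtain y where "(x, y) \<in> G" by blast
    then show ?thesis using ** by (cases "y = 0") auto
  next
    assume "inverse x \<in> Domain G"
    then obtain y where "(inverse x, y) \<in> G" by blast
    moreover have "y \<noteq> 0" using * calculation by auto
    ultimately show ?thesis using place_relD(4)[OF G, of "inverse x" y]
      by (metis inverse_inverse_eq inverse_nonzero_iff_nonzero)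
  qed
qed

lemma to_ac_nonzero_image: "\<forall>l\<in>L. (l, to_ac l) \<in> G \<Longrightarrow> l \<in> L \<Longrightarrow> l \<noteq> 0 \<Longrightarrow> \<exists>y. y \<noteq> 0 \<and> (l, y) \<in> G"
  using to_ac_eq_0_iff by blast

lemma place_infinite_notin_Domain:
  assumes "place_rel G" "z \<in> Domain G" "(inverse z, 0) \<in> G"
  shows "z = 0"
proof (rule ccontr)
  assume z: "z \<noteq> 0"
  note sG = place_relD(1)[OF assms(1)]
  obtain w where "(z, w) \<in> G" using assms(2) by blast
  from srel_mult[OF sG this assms(3)] have "(1, 0) \<in> G" using z by simp
  from srel_diff[OF sG srel_1[OF sG] this] show False
    using place_relD(2)[OF assms(1)] by (auto simp: functional_rel_def)
qed

lemma subfield_alg_over: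
  fixes L :: "'a::field set"
  assumes L: "is_subring L"
  shows "is_subfield {x. alg_over L x}"
proof (rule is_subfieldI)
  \<comment> \<open>One argument for sums, products and negatives: a place that is injective on
    \<open>L\<close> and infinite at \<open>z\<close> would be finite at the algebraic
    \<open>x\<close> and \<open>y\<close>, hence, its domain being a ring, at \<open>z\<close>
    too.\<close>
  have closed: "alg_over L z"
    if xy: "alg_over L x" "alg_over L y"
      and z: "\<And>G :: ('a \<times> 'a alg_closure) set. subring_rel G \<Longrightarrow> x \<in> Domain G \<Longrightarrow> y \<in> Domain G \<Longrightarrow> z \<in> Domain G"
    for x y z
  proof (rule ccontr)
    assume nz: "\<not> alg_over L z"
    then obtain G :: "('a \<times> 'a alg_closure) set" where
      G: "place_rel G" "\<forall>l\<in>L. (l, to_ac l) \<in> G" "(inverse z, 0) \<in> G"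
      using place_transcendental[OF L] by blast
    have "w \<in> Domain G" if "alg_over L w" for w
      using alg_over_place_nonzero[OF G(1) to_ac_nonzero_image[OF G(2)] subring_0[OF L] that]
        srel_0[OF place_relD(1)[OF G(1)]] by (cases "w = 0") auto
    then have "z = 0"
      using z[OF place_relD(1)[OF G(1)]] xy place_infinite_notin_Domain[OF G(1) _ G(3)] by blast
    then show False using nz alg_over_self[OF L subring_0[OF L]] by blast
  qed
  show "is_subring {x. alg_over L x}"
    unfolding is_subring_def
  proof (intro conjI ballI CollectI)
    show "alg_over L 1" by (rule alg_over_self[OF L subring_1[OF L]])
  next
    fix x y assume xy: "x \<in> {x. alg_over L x}" "y \<in> {x. alg_over L x}"
    then have xy': "alg_over L x" "alg_over L y" by auto
    show "alg_over L (x + y)"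
      by (rule closed[OF xy']) (use srel_add in \<open>fastforce simp: Domain.simps\<close>)
    show "alg_over L (x * y)"
      by (rule closed[OF xy']) (use srel_mult in \<open>fastforce simp: Domain.simps\<close>)
  next
    fix x assume x: "x \<in> {x. alg_over L x}"
    then have x': "alg_over L x" by auto
    show "alg_over L (- x)"
      by (rule closed[OF x' x']) (use srel_uminus in \<open>fastforce simp: Domain.simps\<close>)
  qed
  show "inverse x \<in> {x. alg_over L x}" if "x \<in> {x. alg_over L x}" for x
    using that alg_over_inverse subring_0[OF L] by blast
qed

lemma alg_over_trans:
  fixes L :: "'a::field set"
  assumes L: "is_subring L" and x: "alg_over {x. alg_over L x} x"
  shows "alg_over L x"
proof (rule ccontr)
  assume nx: "\<not> alg_over L x"
  then obtain G :: "('a \<times> 'a alg_closure) set" where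
    G: "place_rel G" "\<forall>l\<in>L. (l, to_ac l) \<in> G" "(inverse x, 0) \<in> G"
    using place_transcendental[OF L] by blast
  have "x \<noteq> 0" using nx alg_over_self[OF L subring_0[OF L]] by blast
  moreover have "\<exists>y. y \<noteq> 0 \<and> (l, y) \<in> G" if "l \<in> {x. alg_over L x}" "l \<noteq> 0" for l
    using alg_over_place_nonzero[OF G(1) to_ac_nonzero_image[OF G(2)] subring_0[OF L]] that by blast
  ultimately show False
    using place_infinite_not_alg[OF G(1) _ _ G(3)] x by blast
qed

section \<open>The closure operator of algebraic dependence\<close>

definition alg_cl :: "'a::field set \<Rightarrow> 'a set \<Rightarrow> 'a set" where
  "alg_cl k S = {x. alg_over (field_gen k S) x}"

lemma subring_field_gen: "is_subring (field_gen k S)"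
  by (rule subfield_subring[OF subfield_field_gen])

lemma subfield_alg_cl: "is_subfield (alg_cl k S)"
  unfolding alg_cl_def by (rule subfield_alg_over[OF subring_field_gen])

lemma field_gen_subset_alg_cl: "field_gen k S \<subseteq> alg_cl k S"
  by (auto simp: alg_cl_def intro: alg_over_self[OF subring_field_gen])

lemma alg_cl_superset: "S \<subseteq> alg_cl k S" and alg_cl_base: "k \<subseteq> alg_cl k S"
  using field_gen_subset_alg_cl[of k S] field_gen_gen[of _ S k] field_gen_base[of _ k S] by auto

lemma alg_cl_mono: "S \<subseteq> T \<Longrightarrow> alg_cl k S \<subseteq> alg_cl k T"
  using alg_over_mono field_gen_mono[of k k S T] by (auto simp: alg_cl_def)

lemma alg_cl_trans:
  assumes "S \<subseteq> alg_cl k T"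
  shows "alg_cl k S \<subseteq> alg_cl k T"
proof
  fix x assume "x \<in> alg_cl k S"
  then have "alg_over (field_gen k S) x" by (simp add: alg_cl_def)
  moreover have "field_gen k S \<subseteq> {x. alg_over (field_gen k T) x}"
    using field_gen_least[OF subfield_alg_cl[of k T] alg_cl_base assms] by (simp add: alg_cl_def)
  ultimately have "alg_over {x. alg_over (field_gen k T) x} x" by (rule alg_over_mono)
  from alg_over_trans[OF subring_field_gen this] show "x \<in> alg_cl k T" by (simp add: alg_cl_def)
qed

text \<open>After clearing denominators the relation is a polynomial in \<open>x\<close> and
  \<open>y\<close> over \<open>L\<close>; collecting powers of \<open>y\<close> instead of
  \<open>x\<close> gives a relation for \<open>y\<close>. It is nontrivial because a nonzero
  coefficient \<open>q j\<close> cannot vanish at the transcendental \<open>x\<close>.\<close>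

lemma alg_over_swap:
  assumes L: "is_subfield L" and x: "\<not> alg_over L x" and a: "alg_over (field_gen L {y}) x"
  shows "alg_over (field_gen L {x}) y"
proof -
  note sL = subfield_subring[OF L]
  define R where "R = {poly p y | p. poly_over L p}"
  have R: "is_subring R" unfolding R_def by (rule subring_adjoin[OF sL])
  have "alg_over R x"
    using a unfolding field_gen_simple[OF sL] R_def[symmetric] by (rule alg_over_fractions[OF R])
  then obtain P where P: "P \<noteq> 0" "poly_over R P" "poly P x = 0" by (auto simp: alg_over_def)
  have "\<forall>i. \<exists>p. coeff P i = poly p y \<and> poly_over L p"
    using P(2) by (auto simp: poly_over_def R_def)
  then obtain p where p: "\<And>i. coeff P i = poly (p i) y" "\<And>i. poly_over L (p i)" by metis
  define N where "N = Max (degree ` p ` {..degree P})"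
  have N: "degree (p i) \<le> N" if "i \<le> degree P" for i
    unfolding N_def using that by (intro Max_ge) auto
  define q where "q j = (\<Sum>i\<le>degree P. monom (coeff (p i) j) i)" for j
  have q_over: "poly_over L (q j)" for j
    unfolding q_def using p(2) by (intro poly_over_sum[OF sL] poly_over_monom[OF sL]) (auto simp: poly_over_def)
  define Q where "Q = (\<Sum>j\<le>N. monom (poly (q j) x) j)"
  have "poly Q y = (\<Sum>j\<le>N. \<Sum>i\<le>degree P. coeff (p i) j * x ^ i * y ^ j)"
    by (simp add: Q_def poly_sum poly_monom q_def sum_distrib_right)
  also have "\<dots> = (\<Sum>i\<le>degree P. (\<Sum>j\<le>N. coeff (p i) j * y ^ j) * x ^ i)"
    by (subst sum.swap) (simp add: sum_distrib_left sum_distrib_right mult_ac)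
  also have "\<dots> = (\<Sum>i\<le>degree P. poly (p i) y * x ^ i)"
    by (intro sum.cong refl) (simp add: poly_altdef_le[OF N])
  also have "\<dots> = 0" using P(3) by (simp add: poly_altdef p(1))
  finally have Qy: "poly Q y = 0" .
  have "poly (p (degree P)) y \<noteq> 0" using P(1) p(1)[of "degree P"] by auto
  then obtain j where j: "coeff (p (degree P)) j \<noteq> 0" by (metis poly_0 poly_eqI coeff_0)
  then have "j \<le> degree (p (degree P))" by (rule le_degree)
  then have jN: "j \<le> N" using N[of "degree P"] by simp
  have "coeff (q j) (degree P) = coeff (p (degree P)) j"
    by (simp add: q_def coeff_sum)
  then have "q j \<noteq> 0" using j by auto
  then have "poly (q j) x \<noteq> 0" using x q_over by (auto simp: alg_over_def)
  moreover have "coeff Q j = poly (q j) x"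
    using jN by (simp add: Q_def coeff_sum)
  ultimately have "Q \<noteq> 0" by auto
  moreover have "poly (q j) x \<in> field_gen L {x}" for j
    using q_over[of j] field_gen_base[of _ L "{x}"]
    by (intro subring_poly[OF subring_field_gen]) (auto simp: poly_over_def field_gen_gen)
  then have "poly_over (field_gen L {x}) Q"
    unfolding Q_def by (intro poly_over_sum[OF subring_field_gen] poly_over_monom[OF subring_field_gen])
  ultimately show ?thesis using Qy by (auto simp: alg_over_def)
qed

lemma alg_cl_exchange:
  assumes "x \<in> alg_cl k (insert y S)" "x \<notin> alg_cl k S"
  shows "y \<in> alg_cl k (insert x S)"
  using alg_over_swap[OF subfield_field_gen[of k S], of x y] assms
  by (simp add: alg_cl_def field_gen_field_gen)

subsection \<open>Algebraic independence\<close>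

definition mon_coeffs :: "'a::zero set \<Rightarrow> 'i set \<Rightarrow> (('i \<Rightarrow> nat) \<Rightarrow> 'a) \<Rightarrow> bool" where
  "mon_coeffs k I c \<longleftrightarrow> finite {e. c e \<noteq> 0} \<and> (\<forall>e. c e \<in> k) \<and>
     (\<forall>e. c e \<noteq> 0 \<longrightarrow> finite {i. e i \<noteq> 0} \<and> {i. e i \<noteq> 0} \<subseteq> I)"

definition mon_eval :: "(('i \<Rightarrow> nat) \<Rightarrow> 'a::comm_ring_1) \<Rightarrow> ('i \<Rightarrow> 'a) \<Rightarrow> 'a" where
  "mon_eval c x = (\<Sum>e | c e \<noteq> 0. c e * (\<Prod>i | e i \<noteq> 0. x i ^ e i))"

lemma alg_indep_iff:
  "alg_indep k I x \<longleftrightarrow> (\<forall>c. mon_coeffs k I c \<and> mon_eval c x = 0 \<longrightarrow> (\<forall>e. c e = 0))"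
  unfolding alg_indep_def mon_coeffs_def mon_eval_def by blast

text \<open>With \<open>c\<close> read as a polynomial in the variable \<open>j\<close>, this is its
  coefficient of degree \<open>d\<close>, a polynomial in the other variables whose exponent vectors
  are normalised to 0 at \<open>j\<close>.\<close>

definition mon_slice :: "'i \<Rightarrow> nat \<Rightarrow> (('i \<Rightarrow> nat) \<Rightarrow> 'a::zero) \<Rightarrow> ('i \<Rightarrow> nat) \<Rightarrow> 'a" where
  "mon_slice j d c e = (if e j = 0 then c (e(j := d)) else 0)"

lemma mon_eval_slices:
  fixes x :: "'i \<Rightarrow> 'a::comm_ring_1"
  assumes c: "mon_coeffs k (insert j I) c" and D: "\<forall>e. c e \<noteq> 0 \<longrightarrow> e j \<le> D"
  shows "mon_eval c x = (\<Sum>d\<le>D. mon_eval (mon_slice j d c) x * x j ^ d)"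
proof -
  let ?S = "Sigma {..D} (\<lambda>d. {e. mon_slice j d c e \<noteq> 0})"
  let ?m = "\<lambda>e. \<Prod>i | e i \<noteq> 0. x i ^ e i"
  have fin: "finite {e. mon_slice j d c e \<noteq> 0}" for d
  proof (rule finite_subset)
    show "{e. mon_slice j d c e \<noteq> 0} \<subseteq> (\<lambda>e. e(j := 0)) ` {e. c e \<noteq> 0}"
    proof
      fix e assume "e \<in> {e. mon_slice j d c e \<noteq> 0}"
      then have "e j = 0" "c (e(j := d)) \<noteq> 0" by (auto simp: mon_slice_def split: if_splits)
      then show "e \<in> (\<lambda>e. e(j := 0)) ` {e. c e \<noteq> 0}"
        by (intro image_eqI[of _ _ "e(j := d)"]) auto
    qed
  qed (use c in \<open>auto simp: mon_coeffs_def\<close>)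
  have mono: "?m (e(j := d)) = ?m e * x j ^ d" if "e j = 0" "finite {i. e i \<noteq> 0}" for e d
  proof (cases "d = 0")
    case True
    then show ?thesis using that by (simp add: fun_upd_idem)
  next
    case False
    then have "{i. (e(j := d)) i \<noteq> 0} = insert j {i. e i \<noteq> 0}" by auto
    then have "?m (e(j := d)) = x j ^ d * (\<Prod>i | e i \<noteq> 0. x i ^ (e(j := d)) i)"
      using that by simp
    also have "(\<Prod>i | e i \<noteq> 0. x i ^ (e(j := d)) i) = ?m e"
      using that by (intro prod.cong) auto
    finally show ?thesis by (simp add: mult.commute)
  qed
  have "(\<Sum>d\<le>D. mon_eval (mon_slice j d c) x * x j ^ d) =
      (\<Sum>d\<le>D. \<Sum>e | mon_slice j d c e \<noteq> 0. mon_slice j d c e * ?m e * x j ^ d)"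
    by (simp add: mon_eval_def sum_distrib_right)
  also have "\<dots> = (\<Sum>(d, e)\<in>?S. mon_slice j d c e * ?m e * x j ^ d)"
    using fin by (subst sum.Sigma) auto
  also have "\<dots> = (\<Sum>e | c e \<noteq> 0. c e * ?m e)"
  proof (rule sum.reindex_bij_witness[where j = "\<lambda>(d, e). e(j := d)" and i = "\<lambda>e. (e j, e(j := 0))"])
    fix a assume "a \<in> ?S"
    then obtain d e where a: "a = (d, e)" "d \<le> D" "mon_slice j d c e \<noteq> 0" by auto
    then have e: "e j = 0" "c (e(j := d)) \<noteq> 0" by (auto simp: mon_slice_def split: if_splits)
    show "((case a of (d, e) \<Rightarrow> e(j := d)) j, (case a of (d, e) \<Rightarrow> e(j := d))(j := 0)) = a"
      using a e by (auto simp: fun_upd_idem)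
    show "(case a of (d, e) \<Rightarrow> e(j := d)) \<in> {e. c e \<noteq> 0}" using a e by auto
    have "finite {i. (e(j := d)) i \<noteq> 0}" using c e(2) unfolding mon_coeffs_def by blast
    then have "finite {i. e i \<noteq> 0}"
      by (rule finite_subset[rotated]) (use e in auto)
    then show "c (case a of (d, e) \<Rightarrow> e(j := d)) * ?m (case a of (d, e) \<Rightarrow> e(j := d)) =
        (case a of (d, e) \<Rightarrow> mon_slice j d c e * ?m e * x j ^ d)"
      unfolding a(1) prod.case using mono[of e d] e by (simp add: mon_slice_def)
  next
    fix e assume "e \<in> {e. c e \<noteq> 0}"
    then show "(e j, e(j := 0)) \<in> ?S" "(case (e j, e(j := 0)) of (d, e) \<Rightarrow> e(j := d)) = e"
      using D by (auto simp: mon_slice_def)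
  qed
  finally show ?thesis by (simp add: mon_eval_def)
qed

lemma mon_coeffs_slice:
  assumes c: "mon_coeffs k (insert j I) c" and "0 \<in> k"
  shows "mon_coeffs k I (mon_slice j d c)"
proof -
  have e: "c (e(j := d)) \<noteq> 0" "e j = 0" if "mon_slice j d c e \<noteq> 0" for e
    using that by (auto simp: mon_slice_def split: if_splits)
  have "{e. mon_slice j d c e \<noteq> 0} \<subseteq> (\<lambda>e. e(j := 0)) ` {e. c e \<noteq> 0}"
  proof
    fix e assume "e \<in> {e. mon_slice j d c e \<noteq> 0}"
    then show "e \<in> (\<lambda>e. e(j := 0)) ` {e. c e \<noteq> 0}"
      using e by (intro image_eqI[of _ _ "e(j := d)"]) auto
  qed
  then have "finite {e. mon_slice j d c e \<noteq> 0}"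
    by (rule finite_subset) (use c in \<open>auto simp: mon_coeffs_def\<close>)
  moreover have "finite {i. e i \<noteq> 0} \<and> {i. e i \<noteq> 0} \<subseteq> I" if "mon_slice j d c e \<noteq> 0" for e
  proof -
    have *: "finite {i. (e(j := d)) i \<noteq> 0}" "{i. (e(j := d)) i \<noteq> 0} \<subseteq> insert j I"
      using c e[OF that] unfolding mon_coeffs_def by blast+
    have "{i. e i \<noteq> 0} \<subseteq> {i. (e(j := d)) i \<noteq> 0}" "j \<notin> {i. e i \<noteq> 0}" using e[OF that] by auto
    with * show ?thesis by (meson finite_subset subset_insert subset_trans)
  qed
  moreover have "mon_slice j d c e \<in> k" for e
    using c assms(2) by (auto simp: mon_slice_def mon_coeffs_def)
  ultimately show ?thesis by (auto simp: mon_coeffs_def)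
qed

lemma mon_coeffs_unslice:
  assumes C: "\<And>d. mon_coeffs k I (C d)" and D: "\<forall>d>D. C d = (\<lambda>_. 0)" and j: "j \<notin> I"
  defines "c \<equiv> \<lambda>e. C (e j) (e(j := 0))"
  shows "mon_coeffs k (insert j I) c" "mon_slice j d c = C d" "\<forall>e. c e \<noteq> 0 \<longrightarrow> e j \<le> D"
proof -
  have e: "e j \<le> D" if "c e \<noteq> 0" for e
    using that D by (auto simp: c_def not_less[symmetric])
  then show "\<forall>e. c e \<noteq> 0 \<longrightarrow> e j \<le> D" by blast
  have "{e. c e \<noteq> 0} \<subseteq> (\<Union>d\<le>D. (\<lambda>e. e(j := d)) ` {e. C d e \<noteq> 0})"
  proof
    fix f assume f: "f \<in> {e. c e \<noteq> 0}"
    then have "f j \<le> D" "C (f j) (f(j := 0)) \<noteq> 0" using e[of f] by (auto simp: c_def)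
    then show "f \<in> (\<Union>d\<le>D. (\<lambda>e. e(j := d)) ` {e. C d e \<noteq> 0})"
      by (intro UN_I[of "f j"] image_eqI[of _ _ "f(j := 0)"]) auto
  qed
  then have "finite {e. c e \<noteq> 0}"
    by (rule finite_subset) (use C in \<open>auto simp: mon_coeffs_def\<close>)
  moreover have "c e \<in> k" for e using C by (auto simp: c_def mon_coeffs_def)
  moreover have "finite {i. e i \<noteq> 0} \<and> {i. e i \<noteq> 0} \<subseteq> insert j I" if "c e \<noteq> 0" for e
  proof -
    have *: "finite {i. (e(j := 0)) i \<noteq> 0}" "{i. (e(j := 0)) i \<noteq> 0} \<subseteq> I"
      using C[of "e j"] that unfolding mon_coeffs_def c_def by blast+
    have "{i. e i \<noteq> 0} \<subseteq> insert j {i. (e(j := 0)) i \<noteq> 0}" by auto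
    with * show ?thesis by (meson finite_insert finite_subset insert_mono subset_trans)
  qed
  ultimately show "mon_coeffs k (insert j I) c" by (auto simp: mon_coeffs_def)
  have "C d e = 0" if "e j \<noteq> 0" for e
    using C[of d] that j unfolding mon_coeffs_def by blast
  then show "mon_slice j d c = C d"
    by (auto simp: mon_slice_def c_def fun_eq_iff fun_upd_idem)
qed

lemma mon_eval_in:
  assumes "is_subring R" "k \<subseteq> R" "\<And>i. i \<in> I \<Longrightarrow> x i \<in> R" "mon_coeffs k I c"
  shows "mon_eval c x \<in> R"
  unfolding mon_eval_def
proof (intro subring_sum[OF assms(1)] subring_mult[OF assms(1)] subring_prod[OF assms(1)] subring_power[OF assms(1)])
  fix e assume e: "e \<in> {e. c e \<noteq> 0}"
  show "c e \<in> R" using assms(2,4) by (auto simp: mon_coeffs_def)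
  fix i assume "i \<in> {i. e i \<noteq> 0}"
  then have "i \<in> I" using assms(4) e unfolding mon_coeffs_def by blast
  then show "x i \<in> R" by (rule assms(3))
qed

definition mon_ring :: "'a::comm_ring_1 set \<Rightarrow> 'i set \<Rightarrow> ('i \<Rightarrow> 'a) \<Rightarrow> 'a set" where
  "mon_ring k I x = {mon_eval c x | c. mon_coeffs k I c}"

lemma mon_coeffs_0: "0 \<in> k \<Longrightarrow> mon_coeffs k I (\<lambda>_. 0)"
  by (auto simp: mon_coeffs_def)

lemma mon_ring_empty:
  fixes x :: "'b \<Rightarrow> 'a::comm_ring_1"
  assumes "0 \<in> k"
  shows "mon_ring k {} x = k"
proof
  have "mon_eval c x \<in> k" if c: "mon_coeffs k {} c" for c
  proof -
    have "{e. c e \<noteq> 0} \<subseteq> {\<lambda>_. 0}" using c by (auto simp: mon_coeffs_def)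
    then consider "{e. c e \<noteq> 0} = {}" | "{e. c e \<noteq> 0} = {\<lambda>_. 0}" by blast
    then show ?thesis
      using c assms by cases (auto simp: mon_eval_def mon_coeffs_def)
  qed
  then show "mon_ring k {} x \<subseteq> k" by (auto simp: mon_ring_def)
  show "k \<subseteq> mon_ring k {} x"
  proof
    fix a assume a: "a \<in> k"
    define c where "c e = (if e = (\<lambda>_. 0) then a else 0)" for e :: "'b \<Rightarrow> nat"
    have "mon_coeffs k {} c" using a assms by (auto simp: mon_coeffs_def c_def)
    moreover have "mon_eval c x = a"
      by (cases "a = 0") (auto simp: mon_eval_def c_def)
    ultimately show "a \<in> mon_ring k {} x" unfolding mon_ring_def by blast
  qed
qed

lemma mon_ring_poly_coeffs:
  assumes p: "poly_over (mon_ring k I x) p" and j: "j \<notin> I" and k: "0 \<in> k"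
  shows "\<exists>c. mon_coeffs k (insert j I) c \<and> mon_eval c x = poly p (x j) \<and>
    (\<forall>d. mon_eval (mon_slice j d c) x = coeff p d)"
proof -
  have "\<forall>d. \<exists>c. mon_coeffs k I c \<and> mon_eval c x = coeff p d"
    using p by (auto simp: poly_over_def mon_ring_def) metis
  then obtain C0 where C0: "\<And>d. mon_coeffs k I (C0 d)" "\<And>d. mon_eval (C0 d) x = coeff p d" by metis
  define C where "C d = (if d \<le> degree p then C0 d else (\<lambda>_. 0))" for d
  have C: "mon_coeffs k I (C d)" "mon_eval (C d) x = coeff p d" for d
    using C0 mon_coeffs_0[OF k] by (auto simp: C_def coeff_eq_0 mon_eval_def)
  have "\<forall>d>degree p. C d = (\<lambda>_. 0)" by (simp add: C_def)
  note c = mon_coeffs_unslice[OF C(1) this j]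
  show ?thesis
    by (intro exI[of _ "\<lambda>e. C (e j) (e(j := 0))"] conjI allI c(1))
      (simp_all add: mon_eval_slices[OF c(1,3)] c(2) C(2) poly_altdef)
qed

text \<open>The bridge from the coefficient functions of \<open>alg_indep\<close> to polynomials in
  one variable over a ring: slicing at \<open>j\<close> in one direction, reassembling the slices in
  the other.\<close>

lemma mon_ring_insert:
  assumes j: "j \<notin> I" and k: "0 \<in> k"
  shows "mon_ring k (insert j I) x = {poly p (x j) | p. poly_over (mon_ring k I x) p}"
proof
  show "{poly p (x j) | p. poly_over (mon_ring k I x) p} \<subseteq> mon_ring k (insert j I) x"
    using mon_ring_poly_coeffs[OF _ j k, of x] unfolding mon_ring_def[of k "insert j I"] by force
  show "mon_ring k (insert j I) x \<subseteq> {poly p (x j) | p. poly_over (mon_ring k I x) p}"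
  proof
    fix z assume "z \<in> mon_ring k (insert j I) x"
    then obtain c where c: "mon_coeffs k (insert j I) c" "z = mon_eval c x" by (auto simp: mon_ring_def)
    have "finite ((\<lambda>e. e j) ` {e. c e \<noteq> 0})" using c(1) by (auto simp: mon_coeffs_def)
    then obtain D where D: "\<forall>e. c e \<noteq> 0 \<longrightarrow> e j \<le> D"
      unfolding finite_nat_set_iff_bounded_le by auto
    define p where "p = (\<Sum>d\<le>D. monom (mon_eval (mon_slice j d c) x) d)"
    have "z = poly p (x j)"
      by (simp add: p_def c(2) mon_eval_slices[OF c(1) D] poly_sum poly_monom)
    moreover have "poly_over (mon_ring k I x) p"
    proof -
      have "coeff p d = (if d \<le> D then mon_eval (mon_slice j d c) x else 0)" for d
        by (simp add: p_def coeff_sum)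
      moreover have "0 \<in> mon_ring k I x"
        using mon_coeffs_0[OF k] unfolding mon_ring_def by (force simp: mon_eval_def)
      ultimately show ?thesis
        using mon_coeffs_slice[OF c(1) k] by (auto simp: poly_over_def mon_ring_def)
    qed
    ultimately show "z \<in> {poly p (x j) | p. poly_over (mon_ring k I x) p}" by blast
  qed
qed

lemma mon_ring_subring:
  assumes "finite I" "is_subring k"
  shows "is_subring (mon_ring k I x)"
  using assms(1)
proof induction
  case empty
  then show ?case using assms(2) by (simp add: mon_ring_empty subring_0)
next
  case (insert j I)
  then show ?case
    using subring_adjoin[OF insert.IH] by (simp add: mon_ring_insert[OF insert(2) subring_0[OF assms(2)]])
qed

lemma mon_ring_mem:
  assumes "finite I" "is_subring k"
  shows "k \<subseteq> mon_ring k I x \<and> x ` I \<subseteq> mon_ring k I x"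
  using assms(1)
proof induction
  case empty
  then show ?case using assms(2) by (simp add: mon_ring_empty subring_0)
next
  case (insert j I)
  note R = mon_ring_subring[OF insert(1) assms(2), of x]
  have "mon_ring k I x \<subseteq> mon_ring k (insert j I) x"
    unfolding mon_ring_insert[OF insert(2) subring_0[OF assms(2)]]
    using poly_over_pCons[OF R _ poly_over_0[OF R]] by force
  moreover have "x j \<in> mon_ring k (insert j I) x"
    unfolding mon_ring_insert[OF insert(2) subring_0[OF assms(2)]]
    using poly_over_monom[OF R subring_1[OF R], of 1] by (auto simp: poly_monom intro!: exI[of _ "monom 1 1"])
  ultimately show ?case using insert(3) by blast
qed

lemma field_gen_mon_ring:
  assumes "finite I" "is_subring k"
  shows "field_gen k (x ` I) = fractions (mon_ring k I x)"
proof (rule field_gen_eq_fractions)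
  show "mon_ring k I x \<subseteq> field_gen k (x ` I)"
    using mon_eval_in[OF subring_field_gen[of k "x ` I"], of k I x] field_gen_base[of _ k "x ` I"]
      field_gen_gen[of _ "x ` I" k] by (auto simp: mon_ring_def)
qed (use mon_ring_subring[OF assms] mon_ring_mem[OF assms] in auto)

text \<open>By slicing at \<open>j\<close>, relations that involve the new variable correspond to
  polynomials over \<open>mon_ring k I x\<close> that vanish at \<open>x j\<close>. This trades
  relations in many variables for one algebraic element at a time, hence for
  \<open>alg_cl\<close>.\<close>

lemma alg_indep_insert:
  assumes I: "finite I" "j \<notin> I" and k: "is_subring k"
  shows "alg_indep k (insert j I) x \<longleftrightarrow> alg_indep k I x \<and> x j \<notin> alg_cl k (x ` I)"
proof (intro iffI conjI)
  note k0 = subring_0[OF k]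
  note R = mon_ring_subring[OF I(1) k, of x]
  note frac = field_gen_mon_ring[OF I(1) k, of x]
  {
    assume a: "alg_indep k (insert j I) x"
    have "mon_coeffs k (insert j I) c" if "mon_coeffs k I c" for c
      using that by (auto simp: mon_coeffs_def)
    then show "alg_indep k I x" using a unfolding alg_indep_iff by blast
    show "x j \<notin> alg_cl k (x ` I)"
    proof
      assume "x j \<in> alg_cl k (x ` I)"
      then have "alg_over (mon_ring k I x) (x j)"
        using alg_over_fractions[OF R] by (simp add: alg_cl_def frac)
      then obtain p where p: "p \<noteq> 0" "poly_over (mon_ring k I x) p" "poly p (x j) = 0"
        by (auto simp: alg_over_def)
      obtain c where c: "mon_coeffs k (insert j I) c" "mon_eval c x = poly p (x j)"
        "\<And>d. mon_eval (mon_slice j d c) x = coeff p d"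
        using mon_ring_poly_coeffs[OF p(2) I(2) k0] by blast
      have "\<forall>e. c e = 0" using a c(1,2) p(3) unfolding alg_indep_iff by auto
      then have "mon_slice j d c = (\<lambda>_. 0)" for d by (auto simp: mon_slice_def)
      then have "coeff p d = 0" for d
        using c(3)[of d] by (simp add: mon_eval_def)
      then show False using p(1) by (simp add: poly_eq_iff)
    qed
  }
  assume a: "alg_indep k I x \<and> x j \<notin> alg_cl k (x ` I)"
  show "alg_indep k (insert j I) x"
    unfolding alg_indep_iff
  proof (intro allI impI)
    fix c e assume c: "mon_coeffs k (insert j I) c \<and> mon_eval c x = 0"
    have "finite ((\<lambda>e. e j) ` {e. c e \<noteq> 0})" using c by (auto simp: mon_coeffs_def)
    then obtain D where D: "\<forall>e. c e \<noteq> 0 \<longrightarrow> e j \<le> D"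
      unfolding finite_nat_set_iff_bounded_le by auto
    note slice = mon_coeffs_slice[OF conjunct1[OF c] k0]
    define p where "p = (\<Sum>d\<le>D. monom (mon_eval (mon_slice j d c) x) d)"
    have "poly p (x j) = 0"
      using c mon_eval_slices[OF conjunct1[OF c] D, of x] by (simp add: p_def poly_sum poly_monom)
    moreover have "poly_over (field_gen k (x ` I)) p"
      unfolding p_def
      by (intro poly_over_sum[OF subring_field_gen] poly_over_monom[OF subring_field_gen]
            mon_eval_in[OF subring_field_gen _ _ slice]) (auto intro: field_gen_base field_gen_gen)
    ultimately have "p = 0" using a by (auto simp: alg_cl_def alg_over_def)
    then have "mon_eval (mon_slice j d c) x = 0" if "d \<le> D" for d
      using that by (simp add: p_def poly_eq_iff coeff_sum) (metis (no_types, lifting))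
    then have sl: "mon_slice j d c e = 0" if "d \<le> D" for d e
      using that a slice unfolding alg_indep_iff by blast
    show "c e = 0"
      using sl[of "e j" "e(j := 0)"] D by (cases "c e = 0") (auto simp: mon_slice_def)
  qed
qed

lemma alg_indep_empty: "alg_indep k {} (x :: 'i \<Rightarrow> 'a::field)"
  unfolding alg_indep_iff
proof (intro allI impI)
  fix c :: "('i \<Rightarrow> nat) \<Rightarrow> 'a" and e
  assume c: "mon_coeffs k {} c \<and> mon_eval c x = 0"
  have sub: "{e. c e \<noteq> 0} \<subseteq> {\<lambda>_. 0}" using c by (auto simp: mon_coeffs_def)
  show "c e = 0"
  proof (rule ccontr)
    assume "c e \<noteq> 0"
    with sub have "{e. c e \<noteq> 0} = {\<lambda>_. 0}" "c (\<lambda>_. 0) \<noteq> 0" by auto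
    then show False using c by (simp add: mon_eval_def)
  qed
qed

lemma alg_indep_base_mono: "alg_indep k I x \<Longrightarrow> k' \<subseteq> k \<Longrightarrow> alg_indep k' I x"
proof -
  assume a: "alg_indep k I x" "k' \<subseteq> k"
  have "mon_coeffs k I c" if "mon_coeffs k' I c" for c
    using that a(2) by (auto simp: mon_coeffs_def)
  then show "alg_indep k' I x" using a(1) unfolding alg_indep_iff by blast
qed

text \<open>Steinitz exchange. \<open>T'\<close> is what remains of \<open>T\<close> after each
  \<open>x i\<close> treated so far has displaced one element, while \<open>T\<close> stays in the
  closure.\<close>

theorem alg_indep_card_le:
  assumes "finite I" "is_subring k" "alg_indep k I x" "finite T" "x ` I \<subseteq> alg_cl k T"
  shows "card I \<le> card T"
proof -
  have "\<exists>T'\<subseteq>T. card T' + card I = card T \<and> T \<subseteq> alg_cl k (x ` I \<union> T')"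
    using assms(1,3,5)
  proof induction
    case empty
    then show ?case using alg_cl_superset[of T k] by auto
  next
    case (insert j I)
    have ind: "alg_indep k I x" "x j \<notin> alg_cl k (x ` I)"
      using insert.prems(1) alg_indep_insert[OF insert.hyps assms(2)] by auto
    obtain T' where T': "T' \<subseteq> T" "card T' + card I = card T" "T \<subseteq> alg_cl k (x ` I \<union> T')"
      using insert.IH ind(1) insert.prems(2) by auto
    have finT': "finite T'" using T'(1) assms(4) finite_subset by blast
    have xj: "x j \<in> alg_cl k (x ` I \<union> T')"
      using insert.prems(2) alg_cl_trans[OF T'(3)] by blast
    \<comment> \<open>Among the subsets of \<open>T'\<close> on which \<open>x j\<close> depends,
      together with the earlier elements, one of least size is taken. It is nonempty by
      independence, and minimality makes any element \<open>s\<close> of it exchangeable for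
      \<open>x j\<close>.\<close>
    let ?P = "\<lambda>U. U \<subseteq> T' \<and> x j \<in> alg_cl k (x ` I \<union> U)"
    obtain U where U: "?P U" "\<And>V. ?P V \<Longrightarrow> card U \<le> card V"
      using ex_has_least_nat[of ?P T' card] xj by blast
    have "U \<noteq> {}" using U(1) ind(2) by auto
    then obtain s where s: "s \<in> U" by blast
    have finU: "finite U" using U(1) finT' finite_subset by blast
    have "\<not> ?P (U - {s})"
    proof
      assume "?P (U - {s})"
      from U(2)[OF this] show False using s finU by (metis card_Diff1_less not_less)
    qed
    then have "x j \<notin> alg_cl k (x ` I \<union> (U - {s}))" using U(1) by blast
    moreover have "insert s (x ` I \<union> (U - {s})) = x ` I \<union> U" using s by auto
    ultimately have "s \<in> alg_cl k (insert (x j) (x ` I \<union> (U - {s})))"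
      using alg_cl_exchange[of "x j" k s "x ` I \<union> (U - {s})"] U(1) by simp
    then have sin: "s \<in> alg_cl k (x ` insert j I \<union> (T' - {s}))"
      using alg_cl_mono[of "insert (x j) (x ` I \<union> (U - {s}))" "x ` insert j I \<union> (T' - {s})" k] U(1) by auto
    have "x ` I \<union> T' \<subseteq> alg_cl k (x ` insert j I \<union> (T' - {s}))"
      using sin alg_cl_superset[of "x ` insert j I \<union> (T' - {s})" k] by auto
    from alg_cl_trans[OF this] have "T \<subseteq> alg_cl k (x ` insert j I \<union> (T' - {s}))" using T'(3) by blast
    moreover have "card (T' - {s}) + card (insert j I) = card T"
      using T'(2) insert.hyps card_Suc_Diff1[OF finT', of s] s U(1) by auto
    ultimately show ?case using T'(1) by (intro exI[of _ "T' - {s}"]) auto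
  qed
  then show ?thesis by auto
qed

lemma alg_indep_extract:
  assumes "finite I" "is_subring k"
  shows "\<exists>J\<subseteq>I. alg_indep k J y \<and> y ` I \<subseteq> alg_cl k (y ` J)"
  using assms(1)
proof induction
  case empty
  then show ?case using alg_indep_empty by auto
next
  case (insert j I)
  then obtain J where J: "J \<subseteq> I" "alg_indep k J y" "y ` I \<subseteq> alg_cl k (y ` J)" by blast
  have finJ: "finite J" "j \<notin> J" using J(1) insert.hyps finite_subset by auto
  show ?case
  proof (cases "y j \<in> alg_cl k (y ` J)")
    case True
    then show ?thesis using J by (intro exI[of _ J]) auto
  next
    case False
    then have "alg_indep k (insert j J) y" using J alg_indep_insert[OF finJ assms(2)] by blast
    moreover have "y ` insert j I \<subseteq> alg_cl k (y ` insert j J)"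
      using J(3) alg_cl_mono[of "y ` J" "y ` insert j J" k] alg_cl_superset[of "y ` insert j J" k] by auto
    ultimately show ?thesis using J(1) by (intro exI[of _ "insert j J"]) auto
  qed
qed

text \<open>An independent subfamily \<open>J\<close> of \<open>y\<close> with the same closure
  spans the independent \<open>x\<close>, so it has at least as many members as \<open>I\<close> and
  is all of it.\<close>

lemma alg_indep_change_basis:
  assumes "finite I" "is_subring k" "alg_indep k I x" "x ` I \<subseteq> alg_cl k (y ` I)"
  shows "alg_indep k I y"
proof -
  obtain J where J: "J \<subseteq> I" "alg_indep k J y" "y ` I \<subseteq> alg_cl k (y ` J)"
    using alg_indep_extract[OF assms(1,2)] by blast
  have finJ: "finite J" using J(1) assms(1) finite_subset by blast
  have "x ` I \<subseteq> alg_cl k (y ` J)" using assms(4) alg_cl_trans[OF J(3)] by blast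
  from alg_indep_card_le[OF assms(1,2,3) _ this] have "card I \<le> card (y ` J)" using finJ by simp
  also have "\<dots> \<le> card J" using finJ by (rule card_image_le)
  finally have "J = I" using J(1) assms(1) by (intro card_seteq) auto
  then show ?thesis using J(2) by simp
qed

subsection \<open>Homomorphisms of subfields\<close>

definition hom_on :: "'a::field set \<Rightarrow> ('a \<Rightarrow> 'b::field) \<Rightarrow> bool" where
  "hom_on L h \<longleftrightarrow> h 1 = 1 \<and> (\<forall>x\<in>L. \<forall>y\<in>L. h (x + y) = h x + h y \<and> h (x * y) = h x * h y)"

lemma hom_on_subset: "hom_on M h \<Longrightarrow> L \<subseteq> M \<Longrightarrow> hom_on L h"
  unfolding hom_on_def by blast

context
  fixes L :: "'a::field set" and h :: "'a \<Rightarrow> 'b::field"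
  assumes L: "is_subfield L" and h: "hom_on L h"
begin

lemma hom_1: "h 1 = 1"
  and hom_add: "x \<in> L \<Longrightarrow> y \<in> L \<Longrightarrow> h (x + y) = h x + h y"
  and hom_mult: "x \<in> L \<Longrightarrow> y \<in> L \<Longrightarrow> h (x * y) = h x * h y"
  using h by (auto simp: hom_on_def)

lemma hom_0: "h 0 = 0"
proof -
  have "h (0 + 0) = h 0 + h 0"
    by (rule hom_add) (rule subring_0[OF subfield_subring[OF L]])+
  then show ?thesis by (metis add_0 add_cancel_right_right)
qed

lemma hom_uminus: "x \<in> L \<Longrightarrow> h (- x) = - h x"
  using hom_add[of x "- x"] subring_uminus[OF subfield_subring[OF L]] hom_0
  by (simp add: eq_neg_iff_add_eq_0 add.commute)

lemma hom_diff: "x \<in> L \<Longrightarrow> y \<in> L \<Longrightarrow> h (x - y) = h x - h y"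
  using hom_add[of x "- y"] hom_uminus[of y] subring_uminus[OF subfield_subring[OF L]] by simp

lemma hom_nonzero:
  assumes "x \<in> L" "x \<noteq> 0"
  shows "h x \<noteq> 0"
proof
  assume "h x = 0"
  then have "h (x * inverse x) = 0"
    using hom_mult[of x "inverse x"] assms subfield_inverse[OF L] by simp
  then show False using assms hom_1 by simp
qed

lemma hom_eq_iff: "x \<in> L \<Longrightarrow> y \<in> L \<Longrightarrow> h x = h y \<longleftrightarrow> x = y"
  using hom_nonzero[of "x - y"] hom_diff[of x y] subring_diff[OF subfield_subring[OF L], of x y] by auto

lemma hom_inverse: "x \<in> L \<Longrightarrow> h (inverse x) = inverse (h x)"
  using hom_mult[of x "inverse x"] hom_1 hom_0 subfield_inverse[OF L, of x]
  by (cases "x = 0") (auto simp: inverse_unique)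

lemma hom_power: "x \<in> L \<Longrightarrow> h (x ^ n) = h x ^ n"
  by (induction n) (auto simp: hom_1 hom_mult subring_power[OF subfield_subring[OF L]])

lemma hom_sum: "(\<And>i. i \<in> I \<Longrightarrow> f i \<in> L) \<Longrightarrow> h (sum f I) = (\<Sum>i\<in>I. h (f i))"
  by (induction I rule: infinite_finite_induct)
     (auto simp: hom_0 hom_add subring_sum[OF subfield_subring[OF L]])

lemma hom_poly:
  assumes "poly_over L p" "x \<in> L"
  shows "h (poly p x) = poly (map_poly h p) (h x)"
  using assms(1)
proof (induction p)
  case (pCons a p)
  have ap: "a \<in> L" "poly_over L p"
    using poly_over_pConsD[OF subfield_subring[OF L] pCons.prems] by auto
  have "poly p x \<in> L" by (rule subring_poly[OF subfield_subring[OF L] ap(2) assms(2)])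
  then show ?case
    using ap pCons.IH assms(2) subring_mult[OF subfield_subring[OF L], of x "poly p x"]
    by (simp add: map_poly_pCons hom_0 hom_add hom_mult)
qed (simp add: hom_0)

lemma subfield_hom_image: "is_subfield (h ` L)"
proof (rule is_subfieldI)
  show "is_subring (h ` L)"
    unfolding is_subring_def
    using subring_1[OF subfield_subring[OF L]] subring_add[OF subfield_subring[OF L]]
      subring_mult[OF subfield_subring[OF L]] subring_uminus[OF subfield_subring[OF L]]
    by (auto simp flip: hom_add hom_mult hom_uminus) (metis hom_1 image_eqI)
  show "inverse x \<in> h ` L" if "x \<in> h ` L" for x
    using that subfield_inverse[OF L] by (auto simp flip: hom_inverse)
qed

lemma subfield_hom_vimage:
  assumes M: "is_subfield M"
  shows "is_subfield {x \<in> L. h x \<in> M}"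
proof (rule is_subfieldI)
  note sL = subfield_subring[OF L] and sM = subfield_subring[OF M]
  show "is_subring {x \<in> L. h x \<in> M}"
    unfolding is_subring_def
    using subring_1[OF sL] subring_add[OF sL] subring_mult[OF sL] subring_uminus[OF sL]
      subring_1[OF sM] subring_add[OF sM] subring_mult[OF sM] subring_uminus[OF sM]
    by (auto simp: hom_1 hom_add hom_mult hom_uminus)
  show "inverse x \<in> {x \<in> L. h x \<in> M}" if "x \<in> {x \<in> L. h x \<in> M}" for x
    using that subfield_inverse[OF L] subfield_inverse[OF M] by (auto simp: hom_inverse)
qed

lemma alg_over_hom:
  assumes "M \<subseteq> L" "x \<in> L" "alg_over M x"
  shows "alg_over (h ` M) (h x)"
proof -
  obtain p where p: "p \<noteq> 0" "poly_over M p" "poly p x = 0" using assms by (auto simp: alg_over_def)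
  have pL: "poly_over L p" using p(2) assms(1) by (auto simp: poly_over_def)
  have "coeff (map_poly h p) (degree p) \<noteq> 0"
    using p(1) hom_nonzero[of "lead_coeff p"] pL by (auto simp: coeff_map_poly hom_0 poly_over_def)
  then have "map_poly h p \<noteq> 0" by auto
  moreover have "poly_over (h ` M) (map_poly h p)"
    using p(2) by (auto simp: poly_over_def coeff_map_poly hom_0)
  moreover have "poly (map_poly h p) (h x) = 0"
    using hom_poly[OF pL assms(2)] p(3) hom_0 by simp
  ultimately show ?thesis unfolding alg_over_def by blast
qed

text \<open>Homomorphisms of fields are injective, so a relation over the image pulls back
  coefficient by coefficient. In this way algebraicity descends along
  \<open>fls_square_subst\<close>.\<close>

lemma alg_over_hom_reflect:
  assumes "is_subring M" "M \<subseteq> L" "x \<in> L" "alg_over (h ` M) (h x)"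
  shows "alg_over M x"
proof -
  obtain q where q: "q \<noteq> 0" "poly_over (h ` M) q" "poly q (h x) = 0" using assms by (auto simp: alg_over_def)
  define g where "g = inv_into M h"
  have inj: "inj_on h M" using assms(2) hom_eq_iff by (auto simp: inj_on_def subset_iff)
  have g0: "g 0 = 0" using inv_into_f_f[OF inj subring_0[OF assms(1)]] by (simp add: g_def hom_0)
  define p where "p = map_poly g q"
  have c: "coeff p i \<in> M" "h (coeff p i) = coeff q i" for i
  proof -
    have "coeff q i \<in> h ` M" "coeff p i = inv_into M h (coeff q i)"
      using q(2) g0 by (auto simp: p_def coeff_map_poly poly_over_def g_def)
    then show "coeff p i \<in> M" "h (coeff p i) = coeff q i"
      by (auto simp: f_inv_into_f inv_into_into)
  qed
  have q_eq: "q = map_poly h p" by (rule poly_eqI) (simp add: coeff_map_poly hom_0 c)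
  then have "p \<noteq> 0" using q(1) by auto
  moreover have "h (poly p x) = 0"
    using hom_poly[of p x] assms(2,3) c(1) q(3) q_eq by (auto simp: poly_over_def)
  then have "poly p x = 0"
    using hom_nonzero[of "poly p x"] subring_poly[OF subfield_subring[OF L], of p x] assms(2,3) c(1)
    by (auto simp: poly_over_def)
  ultimately show ?thesis using c(1) by (auto simp: alg_over_def poly_over_def)
qed

end

lemma hom_image_field_gen:
  assumes "hom_on L h" "is_subfield L" "k \<subseteq> L" "S \<subseteq> L"
  shows "h ` field_gen k S = field_gen (h ` k) (h ` S)"
proof
  have sub: "field_gen k S \<subseteq> L" by (rule field_gen_least[OF assms(2-4)])
  note h = hom_on_subset[OF assms(1) sub]
  have "field_gen k S \<subseteq> {x \<in> field_gen k S. h x \<in> field_gen (h ` k) (h ` S)}"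
    by (intro field_gen_least subfield_hom_vimage subfield_field_gen h)
       (auto intro: field_gen_base field_gen_gen)
  then show "h ` field_gen k S \<subseteq> field_gen (h ` k) (h ` S)" by blast
  show "field_gen (h ` k) (h ` S) \<subseteq> h ` field_gen k S"
    by (intro field_gen_least subfield_hom_image subfield_field_gen h)
       (auto intro: field_gen_base field_gen_gen)
qed

lemma hom_agree:
  assumes "hom_on (field_gen k S) h" "hom_on (field_gen k S) g"
    and "\<And>x. x \<in> k \<Longrightarrow> h x = g x" "\<And>x. x \<in> S \<Longrightarrow> h x = g x" "x \<in> field_gen k S"
  shows "h x = g x"
proof -
  let ?F = "field_gen k S"
  note F = subfield_field_gen[of k S]
  note sF = subring_field_gen[of k S]
  have "is_subfield {x \<in> ?F. h x = g x}"
  proof (rule is_subfieldI)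
    show "is_subring {x \<in> ?F. h x = g x}"
      unfolding is_subring_def
      using subring_1[OF sF] subring_add[OF sF] subring_mult[OF sF] subring_uminus[OF sF]
      by (auto simp: hom_1[OF F assms(1)] hom_1[OF F assms(2)] hom_add[OF F assms(1)] hom_add[OF F assms(2)]
          hom_mult[OF F assms(1)] hom_mult[OF F assms(2)] hom_uminus[OF F assms(1)] hom_uminus[OF F assms(2)])
    show "inverse x \<in> {x \<in> ?F. h x = g x}" if "x \<in> {x \<in> ?F. h x = g x}" for x
      using that subfield_inverse[OF F] hom_inverse[OF F assms(1)] hom_inverse[OF F assms(2)] by auto
  qed
  then have "?F \<subseteq> {x \<in> ?F. h x = g x}"
    by (rule field_gen_least) (auto intro: field_gen_base field_gen_gen assms(3,4))
  then show ?thesis using assms(5) by blast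
qed

lemma alg_cl_hom:
  assumes "hom_on L h" "is_subfield L" "k \<subseteq> L" "S \<subseteq> L" "x \<in> L" "x \<in> alg_cl k S"
  shows "h x \<in> alg_cl (h ` k) (h ` S)"
  using alg_over_hom[OF assms(2,1) field_gen_least[OF assms(2,3,4)] assms(5)] assms(6)
    hom_image_field_gen[OF assms(1-4)] by (simp add: alg_cl_def)

lemma alg_cl_hom_reflect:
  assumes "hom_on L h" "is_subfield L" "k \<subseteq> L" "S \<subseteq> L" "x \<in> L" "h x \<in> alg_cl (h ` k) (h ` S)"
  shows "x \<in> alg_cl k S"
  using alg_over_hom_reflect[OF assms(2,1) subring_field_gen field_gen_least[OF assms(2,3,4)] assms(5)] assms(6)
    hom_image_field_gen[OF assms(1-4)] by (simp add: alg_cl_def)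

lemma subfield_UNIV: "is_subfield UNIV"
  by (simp add: is_subfield_def)

lemma alg_indep_hom:
  assumes "hom_on UNIV h" "is_subring k" "is_subring (h ` k)" "finite I" "alg_indep k I x"
  shows "alg_indep (h ` k) I (\<lambda>i. h (x i))"
  using assms(4,5)
proof induction
  case (insert j I)
  have "x j \<notin> alg_cl k (x ` I)" "alg_indep k I x"
    using insert.prems alg_indep_insert[OF insert.hyps assms(2)] by auto
  then show ?case
    using alg_cl_hom_reflect[OF assms(1) subfield_UNIV, of k "x ` I" "x j"] insert.IH
      alg_indep_insert[OF insert.hyps assms(3)] by (auto simp: image_image)
qed (rule alg_indep_empty)

subsection \<open>Extension of homomorphisms\<close>

definition frac_rel :: "('a::field \<times> 'b::field) set \<Rightarrow> ('a \<times> 'b) set" where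
  "frac_rel G = {(u / v, u' / v') | u v u' v'. (u, u') \<in> G \<and> (v, v') \<in> G \<and> v \<noteq> 0 \<and> v' \<noteq> 0}"

lemma frac_relI:
  "(u, u') \<in> G \<Longrightarrow> (v, v') \<in> G \<Longrightarrow> v \<noteq> 0 \<Longrightarrow> v' \<noteq> 0 \<Longrightarrow> (u / v, u' / v') \<in> frac_rel G"
  unfolding frac_rel_def by blast

lemma frac_relE:
  assumes "(x, y) \<in> frac_rel G"
  obtains u v u' v' where "x = u / v" "y = u' / v'" "(u, u') \<in> G" "(v, v') \<in> G" "v \<noteq> 0" "v' \<noteq> 0"
  using assms unfolding frac_rel_def by blast

lemma frac_rel_single_valued:
  assumes G: "subring_rel G" "functional_rel G" and xy: "(x, y) \<in> frac_rel G" "(x, y') \<in> frac_rel G"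
  shows "y = y'"
proof -
  obtain u v u' v' where 1: "x = u / v" "y = u' / v'" "(u, u') \<in> G" "(v, v') \<in> G" "v \<noteq> 0" "v' \<noteq> 0"
    using xy(1) by (rule frac_relE)
  obtain s t s' t' where 2: "x = s / t" "y' = s' / t'" "(s, s') \<in> G" "(t, t') \<in> G" "t \<noteq> 0" "t' \<noteq> 0"
    using xy(2) by (rule frac_relE)
  have "(u * t - s * v, u' * t' - s' * v') \<in> G"
    by (intro srel_diff[OF G(1)] srel_mult[OF G(1)] 1 2)
  moreover have "u * t - s * v = 0" using 1 2 by (simp add: field_simps)
  ultimately have "u' * t' - s' * v' = 0" using G(2) by (auto simp: functional_rel_def)
  then have "u' / v' = s' / t'" using 1(6) 2(6) by (simp add: frac_eq_eq)
  then show ?thesis using 1 2 by simp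
qed

lemma frac_rel_add_mult:
  assumes G: "subring_rel G" and xy: "(x, y) \<in> frac_rel G" "(w, z) \<in> frac_rel G"
  shows "(x + w, y + z) \<in> frac_rel G" "(x * w, y * z) \<in> frac_rel G"
proof -
  obtain u v u' v' where 1: "x = u / v" "y = u' / v'" "(u, u') \<in> G" "(v, v') \<in> G" "v \<noteq> 0" "v' \<noteq> 0"
    using xy(1) by (rule frac_relE)
  obtain s t s' t' where 2: "w = s / t" "z = s' / t'" "(s, s') \<in> G" "(t, t') \<in> G" "t \<noteq> 0" "t' \<noteq> 0"
    using xy(2) by (rule frac_relE)
  have "((u * t + s * v) / (v * t), (u' * t' + s' * v') / (v' * t')) \<in> frac_rel G"
    by (intro frac_relI srel_add[OF G] srel_mult[OF G] 1 2) (use 1 2 in auto)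
  moreover have "x + w = (u * t + s * v) / (v * t)" "y + z = (u' * t' + s' * v') / (v' * t')"
    using 1 2 by (auto simp: add_frac_eq)
  ultimately show "(x + w, y + z) \<in> frac_rel G" by simp
  have "((u * s) / (v * t), (u' * s') / (v' * t')) \<in> frac_rel G"
    by (intro frac_relI srel_mult[OF G] 1 2) (use 1 2 in auto)
  then show "(x * w, y * z) \<in> frac_rel G" using 1 2 by simp
qed

text \<open>As \<open>x\<close> and \<open>y\<close> are both transcendental,
  \<open>poly P x\<close> and its partner vanish only together, namely for \<open>P = 0\<close>. The
  pairs in \<open>adjoin_rel\<close> therefore extend to quotients.\<close>

lemma hom_extend_transcendental:
  assumes L: "is_subfield L" and h: "hom_on L h"
    and x: "\<not> alg_over L x" and y: "\<not> alg_over (h ` L) y"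
  shows "\<exists>h'. hom_on (field_gen L {x}) h' \<and> (\<forall>l\<in>L. h' l = h l) \<and> h' x = y"
proof -
  note sL = subfield_subring[OF L]
  define D where "D = {(l, h l) | l. l \<in> L}"
  have D: "subring_rel D"
    unfolding D_def subring_rel_def
    using subring_1[OF sL] subring_add[OF sL] subring_mult[OF sL] subring_uminus[OF sL]
      hom_1[OF L h] hom_add[OF L h] hom_mult[OF L h] hom_uminus[OF L h] by auto
  define G where "G = adjoin_rel D x y"
  have G: "subring_rel G" unfolding G_def by (rule subring_rel_adjoin[OF D])
  have c: "coeff P i \<in> L \<and> coeff Q i = h (coeff P i)" if "poly_rel D P Q" for P Q i
    using that by (auto simp: poly_rel_def D_def)
  have zero: "u = 0 \<longleftrightarrow> u' = 0" if "(u, u') \<in> G" for u u'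
  proof -
    from that obtain P Q where PQ: "poly_rel D P Q" "u = poly P x" "u' = poly Q y"
      by (auto simp: G_def adjoin_rel_def)
    have "u = 0 \<longleftrightarrow> P = 0"
      using x c[OF PQ(1)] PQ(2) unfolding alg_over_def poly_over_def by auto
    also have "\<dots> \<longleftrightarrow> Q = 0"
      using c[OF PQ(1)] hom_nonzero[OF L h] hom_0[OF L h] unfolding poly_eq_iff coeff_0 by metis
    also have "\<dots> \<longleftrightarrow> u' = 0"
      using y c[OF PQ(1)] PQ(3) unfolding alg_over_def poly_over_def by auto
    finally show ?thesis .
  qed
  then have fG: "functional_rel G" unfolding functional_rel_def by blast
  define h' where "h' z = (THE w. (z, w) \<in> frac_rel G)" for z
  have h': "h' z = w" if "(z, w) \<in> frac_rel G" for z w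
    unfolding h'_def using that frac_rel_single_valued[OF G fG] by (intro the_equality) auto
  have GI: "(u, u') \<in> frac_rel G" if "(u, u') \<in> G" for u u'
    using frac_relI[OF that srel_1[OF G]] by simp
  have dom: "\<exists>w. (z, w) \<in> frac_rel G" if "z \<in> field_gen L {x}" for z
  proof -
    have 1: "\<exists>w. (poly p x, w) \<in> G" if "poly_over L p" for p
    proof -
      have "poly_rel D p (map_poly h p)"
        using that hom_0[OF L h] by (auto simp: poly_rel_def D_def poly_over_def coeff_map_poly)
      then show ?thesis unfolding G_def adjoin_rel_def by blast
    qed
    from that obtain p q where pq: "z = poly p x / poly q x" "poly_over L p" "poly_over L q" "poly q x \<noteq> 0"
      unfolding field_gen_simple[OF sL] by (auto elim!: fractionsE)
    obtain v w where vw: "(poly p x, v) \<in> G" "(poly q x, w) \<in> G" using 1 pq by blast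
    then show ?thesis using frac_relI[OF vw pq(4)] zero[OF vw(2)] pq by auto
  qed
  have "hom_on (field_gen L {x}) h'"
    unfolding hom_on_def
  proof (intro conjI ballI)
    show "h' 1 = 1" by (rule h'[OF GI[OF srel_1[OF G]]])
    fix a b assume "a \<in> field_gen L {x}" "b \<in> field_gen L {x}"
    then obtain a' b' where ab: "(a, a') \<in> frac_rel G" "(b, b') \<in> frac_rel G" using dom by blast
    show "h' (a + b) = h' a + h' b" "h' (a * b) = h' a * h' b"
      using h'[OF ab(1)] h'[OF ab(2)] h'[OF frac_rel_add_mult(1)[OF G ab]] h'[OF frac_rel_add_mult(2)[OF G ab]]
      by auto
  qed
  moreover have "h' l = h l" if "l \<in> L" for l
  proof -
    have "(l, h l) \<in> D" using that by (auto simp: D_def)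
    then show ?thesis using adjoin_rel_subset[OF D, of x y] by (intro h' GI) (auto simp: G_def)
  qed
  moreover have "h' x = y"
    using adjoin_rel_mem[OF D, of x y] by (intro h' GI) (auto simp: G_def)
  ultimately show ?thesis by blast
qed

theorem hom_extend_indep:
  assumes k: "is_subfield k" and h: "hom_on k h" and "finite I"
    and "alg_indep k I x" "alg_indep (h ` k) I y"
  shows "\<exists>h'. hom_on (field_gen k (x ` I)) h' \<and> (\<forall>l\<in>k. h' l = h l) \<and> (\<forall>i\<in>I. h' (x i) = y i)"
  using assms(3-5)
proof induction
  case empty
  then show ?case using h field_gen_empty[OF k] by auto
next
  case (insert j I)
  note sk = subfield_subring[OF k]
  note hk = subfield_subring[OF subfield_hom_image[OF k h]]
  have x: "alg_indep k I x" "\<not> alg_over (field_gen k (x ` I)) (x j)"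
    using insert.prems(1) alg_indep_insert[OF insert.hyps sk] by (auto simp: alg_cl_def)
  have y: "alg_indep (h ` k) I y" "\<not> alg_over (field_gen (h ` k) (y ` I)) (y j)"
    using insert.prems(2) alg_indep_insert[OF insert.hyps hk] by (auto simp: alg_cl_def)
  obtain g where g: "hom_on (field_gen k (x ` I)) g" "\<forall>l\<in>k. g l = h l" "\<forall>i\<in>I. g (x i) = y i"
    using insert.IH x y by blast
  have "g ` field_gen k (x ` I) = field_gen (g ` k) (g ` x ` I)"
    by (rule hom_image_field_gen[OF g(1) subfield_field_gen]) (auto intro: field_gen_base field_gen_gen)
  also have "g ` k = h ` k" using g(2) by (auto simp: image_iff)
  also have "g ` x ` I = y ` I" using g(3) by (auto simp: image_iff)
  finally have img: "g ` field_gen k (x ` I) = field_gen (h ` k) (y ` I)" .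
  obtain h' where h': "hom_on (field_gen (field_gen k (x ` I)) {x j}) h'"
    "\<forall>l\<in>field_gen k (x ` I). h' l = g l" "h' (x j) = y j"
    using hom_extend_transcendental[OF subfield_field_gen g(1) x(2), of "y j"] y(2) img by auto
  show ?case
  proof (intro exI[of _ h'] conjI ballI)
    show "hom_on (field_gen k (x ` insert j I)) h'" using h'(1) by (simp add: field_gen_field_gen)
    show "h' l = h l" if "l \<in> k" for l using h'(2) g(2) that field_gen_base by metis
    show "h' (x i) = y i" if "i \<in> insert j I" for i
      using h'(2,3) g(3) that field_gen_gen[of "x i" "x ` I" k] by auto
  qed
qed

text \<open>Characteristic 0 has to survive the passage to rational functions:
  \<open>local_root\<close> takes square roots of power series over such fields.\<close>

instance fract :: ("{idom,ring_char_0}") ring_char_0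
proof
  show "inj (of_nat :: nat \<Rightarrow> 'a fract)"
    by (auto simp: inj_def of_nat_fract eq_fract)
qed

instance fract :: ("{idom,ring_char_0}") field_char_0 ..

text \<open>Rational functions are presented as fractions of Laurent polynomials: unlike natural number exponents,
  integer exponents form a linearly ordered group, in which the leading exponent of a fraction lives.\<close>

type_synonym 'o ratfun = "((nat \<Rightarrow>\<^sub>0 int) \<Rightarrow>\<^sub>0 'o) fract"

subsection \<open>Weights and algebraic independence\<close>

text \<open>Restricted to the columns \<open>\<sigma> j\<close> the matrix is the identity modulo 2.
  Instead of an odd determinant, descent is used: an integer relation between the rows has only even
  coefficients and can be halved.\<close>

lemma odd_diagonal_injective:
  fixes M :: "'i \<Rightarrow> nat \<Rightarrow> int" and \<sigma> :: "'i \<Rightarrow> nat"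
  assumes I: "finite I"
    and M: "\<And>i j. i \<in> I \<Longrightarrow> j \<in> I \<Longrightarrow> odd (M i (\<sigma> j)) \<longleftrightarrow> i = j"
    and n: "\<And>l. (\<Sum>i\<in>I. n i * M i l) = 0"
  shows "\<forall>i\<in>I. n i = 0"
  using n
proof (induction "\<Sum>i\<in>I. nat \<bar>n i\<bar>" arbitrary: n rule: less_induct)
  case less
  have ev: "even (n j)" if j: "j \<in> I" for j
  proof -
    have "0 = (\<Sum>i\<in>I. n i * M i (\<sigma> j))" using less.prems by simp
    also have "\<dots> = n j * M j (\<sigma> j) + (\<Sum>i\<in>I - {j}. n i * M i (\<sigma> j))"
      using j I by (simp add: sum.remove)
    finally have "even (n j * M j (\<sigma> j) + (\<Sum>i\<in>I - {j}. n i * M i (\<sigma> j)))" by (metis even_zero)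
    moreover have "even (\<Sum>i\<in>I - {j}. n i * M i (\<sigma> j))"
      using M j by (intro dvd_sum) auto
    ultimately show ?thesis using M j by auto
  qed
  show ?case
  proof (rule ccontr)
    assume "\<not> ?thesis"
    then obtain j where j: "j \<in> I" "n j \<noteq> 0" by blast
    define n' where "n' i = n i div 2" for i
    have n2: "n i = 2 * n' i" if "i \<in> I" for i using ev[OF that] by (simp add: n'_def)
    have "(\<Sum>i\<in>I. nat \<bar>n' i\<bar>) < (\<Sum>i\<in>I. nat \<bar>n i\<bar>)"
      using j n2 by (intro sum_strict_mono_ex1[OF I]) auto
    moreover have "(\<Sum>i\<in>I. n' i * M i l) = 0" for l
    proof -
      have "2 * (\<Sum>i\<in>I. n' i * M i l) = (\<Sum>i\<in>I. n i * M i l)"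
        by (simp add: sum_distrib_left n2 mult.assoc cong: sum.cong)
      then show ?thesis using less.prems[of l] by simp
    qed
    ultimately have "\<forall>i\<in>I. n' i = 0" by (rule less.hyps)
    then show False using j n2 by simp
  qed
qed

text \<open>\<open>w\<close> is an abstract valuation with infinitely many components, instantiated
  by the exponents of rational functions and by \<open>lau_weight\<close>. The weight of a monomial
  in the \<open>x i\<close> is linear in its exponents, so distinct monomials have distinct weights
  by \<open>odd_diagonal_injective\<close>, and terms of distinct weights cannot cancel.\<close>

lemma alg_indep_of_weights:
  fixes w :: "'a::field \<Rightarrow> nat \<Rightarrow> int" and x :: "'i \<Rightarrow> 'a" and \<sigma> :: "'i \<Rightarrow> nat"
  assumes mult: "\<And>a b l. a \<noteq> 0 \<Longrightarrow> b \<noteq> 0 \<Longrightarrow> w (a * b) l = w a l + w b l"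
    and const: "\<And>c l. c \<in> k \<Longrightarrow> c \<noteq> 0 \<Longrightarrow> w c l = 0"
    and sums: "\<And>A f. finite A \<Longrightarrow> A \<noteq> {} \<Longrightarrow> (\<And>a. a \<in> A \<Longrightarrow> f a \<noteq> 0) \<Longrightarrow> inj_on (\<lambda>a. w (f a)) A \<Longrightarrow>
      sum f (A :: ('i \<Rightarrow> nat) set) \<noteq> 0"
    and I: "finite I" and nz: "\<And>i. i \<in> I \<Longrightarrow> x i \<noteq> 0"
    and odd: "\<And>i j. i \<in> I \<Longrightarrow> j \<in> I \<Longrightarrow> odd (w (x i) (\<sigma> j)) \<longleftrightarrow> i = j"
  shows "alg_indep k I x"
  unfolding alg_indep_iff
proof (intro allI impI, rule ccontr)
  fix c e assume c: "mon_coeffs k I c \<and> mon_eval c x = 0" and e: "c e \<noteq> 0"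
  let ?E = "{e. c e \<noteq> 0}"
  have one: "w 1 l = 0" for l using mult[of 1 1 l] by simp
  have pow: "w (a ^ n) l = int n * w a l" if "a \<noteq> 0" for a n l
    using that by (induction n) (auto simp: one mult algebra_simps)
  have prod: "w (\<Prod>i\<in>J. f i) l = (\<Sum>i\<in>J. w (f i) l)" if "finite J" "\<And>i. i \<in> J \<Longrightarrow> f i \<noteq> 0"
    for J f l
    using that by (induction J) (auto simp: one mult)
  have supp: "finite {i. e i \<noteq> 0}" "{i. e i \<noteq> 0} \<subseteq> I" if "c e \<noteq> 0" for e
    using c that unfolding mon_coeffs_def by blast+
  have mon: "(\<Prod>i | e i \<noteq> 0. x i ^ e i) \<noteq> 0" if "c e \<noteq> 0" for e
    using supp[OF that] nz by auto
  have wt: "w (c e * (\<Prod>i | e i \<noteq> 0. x i ^ e i)) l = (\<Sum>i\<in>I. int (e i) * w (x i) l)" if "c e \<noteq> 0" for e l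
  proof -
    have ck: "c e \<in> k" using c by (auto simp: mon_coeffs_def)
    have "w (c e * (\<Prod>i | e i \<noteq> 0. x i ^ e i)) l = w (\<Prod>i | e i \<noteq> 0. x i ^ e i) l"
      using that by (simp only: mult[OF that mon[OF that]] const[OF ck that])
    also have "\<dots> = (\<Sum>i | e i \<noteq> 0. w (x i ^ e i) l)"
      using supp[OF that] nz by (intro prod) auto
    also have "\<dots> = (\<Sum>i | e i \<noteq> 0. int (e i) * w (x i) l)"
      using supp[OF that] nz by (intro sum.cong pow) auto
    also have "\<dots> = (\<Sum>i\<in>I. int (e i) * w (x i) l)"
      using supp[OF that] I by (intro sum.mono_neutral_left) auto
    finally show ?thesis .
  qed
  have "inj_on (\<lambda>e. w (c e * (\<Prod>i | e i \<noteq> 0. x i ^ e i))) ?E"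
  proof (rule inj_onI)
    fix e f assume ef: "e \<in> ?E" "f \<in> ?E"
      "w (c e * (\<Prod>i | e i \<noteq> 0. x i ^ e i)) = w (c f * (\<Prod>i | f i \<noteq> 0. x i ^ f i))"
    have "(\<Sum>i\<in>I. (int (e i) - int (f i)) * w (x i) l) = 0" for l
      using fun_cong[OF ef(3), of l] wt[of e l] wt[of f l] ef(1,2)
      by (simp add: left_diff_distrib sum_subtractf)
    from odd_diagonal_injective[OF I odd this]
    have "\<forall>i\<in>I. int (e i) - int (f i) = 0" by blast
    moreover have "e i = 0" "f i = 0" if "i \<notin> I" for i
      using supp[of e] supp[of f] ef that by auto
    ultimately show "e = f" by (intro ext) (metis eq_iff_diff_eq_0 of_nat_eq_iff)
  qed
  moreover have "finite ?E" using c by (simp add: mon_coeffs_def)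
  moreover have "?E \<noteq> {}" using e by blast
  ultimately have "mon_eval c x \<noteq> 0"
    unfolding mon_eval_def using mon by (intro sums) (simp_all only: mem_Collect_eq mult_eq_0_iff de_Morgan_disj simp_thms)
  then show False using c by blast
qed

subsection \<open>Leading exponents of rational functions\<close>

type_synonym exps = "nat \<Rightarrow>\<^sub>0 int"

text \<open>The linear order on exponent vectors is compatible with addition, which makes leading
  exponents additive. The value at 0 is the unspecified \<open>Max {}\<close>.\<close>

definition lead_exp :: "(exps \<Rightarrow>\<^sub>0 'o::zero) \<Rightarrow> exps" where
  "lead_exp p = Max (Poly_Mapping.keys p)"

lemma lead_exp_in_keys: "p \<noteq> 0 \<Longrightarrow> lead_exp p \<in> Poly_Mapping.keys p"
  unfolding lead_exp_def by (intro Max_in) auto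

lemma lead_exp_ge: "a \<in> Poly_Mapping.keys p \<Longrightarrow> a \<le> lead_exp p"
  unfolding lead_exp_def by (intro Max_ge) auto

lemma lead_exp_eqI: "a \<in> Poly_Mapping.keys p \<Longrightarrow> (\<And>b. b \<in> Poly_Mapping.keys p \<Longrightarrow> b \<le> a) \<Longrightarrow> lead_exp p = a"
  unfolding lead_exp_def by (intro Max_eqI) auto

lemma single_nonzero: "c \<noteq> 0 \<Longrightarrow> Poly_Mapping.single a c \<noteq> 0"
  by (metis lookup_single_eq lookup_zero)

lemma lead_exp_single: "c \<noteq> 0 \<Longrightarrow> lead_exp (Poly_Mapping.single a c) = a"
  by (auto simp: lead_exp_def)

lemma lead_exp_1: "lead_exp (1 :: exps \<Rightarrow>\<^sub>0 'o::zero_neq_one) = 0"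
  using lead_exp_single[of "1 :: 'o" 0] by simp

lemma lead_exp_add_le:
  assumes "p + q \<noteq> 0" "p \<noteq> 0" "q \<noteq> 0"
  shows "lead_exp (p + q) \<le> max (lead_exp p) (lead_exp q)"
proof -
  have "lead_exp (p + q) \<in> Poly_Mapping.keys p \<union> Poly_Mapping.keys q"
    using lead_exp_in_keys[OF assms(1)] Poly_Mapping.keys_add[of p q] by blast
  then show ?thesis using lead_exp_ge by (auto simp: le_max_iff_disj)
qed

text \<open>The sum of the two leading exponents comes from a single pair of terms: once both
  leading terms are split off, the remaining products have only smaller exponents.\<close>

lemma lead_exp_mult:
  fixes p q :: "exps \<Rightarrow>\<^sub>0 'o::idom"
  assumes "p \<noteq> 0" "q \<noteq> 0"
  shows "lead_exp (p * q) = lead_exp p + lead_exp q"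
proof (rule lead_exp_eqI)
  show "b \<le> lead_exp p + lead_exp q" if b: "b \<in> Poly_Mapping.keys (p * q)" for b
  proof -
    obtain s t where "b = s + t" "s \<in> Poly_Mapping.keys p" "t \<in> Poly_Mapping.keys q" using b keys_mult[of p q] by blast
    then show ?thesis using add_mono[OF lead_exp_ge lead_exp_ge] by auto
  qed
  let ?a = "lead_exp p" and ?b = "lead_exp q"
  let ?s = "Poly_Mapping.single ?a (Poly_Mapping.lookup p ?a)" and ?t = "Poly_Mapping.single ?b (Poly_Mapping.lookup q ?b)"
  have lt: "s < ?a" if "s \<in> Poly_Mapping.keys (p - ?s)" for s
  proof -
    have "s \<in> Poly_Mapping.keys p \<and> s \<noteq> ?a"
      using that by (auto simp: in_keys_iff lookup_minus lookup_single when_def split: if_splits)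
    then show ?thesis using lead_exp_ge[of s p] by auto
  qed
  have lt': "t < ?b" if "t \<in> Poly_Mapping.keys (q - ?t)" for t
  proof -
    have "t \<in> Poly_Mapping.keys q \<and> t \<noteq> ?b"
      using that by (auto simp: in_keys_iff lookup_minus lookup_single when_def split: if_splits)
    then show ?thesis using lead_exp_ge[of t q] by auto
  qed
  have z1: "Poly_Mapping.lookup (u * v) (?a + ?b) = 0"
    if "\<And>s. s \<in> Poly_Mapping.keys u \<Longrightarrow> s < ?a" "\<And>t. t \<in> Poly_Mapping.keys v \<Longrightarrow> t \<le> ?b" for u v :: "exps \<Rightarrow>\<^sub>0 'o"
  proof (rule ccontr)
    assume "Poly_Mapping.lookup (u * v) (?a + ?b) \<noteq> 0"
    then obtain s t where "?a + ?b = s + t" "s \<in> Poly_Mapping.keys u" "t \<in> Poly_Mapping.keys v"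
      using keys_mult[of u v] by (auto simp flip: in_keys_iff)
    then show False using that add_less_le_mono[of s ?a t ?b] by auto
  qed
  have z2: "Poly_Mapping.lookup (u * v) (?a + ?b) = 0"
    if "\<And>s. s \<in> Poly_Mapping.keys u \<Longrightarrow> s \<le> ?a" "\<And>t. t \<in> Poly_Mapping.keys v \<Longrightarrow> t < ?b" for u v :: "exps \<Rightarrow>\<^sub>0 'o"
  proof (rule ccontr)
    assume "Poly_Mapping.lookup (u * v) (?a + ?b) \<noteq> 0"
    then obtain s t where "?a + ?b = s + t" "s \<in> Poly_Mapping.keys u" "t \<in> Poly_Mapping.keys v"
      using keys_mult[of u v] by (auto simp flip: in_keys_iff)
    then show False using that add_le_less_mono[of s ?a t ?b] by auto
  qed
  have "p * q = ?s * ?t + (p - ?s) * q + ?s * (q - ?t)" by (simp add: algebra_simps)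
  then have "Poly_Mapping.lookup (p * q) (?a + ?b) = Poly_Mapping.lookup (?s * ?t) (?a + ?b) +
      Poly_Mapping.lookup ((p - ?s) * q) (?a + ?b) + Poly_Mapping.lookup (?s * (q - ?t)) (?a + ?b)"
    by (metis lookup_add)
  also have "Poly_Mapping.lookup ((p - ?s) * q) (?a + ?b) = 0" by (rule z1) (auto intro: lt lead_exp_ge)
  also have "Poly_Mapping.lookup (?s * (q - ?t)) (?a + ?b) = 0"
    by (rule z2) (auto intro: lt' split: if_splits)
  finally have "Poly_Mapping.lookup (p * q) (?a + ?b) = Poly_Mapping.lookup p ?a * Poly_Mapping.lookup q ?b"
    by (simp add: mult_single)
  then show "?a + ?b \<in> Poly_Mapping.keys (p * q)"
    using lead_exp_in_keys[OF assms(1)] lead_exp_in_keys[OF assms(2)] by (simp add: in_keys_iff)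
qed

text \<open>Extends \<open>lead_exp\<close> to the fraction field, as a valuation in which sums are
  bounded by \<open>max\<close>. For nonzero arguments the choice of the fraction is immaterial, by
  \<open>rat_exp_Fract\<close>.\<close>

definition rat_exp :: "'o::idom ratfun \<Rightarrow> exps" where
  "rat_exp z = (let (a, b) = (SOME (a, b). b \<noteq> 0 \<and> z = Fract a b) in lead_exp a - lead_exp b)"

lemma rat_exp_Fract:
  fixes a b :: "exps \<Rightarrow>\<^sub>0 'o::idom"
  assumes "a \<noteq> 0" "b \<noteq> 0"
  shows "rat_exp (Fract a b) = lead_exp a - lead_exp b"
proof -
  obtain c d where cd: "(SOME (c, d). d \<noteq> 0 \<and> Fract a b = Fract c d) = (c, d)" by fastforce
  have "case (SOME (c, d). d \<noteq> 0 \<and> Fract a b = Fract c d) of (c, d) \<Rightarrow> d \<noteq> 0 \<and> Fract a b = Fract c d"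
    by (rule someI[of _ "(a, b)"]) (use assms in auto)
  then have *: "d \<noteq> 0" "Fract a b = Fract c d" using cd by auto
  then have eq: "a * d = c * b" using assms by (simp add: eq_fract)
  then have "c \<noteq> 0" using assms * by auto
  then have "lead_exp a + lead_exp d = lead_exp c + lead_exp b"
    using lead_exp_mult[of a d] lead_exp_mult[of c b] assms * eq by simp
  then show ?thesis using cd by (simp add: rat_exp_def algebra_simps)
qed

lemma nonzero_fractE:
  fixes z :: "'a::idom fract"
  assumes "z \<noteq> 0"
  obtains a b where "z = Fract a b" "a \<noteq> 0" "b \<noteq> 0"
proof (cases z)
  case (Fract a b)
  then have "a \<noteq> 0" using assms by (auto simp: fract_collapse)
  then show ?thesis using Fract that by blast
qed

lemma rat_exp_mult:
  fixes y z :: "'o::idom ratfun"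
  assumes "y \<noteq> 0" "z \<noteq> 0"
  shows "rat_exp (y * z) = rat_exp y + rat_exp z"
proof -
  obtain a b c d where "y = Fract a b" "z = Fract c d" "a \<noteq> 0" "b \<noteq> 0" "c \<noteq> 0" "d \<noteq> 0"
    using assms by (metis nonzero_fractE)
  then show ?thesis by (simp add: rat_exp_Fract lead_exp_mult)
qed

lemma rat_exp_add_le:
  fixes y z :: "'o::idom ratfun"
  assumes "y \<noteq> 0" "z \<noteq> 0" "y + z \<noteq> 0"
  shows "rat_exp (y + z) \<le> max (rat_exp y) (rat_exp z)"
proof -
  obtain a b c d where *: "y = Fract a b" "z = Fract c d" "a \<noteq> 0" "b \<noteq> 0" "c \<noteq> 0" "d \<noteq> 0"
    using assms by (metis nonzero_fractE)
  have yz: "y + z = Fract (a * d + c * b) (b * d)" using * by simp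
  then have nz: "a * d + c * b \<noteq> 0" using assms(3) by (auto simp: fract_collapse)
  have "rat_exp (y + z) = lead_exp (a * d + c * b) - (lead_exp b + lead_exp d)"
    using yz nz * by (simp add: rat_exp_Fract lead_exp_mult)
  moreover have "lead_exp (a * d + c * b) \<le> max (lead_exp a + lead_exp d) (lead_exp c + lead_exp b)"
    using lead_exp_add_le[OF nz] * by (simp add: lead_exp_mult)
  ultimately have "rat_exp (y + z) + (lead_exp b + lead_exp d) \<le> lead_exp a + lead_exp d \<or>
      rat_exp (y + z) + (lead_exp b + lead_exp d) \<le> lead_exp c + lead_exp b"
    by (auto simp: le_max_iff_disj)
  moreover have "lead_exp a + lead_exp d = rat_exp y + (lead_exp b + lead_exp d)"
    "lead_exp c + lead_exp b = rat_exp z + (lead_exp b + lead_exp d)"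
    using * by (auto simp: rat_exp_Fract algebra_simps)
  ultimately show ?thesis by (metis add_le_cancel_right le_max_iff_disj)
qed

lemma rat_exp_1: "rat_exp (1 :: 'o::idom ratfun) = 0"
  using rat_exp_mult[of "1 :: 'o ratfun" 1] by simp

lemma rat_exp_minus: "z \<noteq> 0 \<Longrightarrow> rat_exp (- z) = rat_exp z"
  for z :: "'o::idom ratfun"
proof -
  have "rat_exp (- 1 :: 'o ratfun) + rat_exp (- 1 :: 'o ratfun) = rat_exp (1 :: 'o ratfun)"
    using rat_exp_mult[of "- 1 :: 'o ratfun" "- 1"] by simp
  then have "rat_exp (- 1 :: 'o ratfun) = 0" by (simp add: rat_exp_1)
  moreover assume "z \<noteq> 0"
  ultimately show ?thesis using rat_exp_mult[of "- 1" z] by simp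
qed

text \<open>The ultrametric inequality for distinct values. That the exponent of the sum is one of
  the given exponents is the strengthening that keeps it distinct from the exponent of the next term
  in the induction.\<close>

lemma rat_exp_sum:
  fixes f :: "'i \<Rightarrow> 'o::idom ratfun"
  assumes "finite A" "A \<noteq> {}" "\<And>a. a \<in> A \<Longrightarrow> f a \<noteq> 0" "inj_on (\<lambda>a. rat_exp (f a)) A"
  shows "sum f A \<noteq> 0 \<and> rat_exp (sum f A) \<in> (\<lambda>a. rat_exp (f a)) ` A"
  using assms
proof (induction A rule: finite_ne_induct)
  case (insert a A)
  let ?s = "sum f A"
  have IH: "?s \<noteq> 0" "rat_exp ?s \<in> (\<lambda>a. rat_exp (f a)) ` A"
    using insert by (auto simp: inj_on_def)
  have fa: "f a \<noteq> 0" using insert.prems by simp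
  have ne: "rat_exp (f a) \<noteq> rat_exp ?s"
    using IH(2) insert.prems(2) insert.hyps by (auto simp: inj_on_def)
  have nz: "f a + ?s \<noteq> 0"
  proof
    assume "f a + ?s = 0"
    then have "f a = - ?s" by (simp add: add_eq_0_iff2)
    then show False using ne rat_exp_minus[OF IH(1)] by simp
  qed
  have "rat_exp (f a + ?s) \<le> max (rat_exp (f a)) (rat_exp ?s)"
    by (rule rat_exp_add_le[OF fa IH(1) nz])
  moreover have "rat_exp (f a) \<le> max (rat_exp (f a + ?s)) (rat_exp ?s)"
    using rat_exp_add_le[of "f a + ?s" "- ?s"] fa IH(1) nz rat_exp_minus[OF IH(1)] by simp
  moreover have "rat_exp ?s \<le> max (rat_exp (f a + ?s)) (rat_exp (f a))"
    using rat_exp_add_le[of "f a + ?s" "- f a"] fa IH(1) nz rat_exp_minus[OF fa] by simp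
  ultimately have "rat_exp (f a + ?s) = rat_exp (f a) \<or> rat_exp (f a + ?s) = rat_exp ?s"
    using ne by (auto simp: max_def split: if_splits)
  then show ?case using IH(2) nz insert.hyps by auto
qed auto

section \<open>Constants and variables of the rational function field\<close>

definition rat_const :: "'o::idom \<Rightarrow> 'o ratfun" where
  "rat_const c = Fract (Poly_Mapping.single 0 c) 1"

definition rat_var :: "nat \<Rightarrow> 'o::idom ratfun" where
  "rat_var i = Fract (Poly_Mapping.single (Poly_Mapping.single i 1) 1) 1"

lemma rat_const_add: "rat_const (a + b) = rat_const a + rat_const b"
  and rat_const_mult: "rat_const (a * b) = rat_const a * rat_const b"
  and rat_const_1: "rat_const 1 = 1"
  and rat_const_0: "rat_const 0 = 0"
  by (auto simp: rat_const_def single_add mult_single fract_collapse)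

lemma rat_exp_const:
  assumes "c \<noteq> 0"
  shows "rat_exp (rat_const c) = 0"
proof -
  have "Poly_Mapping.single (0::exps) c \<noteq> 0" using assms by (rule single_nonzero)
  then show ?thesis
    using assms by (simp add: rat_const_def rat_exp_Fract lead_exp_single lead_exp_1)
qed

lemma rat_var_nonzero: "rat_var i \<noteq> 0"
  by (simp add: rat_var_def Zero_fract_def eq_fract single_nonzero)

lemma rat_exp_var: "rat_exp (rat_var i) = Poly_Mapping.single i 1"
  by (simp add: rat_var_def rat_exp_Fract lead_exp_single single_nonzero lead_exp_1)

lemma hom_on_rat_const: "hom_on UNIV (rat_const :: 'o::field \<Rightarrow> _)"
  by (simp add: hom_on_def rat_const_1 rat_const_add rat_const_mult)

lemma alg_indep_rat_var:
  assumes "finite I"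
  shows "alg_indep (range (rat_const :: 'o::field \<Rightarrow> _)) I rat_var"
proof (rule alg_indep_of_weights[where w = "\<lambda>z. Poly_Mapping.lookup (rat_exp z)" and \<sigma> = "\<lambda>i. i"])
  show "Poly_Mapping.lookup (rat_exp (a * b)) l = Poly_Mapping.lookup (rat_exp a) l + Poly_Mapping.lookup (rat_exp b) l"
    if "a \<noteq> 0" "b \<noteq> 0" for a b :: "'o ratfun" and l
    by (simp add: rat_exp_mult that lookup_add)
  show "Poly_Mapping.lookup (rat_exp c) l = 0" if "c \<in> range rat_const" "c \<noteq> 0" for c :: "'o ratfun" and l
  proof -
    obtain x where x: "c = rat_const x" using \<open>c \<in> _\<close> by blast
    then have "x \<noteq> 0" using \<open>c \<noteq> 0\<close> by (auto simp: rat_const_0)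
    then show ?thesis using x by (simp add: rat_exp_const)
  qed
  show "sum f A \<noteq> 0"
    if "finite A" "A \<noteq> {}" "\<And>a. a \<in> A \<Longrightarrow> f a \<noteq> 0" "inj_on (\<lambda>a. Poly_Mapping.lookup (rat_exp (f a))) A"
    for A and f :: "(nat \<Rightarrow> nat) \<Rightarrow> 'o ratfun"
    using rat_exp_sum[OF that(1-3)] that(4) by (auto simp: inj_on_def)
qed (use assms in \<open>auto simp: rat_var_nonzero rat_exp_var lookup_single when_def\<close>)

text \<open>Index \<open>0\<close> carries the order in the series variable, index \<open>l + 1\<close> the
  exponent of the variable \<open>l\<close> in the leading coefficient. The weight of \<open>0\<close> is a junk value.\<close>

definition lau_weight :: "'o::field ratfun fls \<Rightarrow> nat \<Rightarrow> int" where
  "lau_weight g l = (case l of 0 \<Rightarrow> fls_subdegree g | Suc l' \<Rightarrow> Poly_Mapping.lookup (rat_exp (fls_nth g (fls_subdegree g))) l')"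

text \<open>In a sum of terms of distinct weights only those of least order reach the lowest
  coefficient. Their orders agree, so their leading coefficients have distinct exponents, and
  \<open>rat_exp_sum\<close> keeps them from cancelling.\<close>

lemma alg_indep_lau_weight:
  fixes x :: "'i \<Rightarrow> 'o::field ratfun fls" and \<sigma> :: "'i \<Rightarrow> nat"
  assumes I: "finite I" "\<And>i. i \<in> I \<Longrightarrow> x i \<noteq> 0"
    "\<And>i j. i \<in> I \<Longrightarrow> j \<in> I \<Longrightarrow> odd (lau_weight (x i) (\<sigma> j)) \<longleftrightarrow> i = j"
  shows "alg_indep (range (\<lambda>c. fls_const (rat_const c))) I x"
proof (rule alg_indep_of_weights[where w = lau_weight, OF _ _ _ I])
  show "lau_weight (a * b) l = lau_weight a l + lau_weight b l"
    if "a \<noteq> 0" "b \<noteq> 0" for a b :: "'o ratfun fls" and l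
    using that by (auto simp: lau_weight_def rat_exp_mult lookup_add split: nat.splits)
  show "lau_weight c l = 0" if "c \<in> range (\<lambda>c. fls_const (rat_const c))" "c \<noteq> 0" for c :: "'o ratfun fls" and l
  proof -
    obtain x where x: "c = fls_const (rat_const x)" using \<open>c \<in> _\<close> by blast
    then have "x \<noteq> 0" using \<open>c \<noteq> 0\<close> by (auto simp: rat_const_0)
    then show ?thesis using x by (simp add: lau_weight_def rat_exp_const split: nat.splits)
  qed
  show "sum f A \<noteq> 0"
    if A: "finite A" "A \<noteq> {}" and f: "\<And>a. a \<in> A \<Longrightarrow> f a \<noteq> 0" and inj: "inj_on (\<lambda>a. lau_weight (f a)) A"
    for A and f :: "('i \<Rightarrow> nat) \<Rightarrow> 'o ratfun fls"
  proof -
    define s where "s = Min ((\<lambda>a. fls_subdegree (f a)) ` A)"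
    define B where "B = {a \<in> A. fls_subdegree (f a) = s}"
    have s: "s \<le> fls_subdegree (f a)" if "a \<in> A" for a
      unfolding s_def using A that by (intro Min_le) auto
    have "s \<in> (\<lambda>a. fls_subdegree (f a)) ` A" unfolding s_def using A by (intro Min_in) auto
    then have B: "finite B" "B \<noteq> {}" using A by (auto simp: B_def)
    have "fls_nth (sum f A) s = (\<Sum>a\<in>A. fls_nth (f a) s)" by (rule fls_nth_sum)
    also have "\<dots> = (\<Sum>a\<in>B. fls_nth (f a) s)"
      unfolding B_def using A(1) s
      by (intro sum.mono_neutral_right) (auto, metis fls_eq0_below_subdegree order_le_less)
    also have "\<dots> \<noteq> 0"
    proof (rule conjunct1[OF rat_exp_sum[OF B]])
      show "fls_nth (f a) s \<noteq> 0" if "a \<in> B" for a using that f by (auto simp: B_def)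
      show "inj_on (\<lambda>a. rat_exp (fls_nth (f a) s)) B"
      proof (rule inj_onI)
        fix a b assume ab: "a \<in> B" "b \<in> B" "rat_exp (fls_nth (f a) s) = rat_exp (fls_nth (f b) s)"
        have "lau_weight (f a) = lau_weight (f b)"
          using ab by (auto simp: lau_weight_def B_def fun_eq_iff split: nat.splits)
        then show "a = b" using inj ab by (auto simp: inj_on_def B_def)
      qed
    qed
    finally show ?thesis by auto
  qed
qed

subsection \<open>Polynomials with prescribed root multiplicities\<close>

lemma coeff_pcompose_linear: "coeff (pcompose p [:0, c:]) l = coeff p l * c ^ l"
  for c :: "'a::comm_ring_1"
  by (induction p arbitrary: l) (auto simp: pcompose_pCons coeff_pCons mult_ac split: nat.splits)

lemma pcompose_power_left: "pcompose (p ^ n) q = pcompose p q ^ n" for p q :: "'a::comm_ring_1 poly"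
  by (induction n) (auto simp: pcompose_mult pcompose_1)

text \<open>A valuation ring preorders the nonzero elements totally, by finiteness of their
  quotient; \<open>b\<close> belongs to a maximum among the finitely many
  \<open>x i\<close>.\<close>

lemma place_max_element:
  assumes G: "place_rel G" and "finite I" "I \<noteq> {}" "\<And>i. i \<in> I \<Longrightarrow> x i \<noteq> 0"
  shows "\<exists>b\<in>I. \<forall>i\<in>I. x i / x b \<in> Domain G"
  using assms(2-)
proof (induction I rule: finite_ne_induct)
  case (singleton j)
  then show ?case using srel_1[OF place_relD(1)[OF G]] by auto
next
  case (insert j I)
  note sG = place_relD(1)[OF G]
  obtain b where b: "b \<in> I" "\<And>i. i \<in> I \<Longrightarrow> x i / x b \<in> Domain G" using insert by auto
  have nz: "x b \<noteq> 0" "x j \<noteq> 0" using insert.prems b(1) by auto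
  have "x j / x b \<in> Domain G \<or> inverse (x j / x b) \<in> Domain G"
    using nz by (intro place_relD(3)[OF G]) auto
  then show ?case
  proof
    assume "x j / x b \<in> Domain G"
    then show ?thesis using b by (intro bexI[of _ b]) auto
  next
    assume "inverse (x j / x b) \<in> Domain G"
    then obtain w where w: "(x b / x j, w) \<in> G" by auto
    have "x i / x j \<in> Domain G" if i: "i \<in> insert j I" for i
    proof (cases "i = j")
      case True
      then show ?thesis using nz srel_1[OF sG] by auto
    next
      case False
      then obtain v where "(x i / x b, v) \<in> G" using b(2) i by blast
      from srel_mult[OF sG this w] show ?thesis using nz by auto
    qed
    then show ?thesis by (intro bexI[of _ j]) auto
  qed
qed

text \<open>These are \<open>m - 1\<close> homogeneous equations in \<open>m\<close> unknowns. The \<open>m\<close> variables cannot all be algebraic over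
  the \<open>m - 1\<close> values of the equations, so some place is trivial on these values and infinite at a variable;
  rescaling by the variable of largest pole yields a nonzero solution in the residue field.\<close>

theorem weighted_roots_exist:
  fixes wt :: "nat \<Rightarrow> nat"
  assumes m: "m > 0" and wt: "\<And>i. i < m \<Longrightarrow> wt i \<ge> 1"
  defines "n \<equiv> (\<Sum>i<m. wt i)"
  shows "\<exists>u :: nat \<Rightarrow> 'k::field ratfun alg_closure. (\<exists>i<m. u i \<noteq> 0) \<and>
    (\<forall>j. 1 \<le> j \<and> j < m \<longrightarrow> coeff (\<Prod>i<m. [:- u i, 1:] ^ wt i) (n - j) = 0)"
proof -
  define P :: "'k ratfun poly" where "P = (\<Prod>i<m. [:- rat_var i, 1:] ^ wt i)"
  define e where "e j = coeff P (n - j)" for j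
  define k0 :: "'k ratfun set" where "k0 = range rat_const"
  define T where "T = e ` {1..<m}"
  have "is_subfield k0"
    unfolding k0_def by (rule subfield_hom_image[OF subfield_UNIV hom_on_rat_const])
  note k0 = subfield_subring[OF this]
  have "(\<Sum>i<m. 1) \<le> n" unfolding n_def using wt by (intro sum_mono) auto
  then have mn: "m \<le> n" by simp
  have "\<exists>a<m. rat_var a \<notin> alg_cl k0 T"
  proof (rule ccontr)
    assume "\<not> ?thesis"
    then have "rat_var ` {..<m} \<subseteq> alg_cl k0 T" by auto
    then have "card {..<m} \<le> card T"
      by (intro alg_indep_card_le[OF _ k0, where x = rat_var])
        (simp_all add: k0_def alg_indep_rat_var, simp add: T_def)
    then have "m \<le> card T" by simp
    also have "\<dots> \<le> card {1..<m}" unfolding T_def by (intro card_image_le) auto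
    finally show False using m by simp
  qed
  then obtain a where a: "a < m" "rat_var a \<notin> alg_cl k0 T" by blast
  then have "\<not> alg_over (field_gen k0 T) (rat_var a)" by (simp add: alg_cl_def)
  from place_transcendental[OF subring_field_gen this]
  obtain G :: "('k ratfun \<times> 'k ratfun alg_closure) set" where
    G: "place_rel G" "\<forall>l\<in>field_gen k0 T. (l, to_ac l) \<in> G" "(inverse (rat_var a), 0) \<in> G" by blast
  note sG = place_relD(1)[OF G(1)] and fG = place_relD(2)[OF G(1)]
  obtain b where b: "b < m" "\<And>i. i < m \<Longrightarrow> rat_var i / rat_var b \<in> Domain G"
    using place_max_element[OF G(1), of "{..<m}" rat_var] m by (auto simp: rat_var_nonzero)
  then have "\<forall>i. \<exists>y. i < m \<longrightarrow> (rat_var i / rat_var b, y) \<in> G" by blast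
  then obtain u where u: "\<And>i. i < m \<Longrightarrow> (rat_var i / rat_var b, u i) \<in> G" by metis
  define P' :: "'k ratfun poly" where "P' = (\<Prod>i<m. [:- (rat_var i / rat_var b), 1:] ^ wt i)"
  define Q where "Q = (\<Prod>i<m. [:- u i, 1:] ^ wt i)"
  have PQ: "poly_rel G P' Q"
    unfolding P'_def Q_def using u
    by (intro poly_rel_prod[OF sG] poly_rel_power[OF sG] poly_rel_pCons[OF sG] srel_uminus[OF sG]
          srel_1[OF sG] poly_rel_0[OF sG]) auto
  \<comment> \<open>Homogeneity: dividing all roots by \<open>rat_var b\<close> divides the
    coefficient \<open>e j\<close> by the power \<open>j\<close> of \<open>rat_var b\<close>. The
    place is finite at \<open>e j\<close> and, \<open>b\<close> being at least as large as the
    infinite \<open>a\<close>, sends \<open>inverse (rat_var b)\<close> to 0, so the new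
    coefficients have value 0.\<close>
  have pcP: "pcompose P [:0, rat_var b:] = smult (rat_var b ^ n) P'"
  proof -
    have "pcompose P [:0, rat_var b:] = (\<Prod>i<m. [:- rat_var i, rat_var b:] ^ wt i)"
      unfolding P_def by (simp add: pcompose_prod pcompose_power_left pcompose_pCons)
    also have "\<dots> = (\<Prod>i<m. smult (rat_var b ^ wt i) ([:- (rat_var i / rat_var b), 1:] ^ wt i))"
      by (intro prod.cong refl) (simp add: rat_var_nonzero flip: smult_power)
    also have "\<dots> = smult (rat_var b ^ n) P'"
      unfolding P'_def n_def by (simp add: prod_smult power_sum)
    finally show ?thesis .
  qed
  have inv_b: "(inverse (rat_var b), 0) \<in> G"
  proof -
    have "(inverse (rat_var a) * (rat_var a / rat_var b), 0 * u a) \<in> G"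
      by (rule srel_mult[OF sG G(3) u[OF a(1)]])
    then show ?thesis by (simp add: rat_var_nonzero field_simps)
  qed
  have "coeff Q (n - j) = 0" if j: "1 \<le> j" "j < m" for j
  proof -
    have "e j * rat_var b ^ (n - j) = rat_var b ^ n * coeff P' (n - j)"
      using arg_cong[OF pcP, of "\<lambda>p. coeff p (n - j)"] by (simp add: coeff_pcompose_linear e_def)
    moreover have "rat_var b ^ n = rat_var b ^ (n - j) * (rat_var b :: 'k ratfun) ^ j"
      using j mn by (simp flip: power_add)
    ultimately have eq: "coeff P' (n - j) = e j * inverse (rat_var b) ^ j"
      by (simp add: rat_var_nonzero field_simps)
    have "e j \<in> field_gen k0 T" using j by (intro field_gen_gen) (auto simp: T_def)
    then have "(e j * inverse (rat_var b) ^ j, to_ac (e j) * 0 ^ j) \<in> G"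
      using G(2) by (intro srel_mult[OF sG] srel_power[OF sG] inv_b) auto
    then have "(coeff P' (n - j), 0) \<in> G" using j by (simp add: eq zero_power)
    moreover have "(coeff P' (n - j), coeff Q (n - j)) \<in> G" using PQ by (simp add: poly_rel_def)
    ultimately show ?thesis using srel_single_valued[OF sG fG] by blast
  qed
  moreover have "u b \<noteq> 0"
  proof -
    have "(1, u b) \<in> G" using u[OF b(1)] by (simp add: rat_var_nonzero)
    then have "u b = 1" using srel_single_valued[OF sG fG _ srel_1[OF sG]] by blast
    then show ?thesis by simp
  qed
  ultimately show ?thesis using b(1) unfolding Q_def by blast
qed

text \<open>With \<open>f = x\<^sup>n + g\<close>, the polynomial \<open>x f' - n f = x g' - n g\<close> has degree at most \<open>n - m\<close> and is divisible
  by \<open>\<Prod>(x - u i)\<^bsup>wt i - 1\<^esup>\<close>, which has that degree; the constant quotient cannot vanish anywhere.\<close>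

theorem weighted_roots_distinct:
  fixes u :: "nat \<Rightarrow> 'o::field_char_0" and wt :: "nat \<Rightarrow> nat"
  assumes wt: "\<And>i. i < m \<Longrightarrow> wt i \<ge> 1"
  defines "n \<equiv> (\<Sum>i<m. wt i)" and "f \<equiv> (\<Prod>i<m. [:- u i, 1:] ^ wt i)"
  assumes zero: "\<And>j. 1 \<le> j \<Longrightarrow> j < m \<Longrightarrow> coeff f (n - j) = 0" and nz: "\<exists>i<m. u i \<noteq> 0"
  shows "inj_on u {..<m}" "i < m \<Longrightarrow> u i \<noteq> 0"
proof -
  define q where "q = (\<Prod>i<m. [:- u i, 1:] ^ (wt i - 1))"
  define s where "s = (\<Prod>i<m. [:- u i, 1:])"
  \<comment> \<open>Logarithmic derivative: \<open>t / s\<close> is the sum of the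
    \<open>wt i / (x - u i)\<close>, hence \<open>pderiv f = q * t\<close>, and \<open>h\<close> is
    the quotient of x f' - n f by \<open>q\<close>. If some \<open>u i\<close> is 0, both terms of
    \<open>h\<close> vanish at 0; if two \<open>u i\<close> coincide, both vanish at that common
    root.\<close>
  define t where "t = (\<Sum>i<m. smult (of_nat (wt i)) (\<Prod>j\<in>{..<m} - {i}. [:- u j, 1:]))"
  define h where "h = [:0, 1:] * t - smult (of_nat n) s"
  have "(\<Sum>i<m. 1) \<le> n" unfolding n_def using wt by (intro sum_mono) auto
  then have mn: "m \<le> n" by simp
  have f_eq: "f = q * s"
    unfolding f_def q_def s_def prod.distrib[symmetric]
    using wt by (intro prod.cong refl) (metis Suc_pred' lessThan_iff power_Suc2 less_eq_Suc_le One_nat_def)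
  have deg_pow: "degree ([:- c, 1:] ^ l) = l" for c :: 'o and l by (simp add: degree_power_eq)
  have deg_f: "degree f = n" unfolding f_def n_def by (subst degree_prod_eq_sum_degree) (auto simp: deg_pow)
  have "degree q = (\<Sum>i<m. wt i - 1)" unfolding q_def by (subst degree_prod_eq_sum_degree) (auto simp: deg_pow)
  also have "\<dots> = n - m" unfolding n_def using wt by (subst sum_subtractf_nat) auto
  finally have deg_q: "degree q = n - m" .
  have monic: "lead_coeff f = 1" unfolding f_def by (simp add: lead_coeff_prod lead_coeff_power)
  have pf: "pderiv f = q * t"
  proof -
    have "pderiv f = (\<Sum>i<m. (\<Prod>j\<in>{..<m} - {i}. [:- u j, 1:] ^ wt j) * pderiv ([:- u i, 1:] ^ wt i))"
      unfolding f_def by (rule pderiv_prod)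
    also have "\<dots> = (\<Sum>i<m. q * smult (of_nat (wt i)) (\<Prod>j\<in>{..<m} - {i}. [:- u j, 1:]))"
    proof (intro sum.cong refl)
      fix i assume i: "i \<in> {..<m}"
      have "(\<Prod>j\<in>{..<m} - {i}. [:- u j, 1:] ^ wt j) =
          (\<Prod>j\<in>{..<m} - {i}. [:- u j, 1:] ^ (wt j - 1)) * (\<Prod>j\<in>{..<m} - {i}. [:- u j, 1:])"
        unfolding prod.distrib[symmetric]
        using wt by (intro prod.cong refl) (metis DiffD1 Suc_pred' lessThan_iff power_Suc2 less_eq_Suc_le One_nat_def)
      moreover have "q = [:- u i, 1:] ^ (wt i - 1) * (\<Prod>j\<in>{..<m} - {i}. [:- u j, 1:] ^ (wt j - 1))"
        unfolding q_def using i by (simp add: prod.remove)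
      moreover have "pderiv ([:- u i, 1:] ^ wt i) = smult (of_nat (wt i)) ([:- u i, 1:] ^ (wt i - 1))"
        by (simp add: pderiv_power pderiv_pCons)
      ultimately show "(\<Prod>j\<in>{..<m} - {i}. [:- u j, 1:] ^ wt j) * pderiv ([:- u i, 1:] ^ wt i) =
          q * smult (of_nat (wt i)) (\<Prod>j\<in>{..<m} - {i}. [:- u j, 1:])"
        by (simp add: mult_ac)
    qed
    finally show ?thesis by (simp add: t_def sum_distrib_left)
  qed
  define D where "D = [:0, 1:] * pderiv f - smult (of_nat n) f"
  have D_eq: "D = q * h"
    unfolding D_def pf by (simp add: f_eq h_def algebra_simps)
  have cD: "coeff D l = (of_nat l - of_nat n) * coeff f l" for l
    by (cases l) (auto simp: D_def coeff_pCons coeff_pderiv algebra_simps)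
  have "degree D \<le> n - m"
  proof (rule degree_le, intro allI impI)
    fix l assume l: "n - m < l"
    consider "l = n" | "l > n" | "l < n" by linarith
    then show "coeff D l = 0"
    proof cases
      case 3
      then show ?thesis using zero[of "n - l"] l by (simp add: cD)
    qed (auto simp: cD coeff_eq_0 deg_f)
  qed
  \<comment> \<open>In characteristic 0 the factor \<open>of_nat l - of_nat n\<close> is zero only
    for \<open>l = n\<close>, so \<open>D = 0\<close> would leave f = x^n, which has no nonzero
    root.\<close>
  moreover have "D \<noteq> 0"
  proof
    assume "D = 0"
    then have "coeff f l = 0" if "l < n" for l using cD[of l] that by simp
    then have "f = monom 1 n"
      using monic deg_f by (intro poly_eqI) (metis coeff_eq_0 coeff_monom linorder_neqE_nat)
    moreover obtain i where i: "i < m" "u i \<noteq> 0" using nz by blast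
    moreover have "poly f (u i) = 0"
      unfolding f_def poly_prod using i wt[OF i(1)] by (intro prod_zero) (auto intro!: bexI[of _ i])
    ultimately show False by (simp add: poly_monom)
  qed
  ultimately have h0: "degree h = 0" "h \<noteq> 0"
    using degree_mult_eq[of q h] by (auto simp: D_eq deg_q)
  then obtain c where c: "h = [:c:]" "c \<noteq> 0" by (metis degree_eq_zeroE pCons_0_0)
  have h_val: "poly h x \<noteq> 0" for x using c by simp
  show "u i \<noteq> 0" if "i < m"
  proof
    assume "u i = 0"
    then have "poly s 0 = 0" unfolding s_def poly_prod using that by (intro prod_zero) auto
    then have "poly h 0 = 0" by (simp add: h_def)
    then show False using h_val by blast
  qed
  show "inj_on u {..<m}"
  proof (rule inj_onI, rule ccontr)
    fix a b assume ab: "a \<in> {..<m}" "b \<in> {..<m}" "u a = u b" "a \<noteq> b"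
    have "poly s (u a) = 0" unfolding s_def poly_prod using ab by (intro prod_zero) auto
    moreover have "poly (\<Prod>j\<in>{..<m} - {i}. [:- u j, 1:]) (u a) = 0" for i
    proof -
      obtain c where "c \<in> {..<m} - {i}" "u c = u a" using ab by (cases "i = a") auto
      then show ?thesis unfolding poly_prod by (intro prod_zero) (auto intro!: bexI[of _ c])
    qed
    ultimately have "poly h (u a) = 0" by (simp add: h_def t_def poly_sum)
    then show False using h_val by blast
  qed
qed

subsection \<open>Power series roots near a double root\<close>

text \<open>Evaluation at \<open>c + T\<close> is written as composition of the expansion at
  \<open>c\<close> with \<open>T\<close>, so that \<open>local_root\<close> can solve its equation
  by a compositional inverse.\<close>

lemma fps_of_poly_shift_compose:
  fixes T :: "'r::field fps"
  assumes "fps_nth T 0 = 0"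
  shows "fps_of_poly (pcompose p [:c, 1:]) oo T = poly (map_poly fps_const p) (fps_const c + T)"
proof (induction p)
  case (pCons a p)
  have "fps_of_poly [:c, 1:] oo T = fps_const c + T"
    by (simp add: fps_of_poly_pCons fps_compose_add_distrib assms add.commute)
  then have "fps_of_poly ([:a:] + [:c, 1:] * pcompose p [:c, 1:]) oo T =
      fps_const a + (fps_const c + T) * poly (map_poly fps_const p) (fps_const c + T)"
    unfolding fps_of_poly_add fps_of_poly_mult fps_of_poly_const fps_compose_add_distrib
      fps_compose_mult_distrib[OF assms] pCons.IH by simp
  then show ?case by (simp add: pcompose_pCons map_poly_pCons)
qed simp

text \<open>With y = x - c the equation F + (X^2 / e) W = 0 reads X^2 = y^2 V for V = - e q / W, and
  \<open>e\<close> is chosen to give V the constant term 1. So X = y sqrt(V), and \<open>T\<close>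
  is the compositional inverse of this series. Its linear coefficient 1 will show that the root
  changes under X to -X.\<close>

lemma local_root:
  fixes F q W :: "'r::field_char_0 poly"
  assumes F: "F = [:- c, 1:] ^ 2 * q" and q: "poly q c \<noteq> 0" and W: "poly W c \<noteq> 0"
  defines "e \<equiv> - poly W c / poly q c"
  shows "\<exists>T. fps_nth T 0 = 0 \<and> fps_nth T 1 = 1 \<and>
    poly (map_poly fps_const F) (fps_const c + T) +
      fps_const (1 / e) * fps_X ^ 2 * poly (map_poly fps_const W) (fps_const c + T) = 0"
proof -
  define qf where "qf = fps_of_poly (pcompose q [:c, 1:])"
  define Wf where "Wf = fps_of_poly (pcompose W [:c, 1:])"
  have nz: "fps_nth qf 0 = poly q c" "fps_nth Wf 0 = poly W c"
    by (simp_all add: qf_def Wf_def poly_0_coeff_0[symmetric] poly_pcompose)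
  have e: "e \<noteq> 0" using q W by (simp add: e_def)
  define V where "V = fps_const (- e) * qf * inverse Wf"
  have V0: "fps_nth V 0 = 1" using q W nz by (simp add: V_def e_def)
  define sq where "sq = fps_radical (\<lambda>_ _. 1) 2 V"
  have sq: "sq ^ 2 = V"
    using power_radical[of V "\<lambda>_ _. 1" 1] V0 by (simp add: sq_def numeral_2_eq_2)
  have sq0: "fps_nth sq 0 = 1" by (simp add: sq_def)
  define S where "S = fps_X * sq"
  have S: "fps_nth S 0 = 0" "fps_nth S 1 = 1" using sq0 by (simp_all add: S_def)
  define T where "T = fps_inv S"
  have T0: "fps_nth T 0 = 0" by (simp add: T_def fps_inv_def)
  have T1: "fps_nth T 1 = 1" using S by (simp add: T_def fps_inv_def)
  have ST: "S oo T = fps_X" unfolding T_def by (rule fps_inv_right) (use S in auto)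
  have "fps_X ^ 2 = S ^ 2 oo T" using fps_compose_power[OF T0, of S 2] ST by simp
  also have "S ^ 2 = fps_X ^ 2 * V" by (simp add: S_def power_mult_distrib sq)
  also have "(fps_X ^ 2 * V) oo T = T ^ 2 * (V oo T)"
    using T0 fps_compose_power[OF T0, of fps_X 2] by (simp add: fps_compose_mult_distrib)
  also have "V oo T = fps_const (- e) * (qf oo T) * inverse (Wf oo T)"
    using T0 nz W by (simp add: V_def fps_compose_mult_distrib fps_inverse_compose)
  finally have 1: "fps_X ^ 2 = T ^ 2 * (fps_const (- e) * (qf oo T) * inverse (Wf oo T))" .
  have Wnz: "fps_nth (Wf oo T) 0 \<noteq> 0" using nz W by simp
  have "fps_X ^ 2 * (Wf oo T) = T ^ 2 * (fps_const (- e) * (qf oo T)) * (inverse (Wf oo T) * (Wf oo T))"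
    by (subst 1) (simp only: mult_ac)
  also have "\<dots> = T ^ 2 * (fps_const (- e) * (qf oo T))"
    using Wnz by (simp add: inverse_mult_eq_1)
  finally have 2: "fps_X ^ 2 * (Wf oo T) = fps_const (- e) * (T ^ 2 * (qf oo T))" by (simp only: mult_ac)
  have "fps_const (1 / e) * fps_X ^ 2 * (Wf oo T) = fps_const (1 / e) * fps_const (- e) * (T ^ 2 * (qf oo T))"
    by (simp only: mult.assoc 2)
  also have "fps_const (1 / e) * fps_const (- e) = fps_const (- 1)"
    using e by simp
  finally have 3: "fps_const (1 / e) * fps_X ^ 2 * (Wf oo T) = - (T ^ 2 * (qf oo T))"
    by (simp flip: fps_const_neg)
  have "pcompose F [:c, 1:] = [:0, 1:] ^ 2 * pcompose q [:c, 1:]"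
    unfolding F by (simp add: pcompose_mult pcompose_power_left pcompose_pCons)
  then have "fps_of_poly (pcompose F [:c, 1:]) = fps_X ^ 2 * qf"
    by (simp add: qf_def fps_of_poly_mult fps_of_poly_power)
  then have 4: "poly (map_poly fps_const F) (fps_const c + T) = T ^ 2 * (qf oo T)"
    using T0 fps_compose_power[OF T0, of fps_X 2]
    by (simp add: fps_compose_mult_distrib flip: fps_of_poly_shift_compose)
  show ?thesis
    using T0 T1 3 4 fps_of_poly_shift_compose[OF T0, of W c]
    by (intro exI[of _ T]) (simp add: Wf_def)
qed

lemma poly_map_fls_const:
  fixes x :: "'r::comm_ring_1 fps"
  shows "fps_to_fls (poly (map_poly fps_const p) x) = poly (map_poly fls_const p) (fps_to_fls x)"
  by (induction p) (simp_all add: map_poly_pCons fls_times_fps_to_fls)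

text \<open>Newton interpolation in degree below \<open>r\<close>, after which the node polynomial
  \<open>g\<close> is added: it vanishes at all nodes and makes the result monic. The leading
  coefficient 1 later allows the series variable to be recovered from the coefficients of the
  deformation.\<close>

lemma interpolation_monic:
  fixes c w :: "nat \<Rightarrow> 'r::field"
  assumes "inj_on c {..<r}"
  shows "\<exists>W. degree W = r \<and> lead_coeff W = 1 \<and> (\<forall>i<r. poly W (c i) = w i)"
proof -
  have "\<exists>P. (\<forall>l\<ge>r. coeff P l = 0) \<and> (\<forall>i<r. poly P (c i) = w i)"
    using assms
  proof (induction r)
    case 0
    then show ?case by (intro exI[of _ 0]) auto
  next
    case (Suc r)
    then obtain P where P: "\<forall>l\<ge>r. coeff P l = 0" "\<forall>i<r. poly P (c i) = w i"
      by (auto simp: lessThan_Suc)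
    define g where "g = (\<Prod>j<r. [:- c j, 1:])"
    have deg: "degree g = r" unfolding g_def by (subst degree_prod_eq_sum_degree) auto
    have g0: "poly g (c i) = 0" if "i < r" for i
      unfolding g_def poly_prod using that by (intro prod_zero) auto
    have gr: "poly g (c r) \<noteq> 0"
    proof -
      have "c r \<noteq> c j" if "j < r" for j
        using Suc.prems that by (metis inj_on_eq_iff lessThan_iff less_Suc_eq less_irrefl)
      then show ?thesis by (auto simp: g_def poly_prod)
    qed
    define s where "s = (w r - poly P (c r)) / poly g (c r)"
    show ?case
      using P g0 gr deg
      by (intro exI[of _ "P + smult s g"]) (auto simp: s_def less_Suc_eq coeff_eq_0)
  qed
  then obtain P where P: "\<forall>l\<ge>r. coeff P l = 0" "\<forall>i<r. poly P (c i) = w i" by blast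
  define g where "g = (\<Prod>j<r. [:- c j, 1:])"
  have deg: "degree g = r" unfolding g_def by (subst degree_prod_eq_sum_degree) auto
  have lc: "coeff g r = 1"
    using lead_coeff_prod[of "\<lambda>j. [:- c j, 1:]" "{..<r}"] deg by (simp add: g_def)
  have g0: "poly g (c i) = 0" if "i < r" for i
    unfolding g_def poly_prod using that by (intro prod_zero) auto
  have cW: "coeff (P + g) r = 1" using P(1) lc by simp
  have "degree (P + g) \<le> r" using P(1) deg by (intro degree_le) (auto simp: coeff_eq_0)
  moreover have "r \<le> degree (P + g)" using cW by (intro le_degree) auto
  ultimately have "degree (P + g) = r" by simp
  then show ?thesis using cW P(2) g0 by (intro exI[of _ "P + g"]) auto
qed

subsection \<open>Substitutions in Laurent series\<close>

text \<open>The substitution t = s^2 / e, which embeds the Laurent series in t into those in s =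
  sqrt(e t).\<close>

definition fls_square_subst :: "'r::field \<Rightarrow> 'r fls \<Rightarrow> 'r fls" where
  "fls_square_subst e g = fls_compose_power (fls_compose_fps g (fps_const (1 / e) * fps_X)) 2"

text \<open>The conjugation s to -s of the quadratic extension given by
  \<open>fls_square_subst\<close>.\<close>

definition fls_reflect :: "'r::field fls \<Rightarrow> 'r fls" where
  "fls_reflect g = fls_compose_fps g (fps_const (- 1) * fps_X)"

context
  fixes e :: "'r::field"
  assumes e: "e \<noteq> 0"
begin

lemma fls_scale_nz: "fps_const (1 / e) * fps_X \<noteq> 0" "fps_nth (fps_const (1 / e) * fps_X) 0 = 0"
  using e by auto

lemma hom_fls_square_subst: "hom_on UNIV (fls_square_subst e)"
  unfolding hom_on_def fls_square_subst_def
  using fls_compose_fps_add[OF fls_scale_nz] fls_compose_fps_mult[OF fls_scale_nz]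
  by (simp add: fls_compose_power_add fls_compose_power_mult)

lemma fls_square_subst_const: "fls_square_subst e (fls_const c) = fls_const c"
  by (simp add: fls_square_subst_def)

lemma fls_square_subst_nth:
  "fls_nth (fls_square_subst e g) n =
    (if even n then fls_nth g (n div 2) * (1 / e) powi (n div 2) else 0)"
  using e by (simp add: fls_square_subst_def fls_nth_compose_power fls_nth_fls_compose_fps_linear)

lemma fls_square_subst_X: "fls_square_subst e fls_X = fls_const (1 / e) * fps_to_fls (fps_X ^ 2)"
proof (rule fls_eqI)
  fix n
  show "fls_nth (fls_square_subst e fls_X) n = fls_nth (fls_const (1 / e) * fps_to_fls (fps_X ^ 2)) n"
    by (cases "n = 2") (auto simp: fls_square_subst_nth)
qed

text \<open>A series with only even exponents is a series in s^2 = e t, whence the powers of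
  \<open>e\<close> in its coefficients with respect to t.\<close>

lemma fls_square_subst_surj:
  assumes "\<And>n. odd n \<Longrightarrow> fls_nth D n = 0"
  obtains D' where "fls_square_subst e D' = D" "\<And>l. fls_nth D' l = fls_nth D (2 * l) * e powi l"
proof -
  define D' where "D' = Abs_fls (\<lambda>l. fls_nth D (2 * l) * e powi l)"
  have D': "fls_nth D' l = fls_nth D (2 * l) * e powi l" for l
    unfolding D'_def
    \<comment> \<open>Below 0 one has \<open>2 * l < l\<close>, so the coefficient of
      \<open>D\<close> at \<open>2 * l\<close> vanishes once \<open>l\<close> is also below the
      order of \<open>D\<close>.\<close>
    by (rule nth_Abs_fls_lower_bound[of "min 0 (fls_subdegree D)"]) auto
  have "fls_square_subst e D' = D"
  proof (rule fls_eqI)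
    fix n
    show "fls_nth (fls_square_subst e D') n = fls_nth D n"
      using assms[of n] e by (auto simp: fls_square_subst_nth D' power_int_divide_distrib)
  qed
  with D' show ?thesis using that by blast
qed

end

lemma hom_fls_reflect: "hom_on UNIV (fls_reflect :: 'r::field fls \<Rightarrow> _)"
proof -
  have *: "fps_const (- 1 :: 'r) * fps_X \<noteq> 0" "fps_nth (fps_const (- 1 :: 'r) * fps_X) 0 = 0"
    by (auto simp: fps_eq_iff dest!: spec[of _ 1])
  show ?thesis
    unfolding hom_on_def fls_reflect_def
    using fls_compose_fps_add[OF *] fls_compose_fps_mult[OF *] by simp
qed

lemma fls_reflect_nth: "fls_nth (fls_reflect g) n = fls_nth g n * (- 1) powi n"
  by (simp add: fls_reflect_def fls_nth_fls_compose_fps_linear del: fps_const_neg)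

lemma fls_reflect_square_subst: "e \<noteq> 0 \<Longrightarrow> fls_reflect (fls_square_subst e g) = fls_square_subst e g"
  by (rule fls_eqI) (auto simp: fls_reflect_nth fls_square_subst_nth)

text \<open>The odd order of \<open>D\<close> leaves an odd power of \<open>e\<close> in its leading coefficient; this is
  the parity that makes the weights of the various \<open>D\<close> independent.\<close>

lemma square_descent:
  fixes g :: "'r::field_char_0 fls"
  assumes e: "e \<noteq> 0" and g: "fls_reflect g \<noteq> g"
  obtains D c where "fls_square_subst e D = (g - fls_reflect g) ^ 2" "D \<noteq> 0"
    "odd (fls_subdegree D)" "c \<noteq> 0"
    "fls_nth D (fls_subdegree D) = c ^ 2 * e powi fls_subdegree D"
proof -
  define d where "d = g - fls_reflect g"
  have d0: "d \<noteq> 0" using g by (simp add: d_def)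
  \<comment> \<open>\<open>d\<close> changes sign under the reflection, so it has only odd exponents
    and odd order \<open>s\<close>. Its square is invariant and descends; the order
    \<open>2 * s\<close> of the square becomes the order \<open>s\<close> of
    \<open>D\<close>.\<close>
  have d_even: "fls_nth d n = 0" if "even n" for n
    using that by (simp add: d_def fls_reflect_nth)
  define s where "s = fls_subdegree d"
  have ds: "fls_nth d s \<noteq> 0" using d0 by (simp add: s_def)
  then have s_odd: "odd s" using d_even by blast
  have refl_d: "fls_reflect d = - d"
    by (rule fls_eqI) (metis d_even fls_reflect_nth fls_uminus_nth mult_minus1_right mult_zero_left
        neg_equal_0_iff_equal power_int_minus_one_minus power_int_minus_left_odd power_int_1_left)
  have "fls_reflect (d ^ 2) = d ^ 2"
    using hom_power[OF subfield_UNIV hom_fls_reflect, of d 2] refl_d by simp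
  then have refl2: "fls_nth (d ^ 2) n * (- 1) powi n = fls_nth (d ^ 2) n" for n
    using fls_reflect_nth[of "d ^ 2" n] by simp
  have "fls_nth (d ^ 2) n = 0" if "odd n" for n
  proof -
    have "- fls_nth (d ^ 2) n = fls_nth (d ^ 2) n" using refl2[of n] that by simp
    then have "2 * fls_nth (d ^ 2) n = 0" by (metis add.left_inverse mult_2)
    then show ?thesis by simp
  qed
  then obtain D where D: "fls_square_subst e D = d ^ 2"
    "\<And>l. fls_nth D l = fls_nth (d ^ 2) (2 * l) * e powi l"
    using fls_square_subst_surj[OF e, of "d ^ 2"] by metis
  have sub: "fls_subdegree (d ^ 2) = 2 * s" "fls_nth (d ^ 2) (2 * s) = fls_nth d s ^ 2"
    using d0 fls_times_base[of d d] by (simp_all add: s_def power2_eq_square)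
  have Ds: "fls_nth D s = fls_nth d s ^ 2 * e powi s" using D(2) sub by simp
  then have Ds0: "fls_nth D s \<noteq> 0" using ds e by simp
  moreover have "fls_nth D l = 0" if "l < s" for l
    using that D(2)[of l] sub(1) by simp
  ultimately have "fls_subdegree D = s" by (intro fls_subdegree_eqI) auto
  moreover have "D \<noteq> 0" using Ds0 by auto
  ultimately show ?thesis using that[of D "fls_nth d s"] D(1) Ds ds s_odd by (simp add: d_def)
qed

lemma rat_exp_powi:
  fixes x :: "'o::idom ratfun"
  assumes x: "x \<noteq> 0"
  shows "Poly_Mapping.lookup (rat_exp (x powi s)) l = s * Poly_Mapping.lookup (rat_exp x) l"
proof -
  have inv: "rat_exp (inverse x) = - rat_exp x"
    using rat_exp_mult[of x "inverse x"] x rat_exp_1[where 'o = 'o] by (simp add: eq_neg_iff_add_eq_0 add.commute)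
  have pow: "Poly_Mapping.lookup (rat_exp (y ^ n)) l = int n * Poly_Mapping.lookup (rat_exp y) l"
    if "y \<noteq> 0" for y :: "'o ratfun" and n
    using that by (induction n) (auto simp: rat_exp_1 rat_exp_mult lookup_add algebra_simps)
  show ?thesis
    using pow[OF x, of "nat s"] pow[of "inverse x" "nat (- s)"] x
    by (auto simp: power_int_def inv lookup_uminus)
qed

subsection \<open>Deformation of the special polynomial\<close>

definition lacunary_root :: "nat \<Rightarrow> nat \<Rightarrow> (nat \<Rightarrow> 'a::comm_ring_1) \<Rightarrow> 'a \<Rightarrow> bool" where
  "lacunary_root m n a x \<longleftrightarrow> x ^ n + (\<Sum>j=m..n. a j * x ^ (n - j)) = 0"

lemma lacunary_coeff:
  assumes "0 < m" "J \<subseteq> {m..n}"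
  shows "coeff (monom 1 n + (\<Sum>j\<in>J. monom (b j) (n - j))) n = 1"
proof -
  have "n - j \<noteq> n" if "j \<in> J" for j
    using assms(1) subsetD[OF assms(2) that] by auto
  then have "coeff (\<Sum>j\<in>J. monom (b j) (n - j)) n = 0"
    unfolding coeff_sum by (intro sum.neutral) auto
  then show ?thesis by simp
qed

lemma lacunary_root_last:
  assumes "m \<le> n"
  shows "lacunary_root m n a x \<longleftrightarrow> a n = - (x ^ n + (\<Sum>j=m..<n. a j * x ^ (n - j)))"
proof -
  have "{m..n} = insert n {m..<n}" using assms by auto
  then have "(\<Sum>j=m..n. a j * x ^ (n - j)) = a n + (\<Sum>j=m..<n. a j * x ^ (n - j))" by simp
  then show ?thesis by (auto simp: lacunary_root_def eq_neg_iff_add_eq_0 algebra_simps)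
qed

lemma lacunary_root_last_in:
  assumes "m \<le> n" "lacunary_root m n a x" "is_subring R" "x \<in> R" "\<And>j. m \<le> j \<Longrightarrow> j < n \<Longrightarrow> a j \<in> R"
  shows "a n \<in> R"
proof -
  have "- (x ^ n + (\<Sum>j=m..<n. a j * x ^ (n - j))) \<in> R"
    by (intro subring_uminus[OF assms(3)] subring_add[OF assms(3)] subring_sum[OF assms(3)]
      subring_mult[OF assms(3)] subring_power[OF assms(3)] assms(4,5)) auto
  then show ?thesis using assms(2) unfolding lacunary_root_last[OF assms(1)] by (simp only:)
qed

text \<open>The equation expresses \<open>a n\<close> polynomially through \<open>x\<close> and the
  other coefficients, so the root can replace \<open>a n\<close> as a variable. With
  \<open>field_gen_root_exchange\<close> this makes E purely transcendental over k, and embeddings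
  of E can be prescribed freely on a basis.\<close>

lemma alg_indep_root_exchange:
  assumes "is_subring k" "alg_indep k {m..n} a" "m \<le> n" "lacunary_root m n a x"
  shows "alg_indep k {m..n} (a(n := x))"
proof (rule alg_indep_change_basis[OF _ assms(1,2)])
  let ?y = "a(n := x)"
  have gen: "?y j \<in> field_gen k (?y ` {m..n})" if "j \<in> {m..n}" for j
    using that by (intro field_gen_gen) blast
  have "a n \<in> field_gen k (?y ` {m..n})"
  proof (rule lacunary_root_last_in[OF assms(3,4) subring_field_gen])
    show "x \<in> field_gen k (?y ` {m..n})" using gen[of n] assms(3) by simp
    show "a j \<in> field_gen k (?y ` {m..n})" if "m \<le> j" "j < n" for j using gen[of j] that by simp
  qed
  then have "a j \<in> field_gen k (?y ` {m..n})" if "j \<in> {m..n}" for j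
    using gen[OF that] by (cases "j = n") (simp_all del: fun_upd_image)
  then have "a ` {m..n} \<subseteq> field_gen k (?y ` {m..n})" by (rule image_subsetI)
  then show "a ` {m..n} \<subseteq> alg_cl k (?y ` {m..n})" using field_gen_subset_alg_cl by blast
qed simp

lemma field_gen_root_exchange:
  assumes "m \<le> n" "lacunary_root m n a x"
  shows "field_gen (field_gen k (a ` {m..n})) {x} = field_gen k ((a(n := x)) ` {m..n})"
  unfolding field_gen_field_gen
proof
  let ?y = "a(n := x)"
  have gen: "?y j \<in> field_gen k (?y ` {m..n})" if "j \<in> {m..n}" for j
    using that by (intro field_gen_gen) blast
  have x: "x \<in> field_gen k (?y ` {m..n})" using gen[of n] assms(1) by simp
  have "a n \<in> field_gen k (?y ` {m..n})"
    by (rule lacunary_root_last_in[OF assms subring_field_gen x]) (use gen in force)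
  then have "a j \<in> field_gen k (?y ` {m..n})" if "j \<in> {m..n}" for j
    using gen[OF that] by (cases "j = n") (simp_all del: fun_upd_image)
  then have "a ` {m..n} \<subseteq> field_gen k (?y ` {m..n})" by (rule image_subsetI)
  then show "field_gen k (a ` {m..n} \<union> {x}) \<subseteq> field_gen k (?y ` {m..n})"
    using x field_gen_base by (intro field_gen_least subfield_field_gen) auto
  show "field_gen k (?y ` {m..n}) \<subseteq> field_gen k (a ` {m..n} \<union> {x})"
    by (intro field_gen_mono) auto
qed

lemma sum_double_weights:
  fixes m r :: nat
  assumes "r \<le> m"
  shows "(\<Sum>i<m. if i < r then 2 else 1) = m + r"
proof -
  have "(\<Sum>i<m. if i < r then 2 else 1) = (\<Sum>i<m. 1 + (if i < r then 1 else 0 :: nat))"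
    by (intro sum.cong) auto
  also have "\<dots> = m + card ({..<m} \<inter> {i. i < r})"
    by (simp only: sum.distrib) (simp add: sum.If_cases)
  also have "{..<m} \<inter> {i. i < r} = {..<r}" using assms by auto
  finally show ?thesis by simp
qed

text \<open>Here \<open>f0\<close> has the \<open>n - m\<close> double roots \<open>u i\<close>, the \<open>A j\<close> are the coefficients of \<open>f0 + t W\<close> for a
  generic \<open>W\<close> of degree \<open>n - m\<close>, and the substitution \<open>t = s\<^sup>2 / e i\<close> makes a root \<open>\<theta> i\<close> near \<open>u i\<close>
  a power series in \<open>s\<close>; the conjugate root is obtained from \<open>s \<mapsto> -s\<close>.\<close>

lemma deformation_exists:
  fixes u :: "nat \<Rightarrow> 'o::field_char_0" and m n :: nat
  assumes mn: "0 < m" "n \<le> 2 * m" "m < n"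
  defines "r \<equiv> n - m"
  defines "wt \<equiv> \<lambda>i. if i < r then 2 else (1::nat)"
  defines "f0 \<equiv> (\<Prod>i<m. [:- u i, 1:] ^ wt i)"
  assumes zero: "\<And>j. 1 \<le> j \<Longrightarrow> j < m \<Longrightarrow> coeff f0 (n - j) = 0" and nz: "\<exists>i<m. u i \<noteq> 0"
  shows "\<exists>(A :: nat \<Rightarrow> 'o ratfun fls) e \<theta>.
    alg_indep (range (\<lambda>c. fls_const (rat_const c))) {m..n} A \<and>
    (\<forall>i<r. e i \<noteq> 0 \<and> rat_exp (e i) = Poly_Mapping.single i 1 \<and> fls_reflect (\<theta> i) \<noteq> \<theta> i \<and>
       lacunary_root m n (\<lambda>j. fls_square_subst (e i) (A j)) (\<theta> i))"
proof -
  let ?c = "rat_const :: 'o \<Rightarrow> 'o ratfun"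
  let ?C = "\<lambda>c. fls_const (?c c)"
  note hc = hom_on_rat_const[where 'o = 'o]
  have wt1: "wt i \<ge> 1" for i by (simp add: wt_def)
  have rm: "r \<le> m" using mn by (simp add: r_def)
  have sum_wt: "(\<Sum>i<m. wt i) = n"
    using sum_double_weights[OF rm] mn by (simp add: wt_def r_def)
  have inj: "inj_on u {..<m}"
    using weighted_roots_distinct(1)[of m wt u] wt1 zero nz unfolding f0_def sum_wt by blast
  have deg_f0: "degree f0 = n" unfolding f0_def
    by (subst degree_prod_eq_sum_degree) (auto simp: degree_power_eq sum_wt)
  have lc_f0: "coeff f0 n = 1"
    using lead_coeff_prod[of "\<lambda>i. [:- u i, 1:] ^ wt i" "{..<m}"] deg_f0
    by (simp add: f0_def lead_coeff_power)
  define q where "q i = (\<Prod>j\<in>{..<m} - {i}. [:- u j, 1:] ^ wt j)" for i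
  have f0_q: "f0 = [:- u i, 1:] ^ 2 * q i" if "i < r" for i
    using that rm unfolding f0_def q_def by (subst prod.remove[of _ i]) (auto simp: wt_def)
  have q_nz: "poly (q i) (u i) \<noteq> 0" if "i < r" for i
  proof -
    have "u i \<noteq> u j" if "j \<in> {..<m} - {i}" for j
      using inj that \<open>i < r\<close> rm by (auto simp: inj_on_def)
    then show ?thesis by (auto simp: q_def poly_prod)
  qed
  have cc: "inj_on (\<lambda>i. ?c (u i)) {..<r}"
    using inj rm hom_eq_iff[OF subfield_UNIV hc] by (auto simp: inj_on_def)
  obtain W where W: "degree W = r" "lead_coeff W = 1" "\<And>i. i < r \<Longrightarrow> poly W (?c (u i)) = rat_var i"
    using interpolation_monic[OF cc, of rat_var] by auto
  define F where "F = map_poly ?c f0"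
  have F_coeff: "coeff F l = ?c (coeff f0 l)" for l by (simp add: F_def coeff_map_poly rat_const_0)
  define A where "A j = fls_const (coeff F (n - j)) + fls_X * fls_const (coeff W (n - j))" for j
  \<comment> \<open>\<open>t\<close> and \<open>x\<close> are arbitrary because the identity serves
    twice: with \<open>t = fls_X\<close> at the constants belonging to \<open>u i\<close>, and with
    t = s^2 / e_i at the series root. The degrees strictly between \<open>r\<close> and
    \<open>n\<close> drop out by \<open>zero\<close>.\<close>
  have key: "x ^ n + (\<Sum>j=m..n. (fls_const (coeff F (n - j)) + t * fls_const (coeff W (n - j))) * x ^ (n - j)) =
      poly (map_poly fls_const F) x + t * poly (map_poly fls_const W) x" for t x :: "'o ratfun fls"
  proof -
    have reidx: "(\<Sum>j=m..n. g (n - j)) = (\<Sum>l\<le>r. g l)" for g :: "nat \<Rightarrow> 'o ratfun fls"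
      by (rule sum.reindex_bij_witness[where i = "\<lambda>l. n - l" and j = "\<lambda>j. n - j"]) (use mn in \<open>auto simp: r_def\<close>)
    have "poly (map_poly fls_const W) x = (\<Sum>l\<le>r. fls_const (coeff W l) * x ^ l)"
      using W(1) by (subst poly_altdef_le[of _ r]) (auto simp: degree_map_poly coeff_map_poly)
    moreover have "poly (map_poly fls_const F) x = x ^ n + (\<Sum>l\<le>r. fls_const (coeff F l) * x ^ l)"
    proof -
      have "degree (map_poly fls_const F) \<le> n"
        by (intro degree_le) (simp add: coeff_map_poly F_coeff coeff_eq_0 deg_f0 rat_const_0)
      then have "poly (map_poly fls_const F) x = (\<Sum>l\<le>n. fls_const (coeff F l) * x ^ l)"
        by (subst poly_altdef_le[of _ n]) (auto simp: coeff_map_poly)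
      also have "{..n} = insert n ({..r} \<union> {r<..<n})" using mn by (auto simp: r_def)
      also have "(\<Sum>l\<in>\<dots>. fls_const (coeff F l) * x ^ l) =
          x ^ n + ((\<Sum>l\<le>r. fls_const (coeff F l) * x ^ l) + (\<Sum>l\<in>{r<..<n}. fls_const (coeff F l) * x ^ l))"
        using mn by (subst sum.insert) (auto simp: r_def F_coeff lc_f0 rat_const_1 intro!: sum.union_disjoint)
      also have "(\<Sum>l\<in>{r<..<n}. fls_const (coeff F l) * x ^ l) = 0"
      proof (intro sum.neutral ballI)
        fix l assume "l \<in> {r<..<n}"
        then have "coeff f0 l = 0" using zero[of "n - l"] by (auto simp: r_def)
        then show "fls_const (coeff F l) * x ^ l = 0" by (simp add: F_coeff rat_const_0)
      qed
      finally show ?thesis by simp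
    qed
    ultimately show ?thesis
      using reidx[of "\<lambda>l. (fls_const (coeff F l) + t * fls_const (coeff W l)) * x ^ l"]
      by (simp add: distrib_right sum.distrib sum_distrib_left mult.assoc)
  qed
  define C0 where "C0 = range ?C"
  have hC: "hom_on UNIV ?C"
    by (simp add: hom_on_def rat_const_1 rat_const_add rat_const_mult fls_plus_const fls_const_mult_const)
  have C0: "is_subfield C0" unfolding C0_def by (rule subfield_hom_image[OF subfield_UNIV hC])
  \<comment> \<open>The reference family of r + 1 independent elements: t itself at index
    \<open>m\<close>, and at \<open>j = m + 1, ..., n\<close> the variables numbered
    \<open>r - 1, ..., 0\<close>.\<close>
  define y where "y j = (if j = m then fls_X else fls_const (rat_var (n - j) :: 'o ratfun))" for j
  have y_indep: "alg_indep C0 {m..n} y"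
    unfolding C0_def
  proof (rule alg_indep_lau_weight[where \<sigma> = "\<lambda>j. if j = m then 0 else Suc (n - j)"])
    show "y i \<noteq> 0" for i by (simp add: y_def rat_var_nonzero)
    show "odd (lau_weight (y i) (if j = m then 0 else Suc (n - j))) \<longleftrightarrow> i = j"
      if "i \<in> {m..n}" "j \<in> {m..n}" for i j
      using that by (auto simp: y_def lau_weight_def rat_var_nonzero rat_exp_var rat_exp_1 lookup_single when_def split: if_splits)
  qed simp
  \<comment> \<open>By counting it is enough to recover \<open>y\<close> from \<open>A\<close>.
    Since \<open>W\<close> is monic, t can be read off the coefficient of degree \<open>r\<close>;
    the value of f0 + t W at the root \<open>u i\<close> of f0 is t times the variable
    \<open>i\<close>.\<close>
  have A_indep: "alg_indep C0 {m..n} A"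
  proof (rule alg_indep_change_basis[OF _ subfield_subring[OF C0] y_indep])
    let ?L = "field_gen C0 (A ` {m..n})"
    note sL = subring_field_gen[of C0 "A ` {m..n}"]
    have AL: "A j \<in> ?L" if "j \<in> {m..n}" for j using that by (intro field_gen_gen) blast
    have CL: "?C c \<in> ?L" for c by (intro field_gen_base) (auto simp: C0_def)
    have Xeq: "fls_X = A m - ?C (coeff f0 r)"
      using W by (simp add: A_def F_coeff r_def)
    have XL: "fls_X \<in> ?L"
      by (subst Xeq, intro subring_diff[OF sL] AL CL) (use mn in auto)
    have "fls_const (rat_var i) \<in> ?L" if i: "i < r" for i
    proof -
      let ?x = "?C (u i)"
      have ev: "poly (map_poly fls_const p) (fls_const z) = fls_const (poly p z)" for p and z :: "'o ratfun"
        by (induction p) (simp_all add: map_poly_pCons flip: fls_plus_const fls_const_mult_const)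
      have "poly f0 (u i) = 0" using f0_q[OF i] by simp
      then have "poly F (?c (u i)) = 0"
        using hom_poly[OF subfield_UNIV hc, of f0 "u i"] by (simp add: F_def poly_over_def rat_const_0)
      then have "?x ^ n + (\<Sum>j=m..n. A j * ?x ^ (n - j)) = fls_X * fls_const (rat_var i)"
        unfolding A_def key ev W(3)[OF i] by simp
      moreover have "?x ^ n + (\<Sum>j=m..n. A j * ?x ^ (n - j)) \<in> ?L"
        by (intro subring_add[OF sL] subring_sum[OF sL] subring_mult[OF sL] subring_power[OF sL] AL CL)
      ultimately have "fls_X * fls_const (rat_var i) / fls_X \<in> ?L"
        using XL by (intro subfield_divide[OF subfield_field_gen]) auto
      then show ?thesis by (subst (asm) nonzero_mult_div_cancel_left) simp_all
    qed
    then have "y ` {m..n} \<subseteq> ?L" using XL mn by (auto simp: y_def r_def)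
    then show "y ` {m..n} \<subseteq> alg_cl C0 (A ` {m..n})" using field_gen_subset_alg_cl by blast
  qed simp
  \<comment> \<open>The constant prescribed by \<open>local_root\<close>; since \<open>W\<close>
    takes the value \<open>rat_var i\<close> at \<open>u i\<close>, it is a constant multiple of
    that variable.\<close>
  define e where "e i = - rat_var i / ?c (poly (q i) (u i))" for i
  have e: "e i \<noteq> 0" "rat_exp (e i) = Poly_Mapping.single i 1" if "i < r" for i
  proof -
    let ?d = "?c (- inverse (poly (q i) (u i)))"
    have ei: "e i = rat_var i * ?d"
      using hom_uminus[OF subfield_UNIV hc] hom_inverse[OF subfield_UNIV hc]
      by (simp add: e_def divide_inverse)
    have "- inverse (poly (q i) (u i)) \<noteq> 0" using q_nz[OF that] by simp
    then have d: "?d \<noteq> 0" "rat_exp ?d = 0"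
      by (rule hom_nonzero[OF subfield_UNIV hc UNIV_I], rule rat_exp_const)
    show "e i \<noteq> 0" using d by (simp add: ei rat_var_nonzero)
    show "rat_exp (e i) = Poly_Mapping.single i 1"
      unfolding ei using d by (subst rat_exp_mult) (auto simp: rat_var_nonzero rat_exp_var)
  qed
  have "\<exists>\<theta>. fls_reflect \<theta> \<noteq> \<theta> \<and> lacunary_root m n (\<lambda>j. fls_square_subst (e i) (A j)) \<theta>" if i: "i < r" for i
  proof -
    have qc: "poly (map_poly ?c (q i)) (?c (u i)) = ?c (poly (q i) (u i))"
      using hom_poly[OF subfield_UNIV hc, of "q i" "u i"] by (simp add: poly_over_def)
    have qc_nz: "?c (poly (q i) (u i)) \<noteq> 0" using q_nz[OF i] hom_nonzero[OF subfield_UNIV hc] by auto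
    have F_q: "F = [:- ?c (u i), 1:] ^ 2 * map_poly ?c (q i)"
    proof -
      have mult: "map_poly ?c (p * s) = map_poly ?c p * map_poly ?c s" for p s
        by (intro poly_eqI) (simp add: coeff_map_poly rat_const_0 coeff_mult rat_const_mult
            hom_sum[OF subfield_UNIV hc])
      have "map_poly ?c [:- u i, 1:] = [:- ?c (u i), 1:]"
        using hom_uminus[OF subfield_UNIV hc] by (simp add: map_poly_pCons rat_const_0 rat_const_1)
      then show ?thesis unfolding F_def f0_q[OF i] power2_eq_square mult by simp
    qed
    obtain T where T: "fps_nth T 0 = 0" "fps_nth T 1 = 1"
      "poly (map_poly fps_const F) (fps_const (?c (u i)) + T) +
        fps_const (1 / e i) * fps_X ^ 2 * poly (map_poly fps_const W) (fps_const (?c (u i)) + T) = 0"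
      using local_root[OF F_q, of W] qc qc_nz W(3)[OF i] rat_var_nonzero by (auto simp: e_def)
    define \<theta> where "\<theta> = fps_to_fls (fps_const (?c (u i)) + T)"
    have "fls_nth \<theta> 1 = 1" using T(2) by (simp add: \<theta>_def)
    then have "fls_nth (fls_reflect \<theta>) 1 \<noteq> fls_nth \<theta> 1" by (simp add: fls_reflect_nth)
    then have "fls_reflect \<theta> \<noteq> \<theta>" by metis
    moreover have "lacunary_root m n (\<lambda>j. fls_square_subst (e i) (A j)) \<theta>"
    proof -
      note hs = hom_fls_square_subst[OF e(1)[OF i]]
      have sA: "fls_square_subst (e i) (A j) = fls_const (coeff F (n - j)) +
          fls_const (1 / e i) * fps_to_fls (fps_X ^ 2) * fls_const (coeff W (n - j))" for j
        unfolding A_def hom_add[OF subfield_UNIV hs UNIV_I UNIV_I] hom_mult[OF subfield_UNIV hs UNIV_I UNIV_I]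
          fls_square_subst_const[OF e(1)[OF i]] fls_square_subst_X[OF e(1)[OF i]] ..
      have "poly (map_poly fls_const F) \<theta> +
          fls_const (1 / e i) * fps_to_fls (fps_X ^ 2) * poly (map_poly fls_const W) \<theta> = fps_to_fls 0"
        unfolding T(3)[symmetric] \<theta>_def
        by (simp add: poly_map_fls_const fls_times_fps_to_fls)
      then show ?thesis unfolding lacunary_root_def sA key by simp
    qed
    ultimately show ?thesis by blast
  qed
  then obtain \<theta> where "\<And>i. i < r \<Longrightarrow> fls_reflect (\<theta> i) \<noteq> \<theta> i \<and>
      lacunary_root m n (\<lambda>j. fls_square_subst (e i) (A j)) (\<theta> i)" by metis
  then show ?thesis
    using A_indep e unfolding C0_def by (intro exI[of _ A] exI[of _ e] exI[of _ \<theta>]) auto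
qed

subsection \<open>The lower bound\<close>

lemma alg_indep_bounded:
  assumes "is_subring k" "finite T" "A \<subseteq> alg_cl k T" "S \<subseteq> A" "finite S" "alg_indep k S id"
  shows "card S \<le> card T"
  using subset_trans[OF assms(4,3)] by (intro alg_indep_card_le[OF assms(5,1,6,2)]) simp

text \<open>\<open>GREATEST\<close> can be compared with its candidates only if these are bounded;
  the finite \<open>T\<close> provides the bound.\<close>

lemma le_trdeg:
  assumes "is_subring k" "finite T" "A \<subseteq> alg_cl k T" "S \<subseteq> A" "finite S" "alg_indep k S id"
  shows "card S \<le> trdeg k A"
  unfolding trdeg_def
proof (rule Greatest_le_nat[where b = "card T"])
  show "\<exists>U. U \<subseteq> A \<and> finite U \<and> card U = card S \<and> alg_indep k U id"
    using assms(4-6) by (intro exI[of _ S] conjI refl)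
  show "d \<le> card T" if "\<exists>U. U \<subseteq> A \<and> finite U \<and> card U = d \<and> alg_indep k U id" for d
    using that alg_indep_bounded[OF assms(1-3)] by blast
qed

lemma trdeg_le:
  assumes "is_subring k" "finite T" "A \<subseteq> alg_cl k T"
  shows "trdeg k A \<le> card T"
proof -
  let ?P = "\<lambda>d. \<exists>S. S \<subseteq> A \<and> finite S \<and> card S = d \<and> alg_indep k S id"
  have "?P 0" using alg_indep_empty by (intro exI[of _ "{}"]) auto
  moreover have "\<And>d. ?P d \<Longrightarrow> d \<le> card T" using alg_indep_bounded[OF assms] by blast
  ultimately have "?P (trdeg k A)" unfolding trdeg_def by (rule GreatestI_nat)
  then obtain S where "S \<subseteq> A" "finite S" "card S = trdeg k A" "alg_indep k S id" by auto
  then show ?thesis using alg_indep_bounded[OF assms, of S] by simp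
qed

section \<open>Existence and uniqueness of minimal polynomials\<close>

lemma is_min_poly_unique:
  assumes F: "is_subring F" and "is_min_poly F z p" "is_min_poly F z q"
  shows "p = q"
proof (rule ccontr)
  assume ne: "p \<noteq> q"
  have p: "lead_coeff p = 1" "poly_over F p" "poly p z = 0"
    and q: "lead_coeff q = 1" "poly_over F q" "poly q z = 0"
    using assms by (auto simp: is_min_poly_def poly_over_coeffs[OF F])
  have nz: "p \<noteq> 0" "q \<noteq> 0" using p(1) q(1) by auto
  have deg: "degree p = degree q"
    using assms nz unfolding is_min_poly_def by (meson order.antisym)
  have "degree p \<le> degree (p - q)"
    using assms(2) ne poly_over_diff[OF F p(2) q(2)] p(3) q(3)
    unfolding is_min_poly_def poly_over_coeffs[OF F] by auto
  moreover have "degree (p - q) \<le> degree p" using deg by (intro degree_diff_le) auto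
  moreover have "coeff (p - q) (degree p) = 0" using p(1) q(1) deg by simp
  ultimately have "lead_coeff (p - q) = 0" by (metis order.antisym)
  then show False using ne by (metis eq_iff_diff_eq_0 leading_coeff_0_iff)
qed

lemma min_poly_eqI:
  assumes "is_subring F" "is_min_poly F z p"
  shows "min_poly F z = p"
  unfolding min_poly_def
proof (rule the_equality)
  show "q = p" if "is_min_poly F z q" for q
    by (rule is_min_poly_unique[OF assms(1) that assms(2)])
qed (rule assms(2))

lemma is_min_poly_min_poly:
  assumes F: "is_subfield F" and z: "alg_over F z"
  shows "is_min_poly F z (min_poly F z)"
proof -
  note sF = subfield_subring[OF F]
  let ?P = "\<lambda>p. p \<noteq> 0 \<and> poly_over F p \<and> poly p z = 0"
  obtain p where p: "?P p" "\<And>q. ?P q \<Longrightarrow> degree p \<le> degree q"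
    using z ex_has_least_nat[of ?P _ degree] unfolding alg_over_def by metis
  let ?p = "smult (inverse (lead_coeff p)) p"
  have "inverse (lead_coeff p) \<in> F"
    using p(1) subfield_inverse[OF F] by (auto simp: poly_over_def)
  then have "poly_over F ?p" using p(1) by (intro poly_over_smult[OF sF]) auto
  then have "is_min_poly F z ?p"
    using p unfolding is_min_poly_def poly_over_coeffs[OF sF, symmetric] by auto
  then show ?thesis using min_poly_eqI[OF sF] by metis
qed

theorem trdeg_min_poly_ge:
  fixes k :: "'K::field_char_0 set" and a :: "nat \<Rightarrow> 'K" and \<theta> z :: 'K
  assumes k: "is_subfield k" and mn: "0 < m" "n \<le> 2 * m" "m < n"
    and a: "alg_indep k {m..n} a" and root: "lacunary_root m n a \<theta>"
  defines "F \<equiv> field_gen k (a ` {m..n})"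
  defines "E \<equiv> field_gen F {\<theta>}"
  assumes z: "z \<in> E" "field_gen F {z} = E"
  shows "n - m \<le> trdeg k (field_gen k (set (coeffs (min_poly F z))))"
proof -
  define r where "r = n - m"
  define wt :: "nat \<Rightarrow> nat" where "wt i = (if i < r then 2 else 1)" for i
  have wt1: "wt i \<ge> 1" for i by (simp add: wt_def)
  have rm: "r \<le> m" using mn by (simp add: r_def)
  have sum_wt: "(\<Sum>i<m. wt i) = n"
    using sum_double_weights[OF rm] mn by (simp add: wt_def r_def)
  obtain u :: "nat \<Rightarrow> 'K ratfun alg_closure" where u: "\<exists>i<m. u i \<noteq> 0"
    "\<And>j. 1 \<le> j \<Longrightarrow> j < m \<Longrightarrow> coeff (\<Prod>i<m. [:- u i, 1:] ^ wt i) (n - j) = 0"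
    using weighted_roots_exist[OF mn(1), of wt, unfolded sum_wt] wt1 by blast
  define cst :: "'K ratfun alg_closure \<Rightarrow> 'K ratfun alg_closure ratfun fls"
    where "cst c = fls_const (rat_const c)" for c
  have u2: "coeff (\<Prod>i<m. [:- u i, 1:] ^ (if i < n - m then 2 else 1)) (n - j) = 0"
    if "1 \<le> j" "j < m" for j using u(2)[OF that] by (simp add: wt_def r_def)
  obtain A e \<Theta> where A: "alg_indep (range cst) {m..n} A"
    and e: "\<And>i. i < r \<Longrightarrow> e i \<noteq> 0" "\<And>i. i < r \<Longrightarrow> rat_exp (e i) = Poly_Mapping.single i 1"
    and \<Theta>: "\<And>i. i < r \<Longrightarrow> fls_reflect (\<Theta> i) \<noteq> \<Theta> i"
      "\<And>i. i < r \<Longrightarrow> lacunary_root m n (\<lambda>j. fls_square_subst (e i) (A j)) (\<Theta> i)"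
    using deformation_exists[OF mn u2 u(1)] unfolding cst_def r_def by blast
  have hcst: "hom_on UNIV cst"
    by (simp add: hom_on_def cst_def rat_const_1 rat_const_add rat_const_mult fls_plus_const fls_const_mult_const)
  \<comment> \<open>Two layers of rational functions: the inner one only supplies the residue field
    that contains the \<open>u i\<close>, and its variables count as constants; the variables of the
    outer one are the w_i.\<close>
  define emb where "emb x = cst (to_ac (rat_const x))" for x :: 'K
  have hemb: "hom_on UNIV emb"
    unfolding hom_on_def emb_def
    by (simp add: rat_const_1 rat_const_add rat_const_mult hom_1[OF subfield_UNIV hcst]
        hom_add[OF subfield_UNIV hcst] hom_mult[OF subfield_UNIV hcst])
  have hembk: "hom_on k emb" by (rule hom_on_subset[OF hemb]) simp
  note sk = subfield_subring[OF k]
  define k' where "k' = emb ` k"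
  have fk': "is_subfield k'" unfolding k'_def by (rule subfield_hom_image[OF k hembk])
  note sk' = subfield_subring[OF fk']
  have k'_cst: "k' \<subseteq> range cst" by (auto simp: k'_def emb_def)
  have E_eq: "E = field_gen k ((a(n := \<theta>)) ` {m..n})"
    unfolding E_def F_def using mn by (intro field_gen_root_exchange root) auto
  have a\<theta>: "alg_indep k {m..n} (a(n := \<theta>))"
    by (rule alg_indep_root_exchange[OF sk a _ root]) (use mn in auto)
  have fF: "is_subfield F" and fE: "is_subfield E" unfolding F_def E_def by (rule subfield_field_gen)+
  have kF: "k \<subseteq> F" and FE: "F \<subseteq> E" unfolding F_def E_def by (auto intro: field_gen_base)
  have aF: "a j \<in> F" if "j \<in> {m..n}" for j unfolding F_def using that by (intro field_gen_gen) auto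
  have \<theta>E: "\<theta> \<in> E" unfolding E_def by (intro field_gen_gen) simp
  obtain \<beta> where \<beta>: "hom_on F \<beta>" "\<forall>l\<in>k. \<beta> l = emb l" "\<forall>j\<in>{m..n}. \<beta> (a j) = A j"
    using hom_extend_indep[OF k hembk _ a alg_indep_base_mono[OF A k'_cst[unfolded k'_def]]]
    unfolding F_def by auto
  have \<theta>_alg: "alg_over F \<theta>"
  proof -
    define p where "p = monom 1 n + (\<Sum>j=m..n. monom (a j) (n - j))"
    have "poly p \<theta> = 0" using root by (simp add: p_def lacunary_root_def poly_sum poly_monom)
    moreover have "poly_over F p"
      unfolding p_def using aF
      by (intro poly_over_add[OF subfield_subring[OF fF]] poly_over_sum[OF subfield_subring[OF fF]]
          poly_over_monom[OF subfield_subring[OF fF]] subring_1[OF subfield_subring[OF fF]]) auto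
    moreover have "coeff p n = 1" unfolding p_def by (rule lacunary_coeff[OF mn(1)]) simp
    then have "p \<noteq> 0" by auto
    ultimately show ?thesis by (auto simp: alg_over_def)
  qed
  have "E \<subseteq> {x. alg_over F x}"
    unfolding E_def using \<theta>_alg alg_over_self[OF subfield_subring[OF fF]]
    by (intro field_gen_least subfield_alg_over[OF subfield_subring[OF fF]]) auto
  then have z_alg: "alg_over F z" using z(1) by blast
  define \<alpha> where "\<alpha> = set (coeffs (min_poly F z))"
  have mpoly: "is_min_poly F z (min_poly F z)" by (rule is_min_poly_min_poly[OF fF z_alg])
  have \<alpha>F: "\<alpha> \<subseteq> F" using mpoly by (simp add: is_min_poly_def \<alpha>_def)
  have z_cl: "z \<in> alg_cl k \<alpha>"
  proof -
    have "poly_over (field_gen k \<alpha>) (min_poly F z)"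
      unfolding poly_over_coeffs[OF subring_field_gen] by (auto simp: \<alpha>_def intro: field_gen_gen)
    moreover have "min_poly F z \<noteq> 0" "poly (min_poly F z) z = 0"
      using mpoly by (auto simp: is_min_poly_def)
    ultimately show ?thesis by (auto simp: alg_cl_def alg_over_def)
  qed
  have ex_D: "\<exists>D. D \<noteq> 0 \<and> D \<in> alg_cl k' (\<beta> ` \<alpha>) \<and> (\<forall>l. odd (lau_weight D (Suc l)) \<longleftrightarrow> l = i)"
    if i: "i < r" for i
  proof -
    let ?\<chi> = "fls_square_subst (e i)"
    note h\<chi> = hom_fls_square_subst[OF e(1)[OF i]]
    have \<chi>cst: "?\<chi> (cst c) = cst c" for c
      unfolding cst_def by (rule fls_square_subst_const[OF e(1)[OF i]])
    then have "?\<chi> ` range cst = range cst" by (auto simp: image_iff)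
    then have "alg_indep (range cst) {m..n} (\<lambda>j. ?\<chi> (A j))"
      using alg_indep_hom[OF h\<chi> _ _ _ A] subfield_subring[OF subfield_hom_image[OF subfield_UNIV hcst]] by simp
    then have "alg_indep (range cst) {m..n} ((\<lambda>j. ?\<chi> (A j))(n := \<Theta> i))"
      using mn by (intro alg_indep_root_exchange[OF subfield_subring[OF subfield_hom_image[OF subfield_UNIV hcst]] _ _ \<Theta>(2)[OF i]]) auto
    note ind = alg_indep_base_mono[OF this k'_cst[unfolded k'_def]]
    \<comment> \<open>The embedding of \<open>E\<close> is prescribed on the basis in which
      \<open>\<theta>\<close> replaces \<open>a n\<close>, which avoids extending
      \<open>\<beta>\<close> along an algebraic element. Its value at \<open>a n\<close> is then
      forced by the equation of the root.\<close>
    obtain \<iota> where \<iota>: "hom_on E \<iota>" "\<forall>l\<in>k. \<iota> l = emb l"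
      "\<forall>j\<in>{m..n}. \<iota> ((a(n := \<theta>)) j) = ((\<lambda>j. ?\<chi> (A j))(n := \<Theta> i)) j"
      using hom_extend_indep[OF k hembk _ a\<theta> ind] unfolding E_eq by auto
    have \<iota>\<theta>: "\<iota> \<theta> = \<Theta> i" using \<iota>(3) mn by (auto dest: bspec[of _ _ n])
    have \<iota>a: "\<iota> (a j) = ?\<chi> (A j)" if "m \<le> j" "j < n" for j using \<iota>(3) that by (auto dest: bspec[of _ _ j])
    have \<iota>an: "\<iota> (a n) = ?\<chi> (A n)"
    proof -
      note sE = subfield_subring[OF fE]
      have aE: "a j \<in> E" if "j \<in> {m..n}" for j using aF[OF that] FE by blast
      have "a n = - (\<theta> ^ n + (\<Sum>j=m..<n. a j * \<theta> ^ (n - j)))"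
        using root mn by (subst (asm) lacunary_root_last) auto
      then have "\<iota> (a n) = \<iota> (- (\<theta> ^ n + (\<Sum>j=m..<n. a j * \<theta> ^ (n - j))))" by simp
      also have "\<dots> = - \<iota> (\<theta> ^ n + (\<Sum>j=m..<n. a j * \<theta> ^ (n - j)))"
        by (intro hom_uminus[OF fE \<iota>(1)] subring_add[OF sE] subring_sum[OF sE] subring_mult[OF sE]
            subring_power[OF sE] \<theta>E aE) auto
      also have "\<iota> (\<theta> ^ n + (\<Sum>j=m..<n. a j * \<theta> ^ (n - j))) = \<iota> (\<theta> ^ n) + \<iota> (\<Sum>j=m..<n. a j * \<theta> ^ (n - j))"
        by (intro hom_add[OF fE \<iota>(1)] subring_sum[OF sE] subring_mult[OF sE]
            subring_power[OF sE] \<theta>E aE) auto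
      also have "\<iota> (\<Sum>j=m..<n. a j * \<theta> ^ (n - j)) = (\<Sum>j=m..<n. \<iota> (a j * \<theta> ^ (n - j)))"
        by (intro hom_sum[OF fE \<iota>(1)] subring_mult[OF sE] subring_power[OF sE] \<theta>E aE) auto
      also have "\<dots> = (\<Sum>j=m..<n. ?\<chi> (A j) * \<Theta> i ^ (n - j))"
      proof (intro sum.cong refl)
        fix j assume j: "j \<in> {m..<n}"
        have "\<iota> (a j * \<theta> ^ (n - j)) = \<iota> (a j) * \<iota> (\<theta> ^ (n - j))"
          using j by (intro hom_mult[OF fE \<iota>(1)] subring_power[OF sE] \<theta>E aE) auto
        then show "\<iota> (a j * \<theta> ^ (n - j)) = ?\<chi> (A j) * \<Theta> i ^ (n - j)"
          using \<iota>a j by (simp add: hom_power[OF fE \<iota>(1) \<theta>E] \<iota>\<theta>)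
      qed
      also have "\<iota> (\<theta> ^ n) = \<Theta> i ^ n" by (simp add: hom_power[OF fE \<iota>(1) \<theta>E] \<iota>\<theta>)
      also have "- (\<Theta> i ^ n + (\<Sum>j=m..<n. ?\<chi> (A j) * \<Theta> i ^ (n - j))) = ?\<chi> (A n)"
        using \<Theta>(2)[OF i] mn by (subst (asm) lacunary_root_last) auto
      finally show ?thesis .
    qed
    \<comment> \<open>On \<open>F\<close> the embedding is the map \<open>\<beta>\<close>, which
      does not depend on \<open>i\<close>, followed by the substitution. Hence the descended
      elements for all \<open>i\<close> are algebraic over one field, generated by the image of
      \<open>\<alpha>\<close> under \<open>\<beta>\<close>.\<close>
    have \<iota>F: "\<iota> x = ?\<chi> (\<beta> x)" if "x \<in> F" for x
      using that unfolding F_def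
    proof (rule hom_agree[rotated 4])
      show "hom_on (field_gen k (a ` {m..n})) \<iota>"
        using hom_on_subset[OF \<iota>(1) FE] by (simp add: F_def)
      show "hom_on (field_gen k (a ` {m..n})) (\<lambda>x. ?\<chi> (\<beta> x))"
        using \<beta>(1) h\<chi> by (simp add: F_def hom_on_def)
      show "\<iota> x = ?\<chi> (\<beta> x)" if "x \<in> k" for x using \<iota>(2) \<beta>(2) that \<chi>cst by (simp add: emb_def)
      show "\<iota> x = ?\<chi> (\<beta> x)" if "x \<in> a ` {m..n}" for x
        using that \<beta>(3) \<iota>a \<iota>an by (auto simp: le_less)
    qed
    define \<iota>' where "\<iota>' x = fls_reflect (\<iota> x)" for x
    have \<iota>': "hom_on E \<iota>'"
      using \<iota>(1)
      by (simp add: hom_on_def \<iota>'_def hom_1[OF subfield_UNIV hom_fls_reflect]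
        hom_add[OF subfield_UNIV hom_fls_reflect UNIV_I UNIV_I]
        hom_mult[OF subfield_UNIV hom_fls_reflect UNIV_I UNIV_I])
    have \<iota>'F: "\<iota>' x = ?\<chi> (\<beta> x)" if "x \<in> F" for x
      by (simp add: \<iota>'_def \<iota>F[OF that] fls_reflect_square_subst[OF e(1)[OF i]])
    \<comment> \<open>Here it enters that \<open>z\<close> generates \<open>E\<close>: the two
      embeddings agree on \<open>F\<close>, so agreement at \<open>z\<close> would give agreement at
      \<open>\<theta>\<close>, whose image the reflection moves.\<close>
    have "\<iota>' z \<noteq> \<iota> z"
    proof
      assume eq: "\<iota>' z = \<iota> z"
      have "\<iota>' \<theta> = \<iota> \<theta>"
      proof (rule hom_agree[of F "{z}"])
        show "hom_on (field_gen F {z}) \<iota>'" "hom_on (field_gen F {z}) \<iota>" using \<iota>' \<iota>(1) z(2) by auto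
        show "\<theta> \<in> field_gen F {z}" using \<theta>E z(2) by simp
      qed (use eq \<iota>'F \<iota>F in auto)
      then show False using \<Theta>(1)[OF i] by (simp add: \<iota>'_def \<iota>\<theta>)
    qed
    then have "fls_reflect (\<iota> z) \<noteq> \<iota> z" by (simp add: \<iota>'_def)
    then obtain D c where D: "?\<chi> D = (\<iota> z - \<iota>' z) ^ 2" "D \<noteq> 0" "odd (fls_subdegree D)" "c \<noteq> 0"
      "fls_nth D (fls_subdegree D) = c ^ 2 * e i powi fls_subdegree D"
      using square_descent[OF e(1)[OF i]] unfolding \<iota>'_def by metis
    have img: "\<iota> ` k = ?\<chi> ` k'" "\<iota> ` \<alpha> = ?\<chi> ` \<beta> ` \<alpha>" "\<iota>' ` k = ?\<chi> ` k'" "\<iota>' ` \<alpha> = ?\<chi> ` \<beta> ` \<alpha>"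
    proof -
      have "\<beta> ` k = k'" using \<beta>(2) by (auto simp: k'_def image_iff)
      moreover have "\<iota> ` B = ?\<chi> ` \<beta> ` B" "\<iota>' ` B = ?\<chi> ` \<beta> ` B" if "B \<subseteq> F" for B
        using \<iota>F \<iota>'F that by (auto simp: image_image intro!: image_cong)
      ultimately show "\<iota> ` k = ?\<chi> ` k'" "\<iota> ` \<alpha> = ?\<chi> ` \<beta> ` \<alpha>" "\<iota>' ` k = ?\<chi> ` k'" "\<iota>' ` \<alpha> = ?\<chi> ` \<beta> ` \<alpha>"
        using kF \<alpha>F by metis+
    qed
    have kE: "k \<subseteq> E" and \<alpha>E: "\<alpha> \<subseteq> E" using kF \<alpha>F FE by auto
    have "\<iota> z \<in> alg_cl (?\<chi> ` k') (?\<chi> ` \<beta> ` \<alpha>)" "\<iota>' z \<in> alg_cl (?\<chi> ` k') (?\<chi> ` \<beta> ` \<alpha>)"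
      using alg_cl_hom[OF \<iota>(1) fE kE \<alpha>E z(1) z_cl] alg_cl_hom[OF \<iota>' fE kE \<alpha>E z(1) z_cl]
      unfolding img by auto
    then have "?\<chi> D \<in> alg_cl (?\<chi> ` k') (?\<chi> ` \<beta> ` \<alpha>)"
      unfolding D(1) using subfield_subring[OF subfield_alg_cl] by (intro subring_power subring_diff) auto
    then have "D \<in> alg_cl k' (\<beta> ` \<alpha>)"
      by (rule alg_cl_hom_reflect[OF h\<chi> subfield_UNIV subset_UNIV subset_UNIV UNIV_I])
    \<comment> \<open>The square \<open>c ^ 2\<close> contributes an even exponent to every
      variable; the odd power of \<open>e i\<close> contributes an odd one to variable
      \<open>i\<close> and 0 to the others.\<close>
    moreover have "odd (lau_weight D (Suc l)) \<longleftrightarrow> l = i" for l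
    proof -
      have "Poly_Mapping.lookup (rat_exp (c ^ 2)) l = 2 * Poly_Mapping.lookup (rat_exp c) l"
        using rat_exp_powi[OF D(4), of 2 l] by simp
      moreover have "rat_exp (c ^ 2 * e i powi fls_subdegree D) =
          rat_exp (c ^ 2) + rat_exp (e i powi fls_subdegree D)"
        using D(4) e(1)[OF i] by (intro rat_exp_mult) auto
      ultimately have "lau_weight D (Suc l) = 2 * Poly_Mapping.lookup (rat_exp c) l +
          fls_subdegree D * Poly_Mapping.lookup (rat_exp (e i)) l"
        by (simp add: lau_weight_def D(5) lookup_add rat_exp_powi[OF e(1)[OF i]])
      then show ?thesis using D(3) by (auto simp: e(2)[OF i] lookup_single when_def)
    qed
    ultimately show ?thesis using D(2) by blast
  qed
  have "\<forall>i. \<exists>D. i < r \<longrightarrow> D \<noteq> 0 \<and> D \<in> alg_cl k' (\<beta> ` \<alpha>) \<and>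
      (\<forall>l. odd (lau_weight D (Suc l)) \<longleftrightarrow> l = i)"
  proof
    fix i
    show "\<exists>D. i < r \<longrightarrow> D \<noteq> 0 \<and> D \<in> alg_cl k' (\<beta> ` \<alpha>) \<and>
      (\<forall>l. odd (lau_weight D (Suc l)) \<longleftrightarrow> l = i)"
    proof (cases "i < r")
      case True
      from ex_D[OF this] obtain D where "D \<noteq> 0 \<and> D \<in> alg_cl k' (\<beta> ` \<alpha>) \<and>
        (\<forall>l. odd (lau_weight D (Suc l)) \<longleftrightarrow> l = i)" by (rule exE)
      then show ?thesis by (intro exI[of _ D] impI)
    qed simp
  qed
  from choice[OF this] obtain D where D': "\<forall>i. i < r \<longrightarrow> D i \<noteq> 0 \<and> D i \<in> alg_cl k' (\<beta> ` \<alpha>) \<and>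
      (\<forall>l. odd (lau_weight (D i) (Suc l)) \<longleftrightarrow> l = i)" by (rule exE)
  have D: "D i \<noteq> 0" "D i \<in> alg_cl k' (\<beta> ` \<alpha>)" "odd (lau_weight (D i) (Suc l)) \<longleftrightarrow> l = i"
    if "i < r" for i l
  proof -
    note Di = D'[THEN spec, THEN mp, OF that]
    show "D i \<noteq> 0" by (rule conjunct1[OF Di])
    show "D i \<in> alg_cl k' (\<beta> ` \<alpha>)" by (rule conjunct1[OF conjunct2[OF Di]])
    show "odd (lau_weight (D i) (Suc l)) \<longleftrightarrow> l = i" by (rule spec[OF conjunct2[OF conjunct2[OF Di]]])
  qed
  have "alg_indep (range cst) {..<r} D"
    unfolding cst_def by (rule alg_indep_lau_weight[where \<sigma> = Suc]) (use D in auto)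
  then have D_ind: "alg_indep k' {..<r} D" by (rule alg_indep_base_mono[OF _ k'_cst])
  \<comment> \<open>Transfer back to \<open>F\<close>: a transcendence basis \<open>J\<close> of the
    coefficients is mapped by \<open>\<beta>\<close> to a set over which the \<open>r\<close>
    independent elements \<open>D i\<close> are algebraic.\<close>
  obtain J where J: "J \<subseteq> \<alpha>" "alg_indep k J id" "id ` \<alpha> \<subseteq> alg_cl k (id ` J)"
    using alg_indep_extract[OF _ sk, of \<alpha> id] by (auto simp: \<alpha>_def)
  have finJ: "finite J" using J(1) by (auto simp: \<alpha>_def intro: finite_subset)
  have JF: "J \<subseteq> F" using J(1) \<alpha>F by blast
  have "\<beta> ` k = k'" using \<beta>(2) by (auto simp: k'_def image_iff)
  then have "\<beta> ` \<alpha> \<subseteq> alg_cl k' (\<beta> ` J)"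
    using alg_cl_hom[OF \<beta>(1) fF kF JF] \<alpha>F J(3) by auto
  from alg_cl_trans[OF this] have "D ` {..<r} \<subseteq> alg_cl k' (\<beta> ` J)" using D(2) by auto
  from alg_indep_card_le[OF _ sk' D_ind _ this] have "r \<le> card (\<beta> ` J)" using finJ by simp
  also have "\<dots> \<le> card J" using finJ by (rule card_image_le)
  also have "card J \<le> trdeg k (field_gen k \<alpha>)"
  proof (rule le_trdeg[OF sk _ _ _ finJ J(2)])
    show "finite \<alpha>" by (simp add: \<alpha>_def)
    show "field_gen k \<alpha> \<subseteq> alg_cl k \<alpha>" by (rule field_gen_subset_alg_cl)
    show "J \<subseteq> field_gen k \<alpha>" using J(1) field_gen_gen by blast
  qed
  finally show ?thesis by (simp add: r_def \<alpha>_def)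
qed

subsection \<open>The upper bound\<close>

lemma sum_distinct_degrees_nonzero:
  fixes t :: "'i \<Rightarrow> 'a::comm_ring_1 poly"
  assumes S: "finite S" "S \<noteq> {}" and nz: "\<And>l. l \<in> S \<Longrightarrow> t l \<noteq> 0" and inj: "inj_on (\<lambda>l. degree (t l)) S"
  shows "sum t S \<noteq> 0"
proof -
  have "Max ((\<lambda>l. degree (t l)) ` S) \<in> (\<lambda>l. degree (t l)) ` S" using S by (intro Max_in) auto
  then obtain l where l: "l \<in> S" "degree (t l) = Max ((\<lambda>l. degree (t l)) ` S)" by auto
  have "coeff (t j) (degree (t l)) = 0" if "j \<in> S - {l}" for j
  proof (rule coeff_eq_0)
    have "degree (t j) \<le> degree (t l)" unfolding l(2) using S that by (intro Max_ge) auto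
    moreover have "degree (t j) \<noteq> degree (t l)" using inj that l(1) by (auto simp: inj_on_def)
    ultimately show "degree (t j) < degree (t l)" by simp
  qed
  then have "coeff (sum t S) (degree (t l)) = lead_coeff (t l)"
    using S(1) l(1) by (simp add: coeff_sum sum.remove)
  then show ?thesis using nz[OF l(1)] by auto
qed

lemma poly_over_pcompose:
  assumes R: "is_subring R" and q: "poly_over R q"
  shows "poly_over R p \<Longrightarrow> poly_over R (pcompose p q)"
proof (induction p)
  case (pCons a p)
  then have "a \<in> R" "poly_over R p" using poly_over_pConsD[OF R] by auto
  then show ?case
    unfolding pcompose_pCons using pCons.IH
    by (intro poly_over_add[OF R] poly_over_mult[OF R] poly_over_pCons[OF R] poly_over_0[OF R] q) auto
qed (simp add: poly_over_0[OF R])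

lemma alg_indep_nonzero:
  assumes "is_subring k" "finite I" "alg_indep k I a" "j \<in> I"
  shows "a j \<noteq> 0"
proof -
  have "alg_indep k (insert j (I - {j})) a" using assms by (simp add: insert_absorb)
  then have "a j \<notin> alg_cl k (a ` (I - {j}))"
    using assms alg_indep_insert[of "I - {j}" j k a] by simp
  then show ?thesis using subring_0[OF subfield_subring[OF subfield_alg_cl]] by metis
qed

text \<open>Irreducibility of the lacunary polynomial: eliminating \<open>a n\<close> turns a relation of degree
  less than \<open>n\<close> into an expansion in powers of a polynomial of degree \<open>n\<close>.\<close>

lemma lacunary_root_degree:
  fixes a :: "nat \<Rightarrow> 'K::field"
  assumes k: "is_subfield k" and mn: "0 < m" "m < n" and a: "alg_indep k {m..n} a"
    and root: "lacunary_root m n a \<theta>"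
    and q: "q \<noteq> 0" "poly_over (field_gen k (a ` {m..n})) q" "poly q \<theta> = 0"
  shows "n \<le> degree q"
proof (rule ccontr)
  assume "\<not> n \<le> degree q"
  note sk = subfield_subring[OF k]
  define F0 where "F0 = field_gen k (a ` {m..<n})"
  have sF0: "is_subring F0" unfolding F0_def by (rule subring_field_gen)
  have ins: "{m..n} = insert n {m..<n}" using mn by auto
  define R where "R = {poly p (a n) | p. poly_over F0 p}"
  have R: "is_subring R" unfolding R_def by (rule subring_adjoin[OF sF0])
  have "field_gen k (a ` {m..n}) = field_gen F0 {a n}"
    unfolding F0_def field_gen_field_gen ins by simp
  also have "\<dots> = fractions R" unfolding R_def by (rule field_gen_simple[OF sF0])
  finally obtain d where d: "d \<in> R" "d \<noteq> 0" "poly_over R (smult d q)"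
    using poly_over_fractions[OF R] q(2) by metis
  define P where "P = smult d q"
  have P: "P \<noteq> 0" "poly_over R P" "poly P \<theta> = 0" "degree P < n"
    using d q \<open>\<not> n \<le> degree q\<close> by (auto simp: P_def)
  have "\<forall>i. \<exists>p. coeff P i = poly p (a n) \<and> poly_over F0 p"
    using P(2) by (auto simp: poly_over_def R_def)
  from choice[OF this] obtain g where g: "\<And>i. coeff P i = poly (g i) (a n)" "\<And>i. poly_over F0 (g i)" by blast
  define B where "B = - (monom 1 n + (\<Sum>j=m..<n. monom (a j) (n - j)))"
  have "a j \<in> F0" if "j \<in> {m..<n}" for j unfolding F0_def using that by (intro field_gen_gen) auto
  then have B_over: "poly_over F0 B"
    unfolding B_def
    by (intro poly_over_uminus[OF sF0] poly_over_add[OF sF0] poly_over_sum[OF sF0]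
        poly_over_monom[OF sF0] subring_1[OF sF0]) auto
  have B_\<theta>: "poly B \<theta> = a n"
    using root mn by (subst (asm) lacunary_root_last) (auto simp: B_def poly_sum poly_monom)
  have "coeff B n = - 1"
    unfolding B_def coeff_minus using lacunary_coeff[OF mn(1), of "{m..<n}" n a] by force
  moreover have "degree B \<le> n"
    unfolding B_def degree_minus
    by (intro degree_add_le degree_monom_le degree_sum_le) (auto intro: order.trans[OF degree_monom_le])
  ultimately have deg_B: "degree B = n" by (metis le_antisym le_degree neg_equal_0_iff_equal zero_neq_one)
  \<comment> \<open>With \<open>a n\<close> replaced by \<open>B\<close>, whose value at
    \<open>\<theta>\<close> it is, the term of index \<open>l\<close> has degree
    \<open>degree (g l) * n + l\<close>. As \<open>l < n\<close>, these degrees differ modulo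
    \<open>n\<close>, the sum is nonzero, and \<open>\<theta>\<close> would be algebraic over the
    field of the other coefficients.\<close>
  define t where "t l = pcompose (g l) B * monom 1 l" for l
  define S where "S = {l. l \<le> degree P \<and> g l \<noteq> 0}"
  have deg_t: "t l \<noteq> 0 \<and> degree (t l) = degree (g l) * n + l" if "l \<in> S" for l
  proof -
    have "pcompose (g l) B \<noteq> 0"
      using that pcompose_eq_0[of "g l" B] deg_B mn by (auto simp: S_def)
    then show ?thesis
      by (simp add: t_def degree_mult_eq degree_monom_eq degree_pcompose deg_B monom_eq_0_iff)
  qed
  have "sum t S \<noteq> 0"
  proof (rule sum_distinct_degrees_nonzero)
    show "finite S" by (simp add: S_def)
    have "g (degree P) \<noteq> 0" using g(1)[of "degree P"] P(1) by auto
    then show "S \<noteq> {}" by (auto simp: S_def)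
    show "t l \<noteq> 0" if "l \<in> S" for l using deg_t[OF that] by simp
    show "inj_on (\<lambda>l. degree (t l)) S"
    proof (rule inj_onI)
      fix l l' assume l: "l \<in> S" "l' \<in> S" "degree (t l) = degree (t l')"
      then have "(degree (g l) * n + l) mod n = (degree (g l') * n + l') mod n" using deg_t by simp
      then show "l = l'" using l(1,2) P(4) by (simp add: S_def)
    qed
  qed
  moreover have "poly_over F0 (sum t S)"
    unfolding t_def
    by (intro poly_over_sum[OF sF0] poly_over_mult[OF sF0] poly_over_pcompose[OF sF0 B_over] g(2)
        poly_over_monom[OF sF0] subring_1[OF sF0])
  moreover have "poly (sum t S) \<theta> = 0"
  proof -
    have "poly (sum t S) \<theta> = (\<Sum>l\<in>S. coeff P l * \<theta> ^ l)"
      by (simp add: poly_sum t_def poly_pcompose B_\<theta> poly_monom g(1))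
    also have "\<dots> = (\<Sum>l\<le>degree P. coeff P l * \<theta> ^ l)"
      by (intro sum.mono_neutral_left) (auto simp: S_def g(1))
    finally show ?thesis using P(3) by (simp add: poly_altdef)
  qed
  ultimately have "alg_over F0 \<theta>" by (auto simp: alg_over_def)
  moreover have "\<theta> \<notin> alg_cl k ((a(n := \<theta>)) ` {m..<n})"
  proof -
    have "alg_indep k (insert n {m..<n}) (a(n := \<theta>))"
      unfolding ins[symmetric] using mn by (intro alg_indep_root_exchange[OF sk a _ root]) auto
    from alg_indep_insert[THEN iffD1, OF _ _ sk this] show ?thesis by simp
  qed
  moreover have "(a(n := \<theta>)) ` {m..<n} = a ` {m..<n}" by (intro image_cong) auto
  ultimately show False by (simp add: alg_cl_def F0_def)
qed

theorem trdeg_min_poly_attained: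
  fixes a :: "nat \<Rightarrow> 'K::field"
  assumes k: "is_subfield k" and mn: "0 < m" "m < n" and a: "alg_indep k {m..n} a"
    and root: "lacunary_root m n a \<theta>"
  defines "F \<equiv> field_gen k (a ` {m..n})"
  defines "E \<equiv> field_gen F {\<theta>}"
  shows "\<exists>z\<in>E. field_gen F {z} = E \<and> trdeg k (field_gen k (set (coeffs (min_poly F z)))) \<le> n - m"
proof -
  note sk = subfield_subring[OF k]
  have fF: "is_subfield F" and fE: "is_subfield E" unfolding F_def E_def by (rule subfield_field_gen)+
  note sF = subfield_subring[OF fF] and sE = subfield_subring[OF fE]
  have kF: "k \<subseteq> F" and FE: "F \<subseteq> E" unfolding F_def E_def by (auto intro: field_gen_base)
  have aF: "a j \<in> F" if "j \<in> {m..n}" for j unfolding F_def using that by (intro field_gen_gen) auto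
  have \<theta>E: "\<theta> \<in> E" unfolding E_def by (intro field_gen_gen) simp
  \<comment> \<open>Passing from \<open>\<theta>\<close> to \<open>\<mu> * \<theta>\<close>
    multiplies \<open>a j\<close> by the power \<open>j\<close> of \<open>\<mu>\<close>; this
    \<open>\<mu>\<close> makes the new coefficients of indices \<open>n - 1\<close> and
    \<open>n\<close> equal. Since \<open>m < n\<close>, the index \<open>n - 1\<close> is still in
    range, so the indices \<open>m, ..., n - 1\<close> suffice for \<open>T\<close>.\<close>
  define \<mu> where "\<mu> = a (n - 1) / a n"
  have nz: "a n \<noteq> 0" "a (n - 1) \<noteq> 0"
    using mn alg_indep_nonzero[OF sk _ a, of n] alg_indep_nonzero[OF sk _ a, of "n - 1"] by auto
  then have \<mu>0: "\<mu> \<noteq> 0" by (simp add: \<mu>_def)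
  have \<mu>F: "\<mu> \<in> F" unfolding \<mu>_def using mn by (intro subfield_divide[OF fF] aF) auto
  define z where "z = \<mu> * \<theta>"
  have zE: "z \<in> E" unfolding z_def using \<mu>F FE \<theta>E by (intro subring_mult[OF sE]) auto
  have gen: "field_gen F {z} = E"
  proof
    show "field_gen F {z} \<subseteq> E" using zE FE by (intro field_gen_least fE) auto
    have "z / \<mu> \<in> field_gen F {z}"
      using \<mu>F by (intro subfield_divide[OF subfield_field_gen]) (auto intro: field_gen_base field_gen_gen)
    then have "\<theta> \<in> field_gen F {z}" using \<mu>0 by (simp add: z_def)
    then show "E \<subseteq> field_gen F {z}"
      unfolding E_def by (intro field_gen_least subfield_field_gen) (auto intro: field_gen_base)
  qed
  define p where "p = monom 1 n + (\<Sum>j=m..n. monom (a j * \<mu> ^ j) (n - j))"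
  have pF: "poly_over F p"
    unfolding p_def using aF \<mu>F
    by (intro poly_over_add[OF sF] poly_over_sum[OF sF] poly_over_monom[OF sF] subring_mult[OF sF]
        subring_power[OF sF] subring_1[OF sF]) auto
  have coeff_n: "coeff p n = 1" unfolding p_def by (rule lacunary_coeff[OF mn(1)]) simp
  have "degree p \<le> n"
    unfolding p_def
    by (intro degree_add_le degree_monom_le degree_sum_le) (auto intro: order.trans[OF degree_monom_le])
  then have deg_p: "degree p = n" using coeff_n by (metis le_antisym le_degree zero_neq_one)
  have "poly p z = \<mu> ^ n * (\<theta> ^ n + (\<Sum>j=m..n. a j * \<theta> ^ (n - j)))"
  proof -
    have "a j * \<mu> ^ j * (\<mu> * \<theta>) ^ (n - j) = \<mu> ^ n * (a j * \<theta> ^ (n - j))" if "j \<in> {m..n}" for j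
    proof -
      have "\<mu> ^ n = \<mu> ^ j * \<mu> ^ (n - j)" using that by (simp flip: power_add)
      then show ?thesis by (simp add: power_mult_distrib mult_ac)
    qed
    then have "(\<Sum>j=m..n. a j * \<mu> ^ j * (\<mu> * \<theta>) ^ (n - j)) = (\<Sum>j=m..n. \<mu> ^ n * (a j * \<theta> ^ (n - j)))"
      by (rule sum.cong[OF refl])
    then have "poly p z = (\<mu> * \<theta>) ^ n + (\<Sum>j=m..n. \<mu> ^ n * (a j * \<theta> ^ (n - j)))"
      by (simp add: p_def z_def poly_sum poly_monom)
    then show ?thesis by (simp only: power_mult_distrib sum_distrib_left distrib_left)
  qed
  then have pz: "poly p z = 0" using root by (simp add: lacunary_root_def)
  have "is_min_poly F z p"
    unfolding is_min_poly_def poly_over_coeffs[OF sF, symmetric] deg_p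
  proof (intro conjI allI impI)
    fix q assume q: "q \<noteq> 0 \<and> poly_over F q \<and> poly q z = 0"
    \<comment> \<open>The substitution of \<open>\<mu> x\<close> for x turns a relation for
      \<open>z\<close> into one for \<open>\<theta>\<close> of the same degree.\<close>
    let ?q = "pcompose q [:0, \<mu>:]"
    have "n \<le> degree ?q"
    proof (rule lacunary_root_degree[OF k mn a root])
      show "?q \<noteq> 0" using q \<mu>0 pcompose_eq_0[of q "[:0, \<mu>:]"] by auto
      show "poly_over (field_gen k (a ` {m..n})) ?q"
        unfolding F_def[symmetric] using q \<mu>F
        by (intro poly_over_pcompose[OF sF] poly_over_pCons[OF sF] poly_over_0[OF sF] subring_0[OF sF]) auto
      show "poly ?q \<theta> = 0" using q by (simp add: poly_pcompose z_def mult.commute)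
    qed
    then show "n \<le> degree q" using \<mu>0 by (simp add: degree_pcompose)
  qed (use pF pz coeff_n deg_p in auto)
  then have mp_eq: "min_poly F z = p" by (rule min_poly_eqI[OF sF])
  define T where "T = (\<lambda>j. a j * \<mu> ^ j) ` {m..<n}"
  note sT = subring_field_gen[of k T]
  have "a j * \<mu> ^ j \<in> field_gen k T" if "j \<in> {m..n}" for j
  proof (cases "j = n")
    case True
    have "a n * \<mu> ^ n = a n * \<mu> * \<mu> ^ (n - 1)" using mn by (cases n) auto
    also have "\<dots> = a (n - 1) * \<mu> ^ (n - 1)" using nz by (simp add: \<mu>_def)
    finally show ?thesis using True mn by (auto simp: T_def intro!: field_gen_gen)
  next
    case False
    then show ?thesis using that by (intro field_gen_gen) (auto simp: T_def)
  qed
  then have "poly_over (field_gen k T) p"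
    unfolding p_def
    by (intro poly_over_add[OF sT] poly_over_sum[OF sT] poly_over_monom[OF sT] subring_1[OF sT]) auto
  then have "set (coeffs p) \<subseteq> field_gen k T" by (simp add: poly_over_coeffs[OF sT])
  then have "field_gen k (set (coeffs p)) \<subseteq> field_gen k T"
    by (intro field_gen_least subfield_field_gen) (auto intro: field_gen_base)
  then have "field_gen k (set (coeffs p)) \<subseteq> alg_cl k T" using field_gen_subset_alg_cl by blast
  then have "trdeg k (field_gen k (set (coeffs p))) \<le> card T"
    by (intro trdeg_le[OF sk]) (auto simp: T_def)
  also have "\<dots> \<le> card {m..<n}" unfolding T_def by (intro card_image_le) auto
  finally show ?thesis using zE gen mp_eq by (intro bexI[of _ z]) auto
qed

theorem theorem9p1:
  fixes k :: "'K::field_char_0 set" and a :: "nat \<Rightarrow> 'K" and \<theta> :: 'K and m n :: nat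
  assumes "is_subfield k"
    and "0 < m" and "n \<le> 2 * m" and "m \<le> n - 1"
    and "alg_indep k {m..n} a"
    and "poly (monom 1 n + (\<Sum>i=m..n. monom (a i) (n - i))) \<theta> = 0"
  shows "tau k (field_gen k (a ` {m..n})) (field_gen (field_gen k (a ` {m..n})) {\<theta>}) = n - m"
proof -
  have mn: "m < n" using assms(2,4) by linarith
  have root: "lacunary_root m n a \<theta>"
    using assms(6) by (simp add: lacunary_root_def poly_sum poly_monom)
  let ?F = "field_gen k (a ` {m..n})"
  let ?E = "field_gen ?F {\<theta>}"
  note lower = trdeg_min_poly_ge[OF assms(1-3) mn assms(5) root]
  obtain z where z: "z \<in> ?E" "field_gen ?F {z} = ?E"
    "trdeg k (field_gen k (set (coeffs (min_poly ?F z)))) \<le> n - m"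
    using trdeg_min_poly_attained[OF assms(1,2) mn assms(5) root] by blast
  have "n - m = trdeg k (field_gen k (set (coeffs (min_poly ?F z))))"
    using lower[OF z(1,2)] z(3) by (rule le_antisym)
  then show ?thesis
    unfolding tau_def using z(1,2) lower by (intro Least_equality) auto
qed

end
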